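(* There exists a constant $C>0$ such that for every odd $n$ and every even $k$ with $2\le k<n$, $$\frac{C}{\sqrt{k\log k}}\le\max_{\mathbb{Q}\in\mathcal{A}(n,k,\frac12)}\left|\mathbb{Q}(\mathrm{Maj}_n=1)-\frac12\right|\le\frac{2\sqrt2}{\sqrt k}.$$ Moreover, for odd $n$, when $\mathbb{Q}_0\in\mathcal{A}(n,n-1,\frac12)$ is the XOR0 distribution, $\left|\mathbb{Q}_0(\mathrm{Maj}_n=1)-\frac12\right|\ge\frac{1}{3\sqrt n}$.
   Context: $\mathcal{A}(n,k,p)$ is the set of all probability distributions $\mathbb{Q}$ of $n$ bits $(X_1,\ldots,X_n)\in\{0,1\}^n$ that are $k$-wise independent (every subset of at most $k$ of the bits is independent) and satisfy $\mathbb{Q}(X_i=1)=p$ for all $i$. $\mathrm{Maj}_n$ ($n$ odd) is the majority function on $n$ bits: its output is the bit occurring more often in the input. XOR0 is the distribution on $(X_1,\ldots,X_n)$ in which $X_1,\ldots,X_{n-1}$ are i.i.d. uniform bits and $X_n\equiv\sum_{i=1}^{n-1}X_i \pmod 2$. *)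

theory Defs
  imports "HOL-Probability.Probability"
begin

text \<open>
  Bits are Booleans (\<^const>\<open>True\<close> is 1), and an element of $\{0,1\}^n$ is a function on the
  indices \<open>1, \<dots>, n\<close>, extended by \<^const>\<open>False\<close> to all other natural numbers.
\<close>

definition bit_vectors :: "nat \<Rightarrow> (nat \<Rightarrow> bool) set" where
  "bit_vectors n = PiE_dflt {1..n} False (\<lambda>_. UNIV)"

definition kwise_indep :: "nat \<Rightarrow> nat \<Rightarrow> (nat \<Rightarrow> bool) pmf \<Rightarrow> bool" where
  "kwise_indep n k Q \<longleftrightarrow>
     (\<forall>S \<subseteq> {1..n}. card S \<le> k \<longrightarrow>
        prob_space.indep_vars (measure_pmf Q) (\<lambda>_. count_space UNIV) (\<lambda>i x. x i) S)"

definition kwise_dists :: "nat \<Rightarrow> nat \<Rightarrow> real \<Rightarrow> (nat \<Rightarrow> bool) pmf set" where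
  "kwise_dists n k p =
     {Q. set_pmf Q \<subseteq> bit_vectors n \<and> kwise_indep n k Q \<and>
         (\<forall>i\<in>{1..n}. measure_pmf.prob Q {x. x i} = p)}"

text \<open>Only used for odd \<open>n\<close>, where there are no ties.\<close>

definition maj :: "nat \<Rightarrow> (nat \<Rightarrow> bool) \<Rightarrow> bool" where
  "maj n x \<longleftrightarrow> card {i\<in>{1..n}. x i} > card {i\<in>{1..n}. \<not> x i}"

definition maj_bias :: "nat \<Rightarrow> (nat \<Rightarrow> bool) pmf \<Rightarrow> real" where
  "maj_bias n Q = \<bar>measure_pmf.prob Q {x. maj n x} - 1 / 2\<bar>"

definition xor0 :: "nat \<Rightarrow> (nat \<Rightarrow> bool) pmf" where
  "xor0 n =
     map_pmf (\<lambda>x. x(n := odd (\<Sum>i=1..n-1. of_bool (x i) :: nat)))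
       (Pi_pmf {1..n-1} False (\<lambda>_. bernoulli_pmf (1 / 2)))"

end

theory Submission
  imports Defs
begin

text \<open>
  Write \<open>S\<close> for the sum of the bits as signs, \<open>U\<close> for the uniform distribution and \<open>chi T\<close> for the
  product of the signs in \<open>T\<close>. A distribution is \<open>k\<close>-wise independent with fair bits iff it annihilates
  every \<open>chi T\<close> with \<open>1 \<le> |T| \<le> k\<close>; it then has the same expectation as \<open>U\<close> on every polynomial in \<open>S\<close> of
  degree at most \<open>k\<close>.

  Upper bound. If \<open>t\<close> is an even polynomial with simple real zeros and \<open>t(0) = 1\<close>, then Hermite interpolation
  at its zeros gives a majorant \<open>P\<close> of the step function with \<open>P(y) + P(-y) = 1 + t(y)\<^sup>2\<close>, so the bias is at most
  half the uniform mean of \<open>t(S)\<^sup>2\<close>. Choose \<open>t\<close> of Fejer type, \<open>t(M sin \<phi>) = sin(m\<phi>) / (m sin \<phi>)\<close> with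
  \<open>m\<close> about \<open>k/2\<close> and \<open>M\<^sup>2 = 3nm\<close>.

  Lower bound. For \<open>n < 32k\<close> use XOR0. For larger \<open>n\<close> perturb the uniform density by \<open>f = sin(\<theta>S)\<close>, with
  \<open>sin\<^sup>2 \<theta> = 32k/n\<close>. Its squared low-degree Fourier weight is a lower tail of a binomial law of mean \<open>32k\<close>, hence
  exponentially small in \<open>k\<close>, and by hypercontractivity it can be cancelled by a function that is bounded by an
  exponentially small constant. The correlation of \<open>f\<close> with majority is of order \<open>1/\<surd>k\<close>, so the argument even
  saves the factor \<open>\<surd>(log k)\<close>.

  The maximum exists because the weights form a compact set.
\<close>

section \<open>The discrete cube\<close>

text \<open>The degree fixes both scales of the upper bound. Beyond \<open>|y| = M\<close> the
  square of the polynomial grows like \<open>(2y/M)^(2N)\<close> with \<open>N = 2j\<close>, and the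
  subgaussian moments of \<open>S\<close> keep its mean bounded once \<open>M^2\<close> exceeds
  about \<open>(8/e) N n\<close>; the factor 3 is just above \<open>8/e\<close>. Inside,
  \<open>t\<close> decays like \<open>a/|y|\<close> with \<open>a = M/m\<close>. Each value of
  \<open>S\<close> has probability of order at most 1/sqrt n, so the mean of \<open>t^2\<close> is
  of order \<open>a\<close>/sqrt n, that is 1/sqrt m.

  The obstacle of the lower bound is positivity. The low-degree part of the sine wave is small in L2
  only, while a density needs a pointwise bound. Hypercontractivity buys this for a factor
  \<open>3^k\<close>, so the low-degree norm has to beat \<open>3^(-k)\<close>. This forces
  \<open>n sin^2 \<theta>\<close> to be a large multiple of \<open>k\<close>; 32 is a convenient
  one, and its size costs only a constant factor in the correlation with majority. Since
  \<open>sin^2 \<theta>\<close> is at most 1, \<open>n\<close> must be at least \<open>32k\<close>;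
  below that threshold 1/sqrt n and 1/sqrt k are comparable.\<close>

definition bsgn :: "bool \<Rightarrow> real" where
  "bsgn b = (if b then 1 else - 1)"

definition chi :: "nat set \<Rightarrow> (nat \<Rightarrow> bool) \<Rightarrow> real" where
  "chi T x = (\<Prod>i\<in>T. bsgn (x i))"

definition ssum :: "nat \<Rightarrow> (nat \<Rightarrow> bool) \<Rightarrow> real" where
  "ssum n x = (\<Sum>i=1..n. bsgn (x i))"

definition avg :: "nat \<Rightarrow> ((nat \<Rightarrow> bool) \<Rightarrow> real) \<Rightarrow> real" where
  "avg n F = (\<Sum>x\<in>bit_vectors n. F x) / 2 ^ n"

lemma bsgn_simps [simp]: "bsgn True = 1" "bsgn False = - 1" "bsgn b * bsgn b = 1" "\<bar>bsgn b\<bar> = 1"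
  by (auto simp: bsgn_def)

lemma chi_empty [simp]: "chi {} x = 1"
  by (simp add: chi_def)

lemma chi_sq [simp]: "chi T x * chi T x = 1"
  by (simp add: chi_def prod.distrib[symmetric])

lemma abs_chi [simp]: "\<bar>chi T x\<bar> = 1"
  by (simp add: chi_def abs_prod)

lemma chi_mult:
  assumes "finite T" "finite T'"
  shows "chi T x * chi T' x = chi (sym_diff T T') x"
proof -
  have 1: "chi T x = chi (T - T') x * chi (T \<inter> T') x"
    unfolding chi_def by (subst prod.union_disjoint[symmetric]) (use assms in \<open>auto intro!: prod.cong\<close>)
  have 2: "chi T' x = chi (T' - T) x * chi (T \<inter> T') x"
    unfolding chi_def by (subst prod.union_disjoint[symmetric]) (use assms in \<open>auto intro!: prod.cong\<close>)
  have 3: "chi (sym_diff T T') x = chi (T - T') x * chi (T' - T) x"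
    unfolding chi_def by (subst prod.union_disjoint) (use assms in auto)
  have "chi T x * chi T' x = chi (T - T') x * chi (T' - T) x * (chi (T \<inter> T') x * chi (T \<inter> T') x)"
    by (simp only: 1 2 mult_ac)
  then show ?thesis by (simp add: 3)
qed

lemma bit_vectors_alt: "bit_vectors n = {x. \<forall>i. i \<notin> {1..n} \<longrightarrow> \<not> x i}"
  by (auto simp: bit_vectors_def PiE_dflt_def)

lemma finite_bit_vectors [simp, intro]: "finite (bit_vectors n)"
  unfolding bit_vectors_def by (rule finite_PiE_dflt) auto

lemma card_bit_vectors [simp]: "card (bit_vectors n) = 2 ^ n"
  unfolding bit_vectors_def by (subst card_PiE_dflt) (auto simp: card_UNIV_bool)

lemma bit_vectors_0: "bit_vectors 0 = {\<lambda>_. False}"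
  by (auto simp: bit_vectors_alt)

text \<open>Vectors are \<open>False\<close> beyond their length, so a vector of length
  \<open>n\<close> is already its own extension by a \<open>False\<close> bit; only the
  \<open>True\<close> extension needs an update.\<close>

lemma sum_bit_vectors_Suc:
  fixes F :: "(nat \<Rightarrow> bool) \<Rightarrow> 'a::comm_monoid_add"
  shows "(\<Sum>x\<in>bit_vectors (Suc n). F x) = (\<Sum>x\<in>bit_vectors n. F x + F (x(Suc n := True)))"
proof -
  have eq: "bit_vectors (Suc n) = bit_vectors n \<union> (\<lambda>x. x(Suc n := True)) ` bit_vectors n"
  proof (intro set_eqI iffI)
    fix x assume x: "x \<in> bit_vectors (Suc n)"
    show "x \<in> bit_vectors n \<union> (\<lambda>x. x(Suc n := True)) ` bit_vectors n"
    proof (cases "x (Suc n)")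
      case True
      then have "x = (x(Suc n := False))(Suc n := True)" by (simp add: fun_upd_idem)
      moreover have "x(Suc n := False) \<in> bit_vectors n" using x by (auto simp: bit_vectors_alt)
      ultimately show ?thesis by blast
    next
      case False
      then have "x \<in> bit_vectors n" using x by (auto simp: bit_vectors_alt) (metis le_SucE)
      then show ?thesis by blast
    qed
  qed (auto simp: bit_vectors_alt)
  have inj: "inj_on (\<lambda>x. x(Suc n := True)) (bit_vectors n)"
  proof (rule inj_onI)
    fix x y assume xy: "x \<in> bit_vectors n" "y \<in> bit_vectors n" "x(Suc n := True) = y(Suc n := True)"
    show "x = y"
    proof
      fix i show "x i = y i"
      proof (cases "i = Suc n")
        case True
        then show ?thesis using xy(1,2) by (simp add: bit_vectors_alt)
      next
        case False
        then show ?thesis using fun_cong[OF xy(3), of i] by simp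
      qed
    qed
  qed
  have disj: "bit_vectors n \<inter> (\<lambda>x. x(Suc n := True)) ` bit_vectors n = {}"
    by (auto simp: bit_vectors_alt dest: spec[of _ "Suc n"])
  show ?thesis
    unfolding eq by (subst sum.union_disjoint) (auto simp: disj sum.reindex[OF inj] sum.distrib)
qed

lemma bit_vectors_Suc_False: "x \<in> bit_vectors n \<Longrightarrow> \<not> x (Suc n)"
  by (auto simp: bit_vectors_alt)

text \<open>Independence of the bits in algebraic form; over a general semiring because the Fourier
  coefficients of sine waves apply it to complex numbers.\<close>

lemma sum_prod_bit_vectors:
  fixes g :: "nat \<Rightarrow> bool \<Rightarrow> 'a::comm_semiring_1"
  shows "(\<Sum>x\<in>bit_vectors n. \<Prod>i=1..n. g i (x i)) = (\<Prod>i=1..n. g i False + g i True)"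
proof (induction n)
  case 0
  show ?case by (simp add: bit_vectors_0)
next
  case (Suc n)
  have "(\<Sum>x\<in>bit_vectors (Suc n). \<Prod>i=1..Suc n. g i (x i))
      = (\<Sum>x\<in>bit_vectors n. (\<Prod>i=1..n. g i (x i)) * (g (Suc n) False + g (Suc n) True))"
    unfolding sum_bit_vectors_Suc
    by (intro sum.cong) (auto simp: bit_vectors_Suc_False distrib_left)
  also have "\<dots> = (\<Prod>i=1..Suc n. g i False + g i True)"
    unfolding sum_distrib_right[symmetric] Suc.IH by simp
  finally show ?case .
qed

lemma avg_prod:
  "avg n (\<lambda>x. \<Prod>i=1..n. g i (x i)) = (\<Prod>i=1..n. (g i False + g i True) / 2)"
  unfolding avg_def sum_prod_bit_vectors by (simp add: prod_dividef)

lemma avg_Suc: "avg (Suc n) F = avg n (\<lambda>x. (F x + F (x(Suc n := True))) / 2)"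
  unfolding avg_def sum_bit_vectors_Suc by (simp add: sum_divide_distrib)

lemma avg_add: "avg n (\<lambda>x. F x + G x) = avg n F + avg n G"
  by (simp add: avg_def sum.distrib add_divide_distrib)

lemma avg_diff: "avg n (\<lambda>x. F x - G x) = avg n F - avg n G"
  by (simp add: avg_def sum_subtractf diff_divide_distrib)

lemma avg_cmult: "avg n (\<lambda>x. c * F x) = c * avg n F"
  by (simp add: avg_def sum_distrib_left)

lemma avg_sum: "avg n (\<lambda>x. \<Sum>i\<in>I. F i x) = (\<Sum>i\<in>I. avg n (F i))"
  unfolding avg_def by (subst sum.swap) (simp add: sum_divide_distrib)

lemma avg_const [simp]: "avg n (\<lambda>_. c) = c"
  by (simp add: avg_def)

lemma avg_mono: "(\<And>x. x \<in> bit_vectors n \<Longrightarrow> F x \<le> G x) \<Longrightarrow> avg n F \<le> avg n G"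
  unfolding avg_def by (intro divide_right_mono sum_mono) auto

lemma avg_cong: "(\<And>x. x \<in> bit_vectors n \<Longrightarrow> F x = G x) \<Longrightarrow> avg n F = avg n G"
  unfolding avg_def by simp

lemma avg_nonneg: "(\<And>x. x \<in> bit_vectors n \<Longrightarrow> 0 \<le> F x) \<Longrightarrow> 0 \<le> avg n F"
  using avg_mono[of n "\<lambda>_. 0" F] by simp

lemma chi_conv_prod:
  assumes "T \<subseteq> {1..n}"
  shows "chi T x = (\<Prod>i=1..n. if i \<in> T then bsgn (x i) else 1)"
  unfolding chi_def using assms by (subst prod.If_cases) (auto intro!: prod.cong)

lemma avg_chi:
  assumes "T \<subseteq> {1..n}"
  shows "avg n (chi T) = (if T = {} then 1 else 0)"
proof -
  have "avg n (chi T) = (\<Prod>i=1..n. ((if i \<in> T then bsgn False else 1) + (if i \<in> T then bsgn True else 1)) / 2)"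
    unfolding chi_conv_prod[OF assms] by (rule avg_prod)
  also have "\<dots> = (\<Prod>i=1..n. if i \<in> T then 0 else 1)"
    by (intro prod.cong) auto
  also have "\<dots> = (if T = {} then 1 else 0)"
    using assms by (auto simp: prod_zero_iff)
  finally show ?thesis .
qed

lemma avg_chi_mult:
  assumes "T \<subseteq> {1..n}" "T' \<subseteq> {1..n}"
  shows "avg n (\<lambda>x. chi T x * chi T' x) = (if T = T' then 1 else 0)"
proof -
  have fin: "finite T" "finite T'" using assms finite_subset by auto
  have "avg n (\<lambda>x. chi T x * chi T' x) = avg n (chi (sym_diff T T'))"
    using chi_mult[OF fin] by simp
  also have "\<dots> = (if T = T' then 1 else 0)"
    using assms by (subst avg_chi) auto
  finally show ?thesis .
qed

lemma ssum_conv_card: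
  "ssum n x = 2 * real (card {i\<in>{1..n}. x i}) - real n"
proof -
  have "ssum n x = (\<Sum>i=1..n. 2 * of_bool (x i) - 1)"
    unfolding ssum_def by (intro sum.cong) auto
  also have "\<dots> = 2 * (\<Sum>i=1..n. of_bool (x i)) - real n"
    by (simp add: sum_subtractf sum_distrib_left)
  also have "(\<Sum>i=1..n. of_bool (x i)) = real (card {i\<in>{1..n}. x i})"
    by (subst sum_of_bool_eq) (auto simp: Int_def)
  finally show ?thesis .
qed

lemma maj_iff: "maj n x \<longleftrightarrow> ssum n x > 0"
proof -
  have "card {i\<in>{1..n}. x i} + card {i\<in>{1..n}. \<not> x i} = n"
    using card_Int_Diff[of "{1..n}" "{i. x i}"] by (simp add: Int_def set_diff_eq)
  then show ?thesis unfolding maj_def ssum_conv_card by linarith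
qed

lemma avg_ssum:
  fixes G :: "real \<Rightarrow> real"
  shows "avg n (\<lambda>x. G (ssum n x)) = (\<Sum>j\<le>n. real (n choose j) * G (2 * real j - real n)) / 2 ^ n"
proof -
  have "(\<Sum>x\<in>bit_vectors n. G (ssum n x)) = (\<Sum>S\<in>Pow {1..n}. G (2 * real (card S) - real n))"
    by (rule sum.reindex_bij_witness[where i="\<lambda>S i. i \<in> S" and j="\<lambda>x. {i\<in>{1..n}. x i}"])
       (auto simp: bit_vectors_alt ssum_conv_card)
  also have "\<dots> = (\<Sum>j\<le>n. \<Sum>S\<in>{S\<in>Pow {1..n}. card S = j}. G (2 * real (card S) - real n))"
    by (rule sum.group[symmetric]) (auto intro: card_mono[of "{1..n}", simplified])
  also have "\<dots> = (\<Sum>j\<le>n. real (n choose j) * G (2 * real j - real n))"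
  proof (intro sum.cong refl)
    fix j assume "j \<in> {..n}"
    have "card {S\<in>Pow {1..n}. card S = j} = n choose j"
      using n_subsets[of "{1..n}" j] by (simp add: Pow_def)
    then show "(\<Sum>S\<in>{S\<in>Pow {1..n}. card S = j}. G (2 * real (card S) - real n)) = real (n choose j) * G (2 * real j - real n)"
      by simp
  qed
  finally show ?thesis by (simp add: avg_def)
qed

section \<open>Characters and k-wise independence\<close>

lemma pmf_expectation_bit_vectors:
  fixes F :: "(nat \<Rightarrow> bool) \<Rightarrow> real"
  assumes "set_pmf Q \<subseteq> bit_vectors n"
  shows "measure_pmf.expectation Q F = (\<Sum>x\<in>bit_vectors n. pmf Q x * F x)"
  using assms by (subst integral_measure_pmf_real[of "bit_vectors n"]) (auto simp: mult.commute)

lemma pmf_prob_bit_vectors: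
  assumes "set_pmf Q \<subseteq> bit_vectors n"
  shows "measure_pmf.prob Q {x. P x} = (\<Sum>x\<in>bit_vectors n. pmf Q x * of_bool (P x))"
proof -
  have "measure_pmf.prob Q {x. P x} = measure_pmf.expectation Q (\<lambda>x. indicat_real {x. P x} x)"
    by simp
  also have "\<dots> = (\<Sum>x\<in>bit_vectors n. pmf Q x * indicat_real {x. P x} x)"
    by (rule pmf_expectation_bit_vectors[OF assms])
  finally show ?thesis by (simp add: indicator_def)
qed

lemma sum_pmf_bit_vectors:
  assumes "set_pmf Q \<subseteq> bit_vectors n"
  shows "(\<Sum>x\<in>bit_vectors n. pmf Q x) = 1"
  using assms by (intro sum_pmf_eq_1) auto

lemma kwise_dists_expectation_chi:
  assumes "Q \<in> kwise_dists n k (1 / 2)" "T \<subseteq> {1..n}" "T \<noteq> {}" "card T \<le> k"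
  shows "measure_pmf.expectation Q (chi T) = 0"
proof -
  have supp: "set_pmf Q \<subseteq> bit_vectors n"
    and ind: "prob_space.indep_vars (measure_pmf Q) (\<lambda>_. count_space UNIV) (\<lambda>i x. x i) T"
    and half: "\<And>i. i \<in> {1..n} \<Longrightarrow> measure_pmf.prob Q {x. x i} = 1 / 2"
    using assms by (auto simp: kwise_dists_def kwise_indep_def)
  have finT: "finite T" using assms(2) finite_subset by auto
  have finQ: "finite (set_pmf Q)" using supp finite_subset by auto
  have E0: "measure_pmf.expectation Q (\<lambda>x. bsgn (x i)) = 0" if "i \<in> T" for i
  proof -
    have "measure_pmf.expectation Q (\<lambda>x. bsgn (x i)) = (\<Sum>x\<in>bit_vectors n. pmf Q x * (2 * of_bool (x i) - 1))"
      unfolding pmf_expectation_bit_vectors[OF supp] by (intro sum.cong) auto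
    also have "\<dots> = 2 * (\<Sum>x\<in>bit_vectors n. pmf Q x * of_bool (x i)) - 1"
      by (simp add: sum_subtractf right_diff_distrib sum_distrib_left sum_pmf_bit_vectors[OF supp] mult_ac del: sum_mult_of_bool_eq)
    also have "\<dots> = 0"
      using half[of i] that assms(2) unfolding pmf_prob_bit_vectors[OF supp] by auto
    finally show ?thesis .
  qed
  have "prob_space.indep_vars (measure_pmf Q) (\<lambda>_. borel) (\<lambda>i x. bsgn (x i)) T"
    using prob_space.indep_vars_compose2[OF measure_pmf.prob_space_axioms ind, of "\<lambda>_. bsgn" "\<lambda>_. borel"] by auto
  then have "measure_pmf.expectation Q (chi T) = (\<Prod>i\<in>T. measure_pmf.expectation Q (\<lambda>x. bsgn (x i)))"
    unfolding chi_def
    by (intro prob_space.indep_vars_lebesgue_integral[OF measure_pmf.prob_space_axioms] finT) (auto intro: integrable_measure_pmf_finite finQ)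
  also have "\<dots> = 0"
    using assms(3) E0 finT by (auto simp: prod_zero_iff)
  finally show ?thesis .
qed

text \<open>An indicator of one bit is affine in its sign, so the indicator of a cylinder expands
  into characters of subsets of \<open>J\<close>. All of these but the empty one have mean zero,
  which leaves the product of the constant terms.\<close>

lemma prob_cylinder_of_chi:
  assumes supp: "set_pmf Q \<subseteq> bit_vectors n"
    and chi0: "\<And>T. T \<subseteq> {1..n} \<Longrightarrow> T \<noteq> {} \<Longrightarrow> card T \<le> k \<Longrightarrow> measure_pmf.expectation Q (chi T) = 0"
    and J: "J \<subseteq> {1..n}" "card J \<le> k"
  shows "measure_pmf.prob Q {x. \<forall>j\<in>J. x j \<in> B j} = (\<Prod>j\<in>J. (of_bool (True \<in> B j) + of_bool (False \<in> B j)) / 2)"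
proof -
  define \<alpha> :: "nat \<Rightarrow> real" where "\<alpha> j = (of_bool (True \<in> B j) + of_bool (False \<in> B j)) / 2" for j
  define \<beta> :: "nat \<Rightarrow> real" where "\<beta> j = (of_bool (True \<in> B j) - of_bool (False \<in> B j)) / 2" for j
  have finJ: "finite J" using J(1) finite_subset by auto
  have finQ: "finite (set_pmf Q)" using supp finite_subset by auto
  have ind: "of_bool (\<forall>j\<in>J. x j \<in> B j) = (\<Prod>j\<in>J. \<beta> j * bsgn (x j) + \<alpha> j)" for x
  proof -
    have "of_bool (\<forall>j\<in>J. x j \<in> B j) = (\<Prod>j\<in>J. of_bool (x j \<in> B j) :: real)"
      using finJ by (induction J rule: finite_induct) auto
    also have "\<dots> = (\<Prod>j\<in>J. \<beta> j * bsgn (x j) + \<alpha> j)"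
    proof (intro prod.cong refl)
      fix j show "(of_bool (x j \<in> B j) :: real) = \<beta> j * bsgn (x j) + \<alpha> j"
        by (cases "x j") (auto simp: \<alpha>_def \<beta>_def)
    qed
    finally show ?thesis .
  qed
  have "measure_pmf.prob Q {x. \<forall>j\<in>J. x j \<in> B j} = measure_pmf.expectation Q (\<lambda>x. of_bool (\<forall>j\<in>J. x j \<in> B j))"
    unfolding pmf_prob_bit_vectors[OF supp] pmf_expectation_bit_vectors[OF supp] ..
  also have "\<dots> = measure_pmf.expectation Q (\<lambda>x. \<Sum>T\<in>Pow J. prod \<beta> T * prod \<alpha> (J - T) * chi T x)"
    unfolding ind prod_add[OF finJ] by (simp add: prod.distrib chi_def mult_ac)
  also have "\<dots> = (\<Sum>T\<in>Pow J. prod \<beta> T * prod \<alpha> (J - T) * measure_pmf.expectation Q (chi T))"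
    by (subst Bochner_Integration.integral_sum) (auto intro: integrable_measure_pmf_finite finQ)
  also have "\<dots> = (\<Sum>T\<in>Pow J. if T = {} then prod \<alpha> J else 0)"
  proof (intro sum.cong refl)
    fix T assume T: "T \<in> Pow J"
    have "card T \<le> k" using card_mono[OF finJ, of T] T J(2) by auto
    then show "prod \<beta> T * prod \<alpha> (J - T) * measure_pmf.expectation Q (chi T) = (if T = {} then prod \<alpha> J else 0)"
      using chi0[of T] T J(1) by (cases "T = {}") (auto simp: chi_empty[abs_def])
  qed
  also have "\<dots> = prod \<alpha> J"
    using finJ by (subst sum.delta) auto
  finally show ?thesis by (simp add: \<alpha>_def)
qed

text \<open>The cylinder formula gives both sides of the independence equation, since the single
  factors are its case of a singleton \<open>J\<close>; this case is where \<open>1 \<le> k\<close>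
  enters.\<close>

lemma kwise_distsI:
  assumes supp: "set_pmf Q \<subseteq> bit_vectors n"
    and chi0: "\<And>T. T \<subseteq> {1..n} \<Longrightarrow> T \<noteq> {} \<Longrightarrow> card T \<le> k \<Longrightarrow> measure_pmf.expectation Q (chi T) = 0"
    and k: "1 \<le> k"
  shows "Q \<in> kwise_dists n k (1 / 2)"
proof -
  have cyl: "measure_pmf.prob Q {x. \<forall>j\<in>J. x j \<in> B j} = (\<Prod>j\<in>J. (of_bool (True \<in> B j) + of_bool (False \<in> B j)) / 2)"
    if "J \<subseteq> {1..n}" "card J \<le> k" for J B
    using prob_cylinder_of_chi[of Q n k J B] supp chi0 that by blast
  show ?thesis
    unfolding kwise_dists_def mem_Collect_eq
  proof (intro conjI supp ballI)
    fix i assume "i \<in> {1..n}"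
    then show "measure_pmf.prob Q {x. x i} = 1 / 2"
      using cyl[of "{i}" "\<lambda>_. {True}"] k by auto
  next
    show "kwise_indep n k Q"
      unfolding kwise_indep_def
    proof (intro allI impI)
      fix S assume S: "S \<subseteq> {1..n}" "card S \<le> k"
      have finS: "finite S" using S(1) finite_subset by auto
      show "prob_space.indep_vars (measure_pmf Q) (\<lambda>_. count_space UNIV) (\<lambda>i x. x i) S"
        unfolding prob_space.indep_vars_def2[OF measure_pmf.prob_space_axioms]
      proof (intro conjI ballI prob_space.indep_setsI[OF measure_pmf.prob_space_axioms])
        fix A J assume J: "J \<noteq> {}" "J \<subseteq> S" "finite J"
          and A: "\<forall>j\<in>J. A j \<in> {(\<lambda>x. x j) -` A \<inter> space (measure_pmf Q) |A. A \<in> sets (count_space UNIV)}"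
        from A have "\<forall>j\<in>J. \<exists>C. A j = {x. x j \<in> C}" by (auto simp: vimage_def)
        then obtain B where B: "\<And>j. j \<in> J \<Longrightarrow> A j = {x. x j \<in> B j}" by metis
        have cJ: "J \<subseteq> {1..n}" "card J \<le> k"
          using J S card_mono[OF finS J(2)] by auto
        have "(\<Inter>j\<in>J. A j) = {x. \<forall>j\<in>J. x j \<in> B j}" using B by auto
        then have "measure_pmf.prob Q (\<Inter>j\<in>J. A j) = (\<Prod>j\<in>J. (of_bool (True \<in> B j) + of_bool (False \<in> B j)) / 2)"
          using cyl[OF cJ] by simp
        also have "\<dots> = (\<Prod>j\<in>J. measure_pmf.prob Q (A j))"
        proof (intro prod.cong refl)
          fix j assume j: "j \<in> J"
          then show "(of_bool (True \<in> B j) + of_bool (False \<in> B j)) / 2 = measure_pmf.prob Q (A j)"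
            using cyl[of "{j}" B] cJ k B[OF j] by auto
        qed
        finally show "measure_pmf.prob Q (\<Inter>j\<in>J. A j) = (\<Prod>j\<in>J. measure_pmf.prob Q (A j))" .
      qed auto
    qed
  qed
qed

text \<open>Turns membership into finitely many linear equations on the weights; the compactness
  argument and the construction by densities both rest on this form.\<close>

lemma kwise_dists_iff:
  assumes "1 \<le> k"
  shows "Q \<in> kwise_dists n k (1 / 2) \<longleftrightarrow> set_pmf Q \<subseteq> bit_vectors n \<and>
    (\<forall>T. T \<subseteq> {1..n} \<longrightarrow> T \<noteq> {} \<longrightarrow> card T \<le> k \<longrightarrow> (\<Sum>x\<in>bit_vectors n. pmf Q x * chi T x) = 0)"
proof (cases "set_pmf Q \<subseteq> bit_vectors n")
  case True
  show ?thesis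
    using kwise_dists_expectation_chi[of Q n k] kwise_distsI[OF True _ assms]
    unfolding pmf_expectation_bit_vectors[OF True] using True by blast
qed (auto simp: kwise_dists_def)

text \<open>Since \<open>S \<cdot> chi T = (\<Sum>i. chi (sym_diff {i} T))\<close>, a weight orthogonal to the low-degree characters
  is orthogonal to the low powers of \<open>S\<close>.\<close>

lemma sum_ssum_power_chi_eq_0:
  assumes orth: "\<And>T. T \<subseteq> {1..n} \<Longrightarrow> card T \<le> k \<Longrightarrow> (\<Sum>x\<in>bit_vectors n. v x * chi T x) = 0"
    and "T \<subseteq> {1..n}" "card T + d \<le> k"
  shows "(\<Sum>x\<in>bit_vectors n. v x * (ssum n x ^ d * chi T x)) = 0"
  using assms(2,3)
proof (induction d arbitrary: T)
  case 0
  then show ?case using orth by simp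
next
  case (Suc d)
  have finT: "finite T" using Suc.prems(1) finite_subset by auto
  have step: "ssum n x * chi T x = (\<Sum>i=1..n. chi (sym_diff {i} T) x)" for x
  proof -
    have "ssum n x * chi T x = (\<Sum>i=1..n. chi {i} x * chi T x)"
      by (simp add: ssum_def sum_distrib_right chi_def)
    then show ?thesis using chi_mult[OF _ finT] by simp
  qed
  have "(\<Sum>x\<in>bit_vectors n. v x * (ssum n x ^ Suc d * chi T x)) =
    (\<Sum>x\<in>bit_vectors n. \<Sum>i=1..n. v x * (ssum n x ^ d * chi (sym_diff {i} T) x))"
  proof (intro sum.cong refl)
    fix x
    have "v x * (ssum n x ^ Suc d * chi T x) = v x * ssum n x ^ d * (ssum n x * chi T x)" by simp
    then show "v x * (ssum n x ^ Suc d * chi T x) = (\<Sum>i=1..n. v x * (ssum n x ^ d * chi (sym_diff {i} T) x))"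
      unfolding step by (simp add: sum_distrib_left mult_ac)
  qed
  also have "\<dots> = (\<Sum>i=1..n. \<Sum>x\<in>bit_vectors n. v x * (ssum n x ^ d * chi (sym_diff {i} T) x))"
    by (rule sum.swap)
  also have "\<dots> = 0"
  proof (rule sum.neutral, rule ballI, rule Suc.IH)
    fix i assume i: "i \<in> {1..n}"
    show "sym_diff {i} T \<subseteq> {1..n}" using i Suc.prems by auto
    have "card (sym_diff {i} T) \<le> card (insert i T)" by (intro card_mono) (use finT in auto)
    also have "\<dots> \<le> Suc (card T)" by (rule card_insert_le_m1) auto
    finally show "card (sym_diff {i} T) + d \<le> k" using Suc.prems(2) by linarith
  qed
  finally show ?case .
qed

lemma sum_poly_ssum_eq_0:
  assumes orth: "\<And>T. T \<subseteq> {1..n} \<Longrightarrow> card T \<le> k \<Longrightarrow> (\<Sum>x\<in>bit_vectors n. v x * chi T x) = 0"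
    and "degree P \<le> k"
  shows "(\<Sum>x\<in>bit_vectors n. v x * poly P (ssum n x)) = 0"
proof -
  have "(\<Sum>x\<in>bit_vectors n. v x * poly P (ssum n x))
      = (\<Sum>x\<in>bit_vectors n. \<Sum>d\<le>degree P. coeff P d * (v x * (ssum n x ^ d * chi {} x)))"
    by (simp add: poly_altdef sum_distrib_left mult_ac)
  also have "\<dots> = (\<Sum>d\<le>degree P. coeff P d * (\<Sum>x\<in>bit_vectors n. v x * (ssum n x ^ d * chi {} x)))"
    by (subst sum.swap) (simp add: sum_distrib_left)
  also have "\<dots> = 0"
  proof (intro sum.neutral ballI)
    fix d assume "d \<in> {..degree P}"
    then have "(\<Sum>x\<in>bit_vectors n. v x * (ssum n x ^ d * chi {} x)) = 0"
      using assms(2) sum_ssum_power_chi_eq_0[of n k v "{}" d, OF orth] by auto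
    then show "coeff P d * (\<Sum>x\<in>bit_vectors n. v x * (ssum n x ^ d * chi {} x)) = 0" by simp
  qed
  finally show ?thesis .
qed

lemma kwise_expectation_poly:
  assumes Q: "Q \<in> kwise_dists n k (1 / 2)" and deg: "degree P \<le> k"
  shows "(\<Sum>x\<in>bit_vectors n. pmf Q x * poly P (ssum n x)) = avg n (\<lambda>x. poly P (ssum n x))"
proof -
  have supp: "set_pmf Q \<subseteq> bit_vectors n" using Q by (simp add: kwise_dists_def)
  \<comment> \<open>Subtracting the uniform weight makes the signed weight orthogonal to the empty
    character too, as \<open>sum_poly_ssum_eq_0\<close> requires.\<close>
  have "(\<Sum>x\<in>bit_vectors n. (pmf Q x - 1 / 2 ^ n) * poly P (ssum n x)) = 0"
  proof (rule sum_poly_ssum_eq_0[OF _ deg])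
    fix T assume T: "T \<subseteq> {1..n}" "card T \<le> k"
    have "(\<Sum>x\<in>bit_vectors n. (pmf Q x - 1 / 2 ^ n) * chi T x) =
      (\<Sum>x\<in>bit_vectors n. pmf Q x * chi T x) - avg n (chi T)"
      by (simp add: left_diff_distrib sum_subtractf avg_def sum_divide_distrib)
    also have "\<dots> = 0"
      using kwise_dists_expectation_chi[OF Q T(1) _ T(2)] avg_chi[OF T(1)] sum_pmf_bit_vectors[OF supp]
      unfolding pmf_expectation_bit_vectors[OF supp] by (cases "T = {}") auto
    finally show "(\<Sum>x\<in>bit_vectors n. (pmf Q x - 1 / 2 ^ n) * chi T x) = 0" .
  qed
  then show ?thesis
    by (simp add: left_diff_distrib sum_subtractf avg_def sum_divide_distrib)
qed

section \<open>Distributions given by a density against the uniform measure\<close>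

definition density_pmf :: "nat \<Rightarrow> ((nat \<Rightarrow> bool) \<Rightarrow> real) \<Rightarrow> (nat \<Rightarrow> bool) pmf" where
  "density_pmf n w = embed_pmf (\<lambda>x. if x \<in> bit_vectors n then w x / 2 ^ n else 0)"

lemma pmf_density_pmf:
  assumes "\<And>x. x \<in> bit_vectors n \<Longrightarrow> 0 \<le> w x" "avg n w = 1"
  shows "pmf (density_pmf n w) x = (if x \<in> bit_vectors n then w x / 2 ^ n else 0)"
  unfolding density_pmf_def
proof (rule pmf_embed_pmf)
  show "0 \<le> (if x \<in> bit_vectors n then w x / 2 ^ n else 0)" for x using assms(1) by auto
  have "(\<integral>\<^sup>+ x. ennreal (if x \<in> bit_vectors n then w x / 2 ^ n else 0) \<partial>count_space UNIV)
    = (\<integral>\<^sup>+ x. ennreal (w x / 2 ^ n) * indicator (bit_vectors n) x \<partial>count_space UNIV)"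
    by (intro nn_integral_cong) (auto simp: indicator_def)
  also have "\<dots> = (\<integral>\<^sup>+ x. ennreal (w x / 2 ^ n) \<partial>count_space (bit_vectors n))"
    by (simp add: nn_integral_count_space_indicator)
  also have "\<dots> = (\<Sum>x\<in>bit_vectors n. ennreal (w x / 2 ^ n))"
    by (simp add: nn_integral_count_space_finite)
  also have "\<dots> = ennreal (avg n w)"
    using assms(1) by (subst sum_ennreal) (auto simp: avg_def sum_divide_distrib)
  finally show "(\<integral>\<^sup>+ x. ennreal (if x \<in> bit_vectors n then w x / 2 ^ n else 0) \<partial>count_space UNIV) = 1"
    using assms(2) by simp
qed

lemma set_density_pmf:
  assumes "\<And>x. x \<in> bit_vectors n \<Longrightarrow> 0 \<le> w x" "avg n w = 1"
  shows "set_pmf (density_pmf n w) \<subseteq> bit_vectors n"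
  using pmf_density_pmf[of n w, OF assms] by (auto simp: set_pmf_iff split: if_splits)

lemma density_pmf_kwise:
  assumes w: "\<And>x. x \<in> bit_vectors n \<Longrightarrow> 0 \<le> w x" "avg n w = 1" and "1 \<le> k"
    and orth: "\<And>T. T \<subseteq> {1..n} \<Longrightarrow> T \<noteq> {} \<Longrightarrow> card T \<le> k \<Longrightarrow> avg n (\<lambda>x. w x * chi T x) = 0"
  shows "density_pmf n w \<in> kwise_dists n k (1 / 2)"
  unfolding kwise_dists_iff[OF \<open>1 \<le> k\<close>]
proof (intro conjI allI impI)
  show "set_pmf (density_pmf n w) \<subseteq> bit_vectors n" by (rule set_density_pmf[OF w])
  fix T assume "T \<subseteq> {1..n}" "T \<noteq> {}" "card T \<le> k"
  from orth[OF this] show "(\<Sum>x\<in>bit_vectors n. pmf (density_pmf n w) x * chi T x) = 0"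
    by (simp add: pmf_density_pmf[OF w] avg_def sum_divide_distrib[symmetric])
qed

lemma maj_bias_density_pmf:
  assumes w: "\<And>x. x \<in> bit_vectors n \<Longrightarrow> 0 \<le> w x" "avg n w = 1"
  shows "maj_bias n (density_pmf n w) = \<bar>avg n (\<lambda>x. w x * of_bool (maj n x)) - 1 / 2\<bar>"
proof -
  have "measure_pmf.prob (density_pmf n w) {x. maj n x} =
      (\<Sum>x\<in>bit_vectors n. pmf (density_pmf n w) x * of_bool (maj n x))"
    by (rule pmf_prob_bit_vectors[OF set_density_pmf[OF w]])
  also have "\<dots> = avg n (\<lambda>x. w x * of_bool (maj n x))"
    by (simp add: pmf_density_pmf[OF w] avg_def sum_divide_distrib del: sum_mult_of_bool_eq)
  finally show ?thesis by (simp add: maj_bias_def)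
qed

section \<open>Polynomial majorants of the step function\<close>

text \<open>Mean value theorem between each new largest point and the previous maximum.
  \<open>G\<close> is kept off \<open>A\<close> so that zeros of the derivative at the points of
  \<open>A\<close> can be counted in addition.\<close>

lemma rolle_roots:
  fixes f :: "real poly"
  assumes "finite A" "A \<noteq> {}" "\<And>a. a \<in> A \<Longrightarrow> poly f a = c"
  shows "\<exists>G. finite G \<and> card G + 1 = card A \<and> G \<inter> A = {} \<and>
    (\<forall>z\<in>G. poly (pderiv f) z = 0 \<and> (\<exists>a\<in>A. a < z) \<and> (\<exists>a\<in>A. z < a))"
  using assms
proof (induction A rule: finite_linorder_max_induct)
  case empty
  then show ?case by simp
next
  case (insert b A)
  show ?case
  proof (cases "A = {}")
    case True
    then show ?thesis by (intro exI[of _ "{}"]) auto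
  next
    case False
    have "\<exists>G. finite G \<and> card G + 1 = card A \<and> G \<inter> A = {} \<and>
        (\<forall>z\<in>G. poly (pderiv f) z = 0 \<and> (\<exists>a\<in>A. a < z) \<and> (\<exists>a\<in>A. z < a))"
      by (rule insert.IH[OF False]) (simp add: insert.prems)
    then obtain G where G: "finite G" "card G + 1 = card A" "G \<inter> A = {}"
      "\<And>z. z \<in> G \<Longrightarrow> poly (pderiv f) z = 0 \<and> (\<exists>a\<in>A. a < z) \<and> (\<exists>a\<in>A. z < a)"
      by blast
    define m where "m = Max A"
    have m: "m \<in> A" "\<And>a. a \<in> A \<Longrightarrow> a \<le> m"
      using insert.hyps(1) False by (auto simp: m_def)
    have mb: "m < b" using insert.hyps(2) m(1) by auto
    have "\<exists>z. m < z \<and> z < b \<and> poly f b - poly f m = (b - m) * poly (pderiv f) z"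
      by (rule poly_MVT[OF mb])
    then obtain z where z: "m < z" "z < b" "poly (pderiv f) z = 0"
      using insert.prems(2)[of m] insert.prems(2)[of b] m(1) mb by auto
    have zG: "z \<notin> G" using G(4)[of z] m(2) z(1) by force
    have zA: "z \<notin> A" using m(2) z(1) by force
    have bG: "b \<notin> G" using G(4)[of b] m(2) mb by force
    have bA: "b \<notin> A" using insert.hyps(2) by auto
    show ?thesis
    proof (intro exI[of _ "insert z G"] conjI ballI)
      show "card (insert z G) + 1 = card (insert b A)"
        using G(1,2) zG bA insert.hyps(1) by simp
      show "insert z G \<inter> insert b A = {}" using G(3) zA bG z by auto
      fix y assume y: "y \<in> insert z G"
      show "poly (pderiv f) y = 0" using y z(3) G(4) by auto
      show "\<exists>a\<in>insert b A. a < y" using y z(1) m(1) G(4) by auto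
      show "\<exists>a\<in>insert b A. y < a" using y z(2) G(4) by auto
    qed (use G(1) in auto)
  qed
qed

lemma card_roots_le_degree:
  fixes p :: "real poly"
  assumes "p \<noteq> 0" "\<And>x. x \<in> R \<Longrightarrow> poly p x = 0"
  shows "card R \<le> degree p"
proof -
  have "card R \<le> card {x. poly p x = 0}"
    using assms by (intro card_mono poly_roots_finite) auto
  also have "\<dots> \<le> degree p" by (rule card_poly_roots_bound[OF assms(1)])
  finally show ?thesis .
qed

lemma pderiv_root_factor:
  fixes L h :: "real poly"
  assumes "poly L z = 0"
  shows "poly (pderiv (L * h)) z = poly (pderiv L) z * poly h z"
    and "poly (pderiv (L ^ 2 * h)) z = 0"
    and "poly (pderiv (pderiv (L ^ 3 * h))) z = 0"
  using assms by (simp_all add: power2_eq_square power3_eq_cube pderiv_mult pderiv_add)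

lemma pderiv_linear_factor: "poly (pderiv ([:- z, 1:] * h)) z = poly h z" for h :: "real poly"
  by (subst pderiv_root_factor) (auto simp: pderiv_pCons)

text \<open>The zero count behind the majorant: Rolle yields \<open>card A - 1\<close> and
  \<open>card B - 1\<close> zeros of the derivative off the nodes, and the prescribed zeros
  \<open>D\<close> at nodes come on top. A double zero of the derivative counts once more, which is
  the second claim.\<close>

lemma two_level_roots:
  fixes f :: "real poly"
  assumes A: "finite A" "A \<noteq> {}" "\<And>a. a \<in> A \<Longrightarrow> poly f a = c"
    and B: "finite B" "B \<noteq> {}" "\<And>b. b \<in> B \<Longrightarrow> poly f b = d"
    and AB: "\<And>a b. a \<in> A \<Longrightarrow> b \<in> B \<Longrightarrow> a < b"
    and D: "D \<subseteq> A \<union> B" "\<And>x. x \<in> D \<Longrightarrow> poly (pderiv f) x = 0"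
    and nz: "pderiv f \<noteq> 0"
  shows "card A + card B + card D \<le> degree (pderiv f) + 2"
    and "z \<in> D \<Longrightarrow> poly (pderiv (pderiv f)) z = 0 \<Longrightarrow> card A + card B + card D \<le> degree (pderiv f) + 1"
proof -
  obtain G where G: "finite G" "card G + 1 = card A" "G \<inter> A = {}"
    "\<And>z. z \<in> G \<Longrightarrow> poly (pderiv f) z = 0 \<and> (\<exists>a\<in>A. a < z) \<and> (\<exists>a\<in>A. z < a)"
    using rolle_roots[of A f c] A by blast
  obtain H where H: "finite H" "card H + 1 = card B" "H \<inter> B = {}"
    "\<And>z. z \<in> H \<Longrightarrow> poly (pderiv f) z = 0 \<and> (\<exists>a\<in>B. a < z) \<and> (\<exists>a\<in>B. z < a)"
    using rolle_roots[of B f d] B by blast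
  define R where "R = G \<union> H \<union> D"
  have finD: "finite D" using D(1) A(1) B(1) finite_subset by blast
  have "G \<inter> H = {}" using G(4) H(4) AB by force
  moreover have "G \<inter> B = {}" using G(4) AB by force
  moreover have "H \<inter> A = {}" using H(4) AB by force
  ultimately have cR: "card R = card G + card H + card D"
    unfolding R_def using G(1,3) H(1,3) D(1) finD
    by (subst card_Un_disjoint; (subst card_Un_disjoint)?) auto
  have root: "poly (pderiv f) x = 0" if "x \<in> R" for x
    using that G(4) H(4) D(2) by (auto simp: R_def)
  show "card A + card B + card D \<le> degree (pderiv f) + 2"
    using card_roots_le_degree[OF nz root, of R] cR G(2) H(2) by simp
  assume z: "z \<in> D" "poly (pderiv (pderiv f)) z = 0"
  \<comment> \<open>After one factor at \<open>z\<close> is split off, the quotient still vanishes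
    on all of \<open>R\<close>, at \<open>z\<close> because the zero was double; so the degree drops
    by one and the zero count does not.\<close>
  obtain h where h: "pderiv f = [:- z, 1:] * h"
    using D(2)[OF z(1)] by (auto simp: poly_eq_0_iff_dvd elim!: dvdE)
  have hnz: "h \<noteq> 0" using h nz by auto
  have hz: "poly h z = 0" using z(2) unfolding h pderiv_linear_factor .
  have "poly h x = 0" if "x \<in> R" for x
    using root[OF that] hz unfolding h by (cases "x = z") auto
  from card_roots_le_degree[OF hnz this, of R] have "card R \<le> degree h" by simp
  moreover have "degree (pderiv f) = degree h + 1"
    unfolding h using hnz by (subst degree_mult_eq) auto
  ultimately show "card A + card B + card D \<le> degree (pderiv f) + 1"
    using cR G(2) H(2) by simp
qed

text \<open>The nodal polynomial of Hermite interpolation: for finite \<open>D\<close>, divisibility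
  by it means a double zero at every point of \<open>D\<close>.\<close>

definition sq_prod :: "real set \<Rightarrow> real poly" where
  "sq_prod D = (\<Prod>d\<in>D. [:- d, 1:] ^ 2)"

lemma sq_prod_nonzero: "finite D \<Longrightarrow> x \<notin> D \<Longrightarrow> poly (sq_prod D) x > 0"
  unfolding sq_prod_def poly_prod by (intro prod_pos) auto

lemma degree_sq_prod: "degree (sq_prod D) = 2 * card D"
  unfolding sq_prod_def
  by (subst degree_prod_eq_sum_degree) (auto simp: degree_power_eq)

lemma sq_prod_nz [simp]: "sq_prod D \<noteq> 0"
  by (cases "finite D") (auto simp: sq_prod_def)

lemma sq_prod_double_root:
  assumes "finite D" "d \<in> D"
  shows "poly (sq_prod D) d = 0" "poly (pderiv (sq_prod D)) d = 0"
proof -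
  have "sq_prod D = [:- d, 1:] ^ 2 * sq_prod (D - {d})"
    unfolding sq_prod_def using assms by (simp add: prod.remove)
  then show "poly (sq_prod D) d = 0" "poly (pderiv (sq_prod D)) d = 0"
    using pderiv_root_factor(2)[of "[:- d, 1:]" d] by simp_all
qed

lemma sq_prod_dvd:
  assumes "finite D" "\<And>d. d \<in> D \<Longrightarrow> poly f d = 0" "\<And>d. d \<in> D \<Longrightarrow> poly (pderiv f) d = 0"
  shows "sq_prod D dvd f"
  using assms
proof (induction D rule: finite_induct)
  case empty
  then show ?case by (simp add: sq_prod_def)
next
  case (insert d D)
  then obtain g where g: "f = sq_prod D * g" by auto
  have pos: "poly (sq_prod D) d > 0" using sq_prod_nonzero insert.hyps by auto
  have g0: "poly g d = 0" using insert.prems(1)[of d] pos unfolding g by auto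
  then obtain h where h: "g = [:- d, 1:] * h" by (auto simp: poly_eq_0_iff_dvd elim!: dvdE)
  have "poly (pderiv g) d = 0"
    using insert.prems(2)[of d] pos g0 unfolding g by (auto simp: pderiv_mult)
  then have "poly h d = 0" unfolding h pderiv_linear_factor .
  then obtain k where k: "h = [:- d, 1:] * k" by (auto simp: poly_eq_0_iff_dvd elim!: dvdE)
  have "sq_prod (insert d D) = [:- d, 1:] ^ 2 * sq_prod D"
    unfolding sq_prod_def by (rule prod.insert[OF insert.hyps])
  then have "f = sq_prod (insert d D) * k"
    unfolding g h k by (simp only: power2_eq_square mult_ac)
  then show ?case by simp
qed

text \<open>Uniqueness in the Hermite problem with one additional simple node \<open>x\<close>:
  there are \<open>2 * card D + 1\<close> conditions on a polynomial of degree at most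
  \<open>2 * card D\<close>.\<close>

lemma double_roots_imp_zero:
  fixes D :: "real set"
  assumes "finite D" "\<And>d. d \<in> D \<Longrightarrow> poly f d = 0" "\<And>d. d \<in> D \<Longrightarrow> poly (pderiv f) d = 0"
    and "x \<notin> D" "poly f x = 0" "degree f \<le> 2 * card D"
  shows "f = 0"
proof (rule ccontr)
  assume nz: "f \<noteq> 0"
  obtain g where g: "f = sq_prod D * g" using sq_prod_dvd[OF assms(1-3)] by auto
  then have "g \<noteq> 0" using nz by auto
  then have "degree f = 2 * card D + degree g"
    unfolding g by (subst degree_mult_eq) (auto simp: degree_sq_prod)
  then have "degree g = 0" using assms(6) by simp
  then obtain c where c: "g = [:c:]" by (rule degree_eq_zeroE)
  have "poly g x = 0" using assms(5) sq_prod_nonzero[OF assms(1,4)] unfolding g by auto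
  then show False using c \<open>g \<noteq> 0\<close> by auto
qed

text \<open>Newton's scheme: a correction that vanishes at \<open>x0\<close> and doubly on
  \<open>D\<close> leaves the old conditions intact, and a linear cofactor has just the two
  parameters that value and slope at the new node demand.\<close>

lemma hermite_interpolation:
  fixes val :: "real \<Rightarrow> real"
  assumes "finite D" "x0 \<notin> D"
  shows "\<exists>P. degree P \<le> 2 * card D \<and> poly P x0 = v0 \<and>
    (\<forall>d\<in>D. poly P d = val d \<and> poly (pderiv P) d = 0)"
  using assms
proof (induction D rule: finite_induct)
  case empty
  then show ?case by (intro exI[of _ "[:v0:]"]) auto
next
  case (insert d D)
  then obtain P where P: "degree P \<le> 2 * card D" "poly P x0 = v0"
    "\<And>d. d \<in> D \<Longrightarrow> poly P d = val d \<and> poly (pderiv P) d = 0"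
    by auto
  define N where "N = [:- x0, 1:] * sq_prod D"
  have Nd: "poly N d \<noteq> 0"
    using sq_prod_nonzero[of D d] insert by (auto simp: N_def)
  define \<alpha> where "\<alpha> = (val d - poly P d) / poly N d"
  define \<beta> where "\<beta> = - (poly (pderiv P) d + \<alpha> * poly (pderiv N) d) / poly N d"
  define L where "L = [:\<alpha> - \<beta> * d, \<beta>:]"
  have "degree (L * N) \<le> 1 + (1 + 2 * card D)"
  proof (rule order_trans[OF degree_mult_le add_mono])
    show "degree L \<le> 1" by (simp add: L_def)
    show "degree N \<le> 1 + 2 * card D"
      unfolding N_def by (rule order_trans[OF degree_mult_le add_mono]) (auto simp: degree_sq_prod)
  qed
  then have "degree (P + L * N) \<le> 2 * card (insert d D)"
    using P(1) insert.hyps by (intro degree_add_le) auto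
  moreover have "poly (P + L * N) x0 = v0" using P(2) by (simp add: N_def)
  moreover have "poly (P + L * N) d = val d"
    using Nd by (simp add: L_def \<alpha>_def field_simps)
  moreover have "poly (pderiv (P + L * N)) d = 0"
  proof -
    have "poly (pderiv (P + L * N)) d = poly (pderiv P) d + \<alpha> * poly (pderiv N) d + \<beta> * poly N d"
      by (simp add: pderiv_add pderiv_mult L_def pderiv_pCons pderiv_smult algebra_simps)
    then show ?thesis using Nd by (simp add: \<beta>_def)
  qed
  moreover have "poly (P + L * N) e = val e \<and> poly (pderiv (P + L * N)) e = 0" if "e \<in> D" for e
  proof -
    have "poly N e = 0" "poly (pderiv N) e = 0"
      unfolding N_def using sq_prod_double_root[OF insert.hyps(1) that]
      by (simp_all add: pderiv_mult del: mult_pCons_left)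
    then show ?thesis using P(3)[OF that] by (simp add: pderiv_add pderiv_mult)
  qed
  ultimately show ?case by blast
qed

text \<open>The polynomial majorant of the step function, in the style of Chebyshev, Markov and Stieltjes: a crossing
  of the wrong sign would, by Rolle's theorem, give the derivative more zeros than its degree.\<close>

lemma step_majorant:
  fixes A B :: "real set"
  assumes fin: "finite A" "finite B" and ne: "A \<noteq> {}"
    and neg: "\<And>a. a \<in> A \<Longrightarrow> a < 0" and pos: "\<And>b. b \<in> B \<Longrightarrow> 0 < b"
    and deg: "degree P \<le> 2 * (card A + card B)"
    and P0: "poly P 0 = 1"
    and PA: "\<And>a. a \<in> A \<Longrightarrow> poly P a = 0" "\<And>a. a \<in> A \<Longrightarrow> poly (pderiv P) a = 0"
    and PB: "\<And>b. b \<in> B \<Longrightarrow> poly P b = 1" "\<And>b. b \<in> B \<Longrightarrow> poly (pderiv P) b = 0"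
  shows "y \<le> 0 \<Longrightarrow> 0 \<le> poly P y" "0 \<le> y \<Longrightarrow> 1 \<le> poly P y"
proof -
  define B' where "B' = insert 0 B"
  have finB': "finite B'" "B' \<noteq> {}" using fin by (auto simp: B'_def)
  have AB': "a < b" if "a \<in> A" "b \<in> B'" for a b
    using neg[OF that(1)] pos that(2) by (force simp: B'_def)
  have PB': "poly P b = 1" if "b \<in> B'" for b using that P0 PB(1) by (auto simp: B'_def)
  have B0: "0 \<notin> B" using pos by auto
  have cB': "card B' = card B + 1" unfolding B'_def using fin(2) B0 by simp
  have disj: "A \<inter> B = {}" using neg pos by force
  have cAB: "card (A \<union> B) = card A + card B" using fin disj by (rule card_Un_disjoint)
  have nz: "pderiv P \<noteq> 0"
  proof
    assume "pderiv P = 0"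
    then obtain c where "P = [:c:]" by (auto simp: pderiv_eq_0_iff elim: degree_eq_zeroE)
    then show False using P0 PA(1) ne by force
  qed
  have cA: "card A > 0" using fin ne by (simp add: card_gt_0_iff)
  have degP: "degree (pderiv P) + 1 \<le> 2 * (card A + card B)"
    using deg cA by (simp add: degree_pderiv)
  have PD: "poly (pderiv P) x = 0" if "x \<in> A \<union> B" for x using that PA(2) PB(2) by auto
  \<comment> \<open>Off \<open>A\<close> the sign of \<open>P\<close> is the sign of
    \<open>u\<close>, which is positive at 0. A negative zero of \<open>u\<close> would either add a
    point at level 0 to \<open>A\<close> or make a node a triple zero of \<open>P\<close>, and
    either one exceeds the zero count.\<close>
  obtain u where u: "P = sq_prod A * u" using sq_prod_dvd[OF fin(1) PA] by auto
  have uroot: False if uz: "poly u z = 0" and z0: "z < 0" for z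
  proof (cases "z \<in> A")
    case False
    have "card (insert z A) + card B' + card (A \<union> B) \<le> degree (pderiv P) + 2"
    proof (rule two_level_roots(1)[of _ P 0 _ 1])
      fix a assume "a \<in> insert z A"
      then show "poly P a = 0" using that PA(1) unfolding u by auto
    next
      fix a b assume ab: "a \<in> insert z A" "b \<in> B'"
      have "0 \<le> b" using ab(2) pos by (force simp: B'_def)
      then show "a < b" using ab that AB' by (cases "a = z") auto
    qed (use fin finB' PB' PD nz in \<open>auto simp: B'_def\<close>)
    then show False using degP fin False by (simp add: cB' cAB)
  next
    case True
    obtain w where w: "u = [:- z, 1:] * w" using uz unfolding poly_eq_0_iff_dvd by (elim dvdE)
    have sA: "sq_prod A = [:- z, 1:] ^ 2 * sq_prod (A - {z})"
      unfolding sq_prod_def using fin True by (simp add: prod.remove)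
    have "P = [:- z, 1:] ^ 3 * (sq_prod (A - {z}) * w)"
      by (subst u, subst w, subst sA) (simp only: power3_eq_cube power2_eq_square mult_ac)
    then have "poly (pderiv (pderiv P)) z = 0"
      using pderiv_root_factor(3)[of "[:- z, 1:]" z] by simp
    then have "card A + card B' + card (A \<union> B) \<le> degree (pderiv P) + 1"
      using True by (intro two_level_roots(2)[of A P 0 B' 1 _ z])
        (use fin ne finB' PA(1) PB' AB' PD nz in \<open>auto simp: B'_def\<close>)
    then show False using degP by (simp add: cB' cAB)
  qed
  show "0 \<le> poly P y" if "y \<le> 0"
  proof (rule ccontr)
    assume "\<not> 0 \<le> poly P y"
    then have y: "poly P y < 0" by simp
    have yA: "y \<notin> A" using y PA(1) by force
    have y0: "y < 0" using y that P0 by (cases "y = 0") auto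
    have "poly u y < 0"
      using y sq_prod_nonzero[OF fin(1) yA] unfolding u by (simp add: mult_less_0_iff)
    moreover have "0 \<notin> A" using neg by auto
    then have "poly u 0 > 0"
      using P0 sq_prod_nonzero[OF fin(1)] unfolding u by (metis poly_mult zero_less_mult_pos zero_less_one)
    ultimately obtain z where "y < z" "z < 0" "poly u z = 0"
      using poly_IVT_pos[OF y0] by blast
    then show False using uroot by blast
  qed
  have "sq_prod B dvd P - 1"
    by (rule sq_prod_dvd[OF fin(2)]) (auto simp: PB pderiv_diff)
  then obtain h where h: "P - 1 = sq_prod B * h" by auto
  have "poly h 0 = 0"
    using arg_cong[OF h, of "\<lambda>p. poly p 0"] P0 sq_prod_nonzero[OF fin(2) B0] by auto
  then obtain w where w: "h = [:0, 1:] * w" by (auto simp: poly_eq_0_iff_dvd elim!: dvdE)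
  \<comment> \<open>The same argument at level 1, for the cofactor \<open>w\<close> of
    \<open>P - 1\<close>. The node 0 carries no slope condition, hence the single factor
    \<open>[:0, 1:]\<close>.\<close>
  have Pw: "P = 1 + sq_prod B * ([:0, 1:] * w)" using h w by (simp add: algebra_simps)
  have wroot: False if wz: "poly w z = 0" and zA: "\<And>a. a \<in> A \<Longrightarrow> a < z" for z
  proof (cases "z \<in> B'")
    case False
    have "card A + card (insert z B') + card (A \<union> B) \<le> degree (pderiv P) + 2"
    proof (rule two_level_roots(1)[of _ P 0 _ 1])
      fix b assume "b \<in> insert z B'"
      moreover have "poly P z = 1" using that(1) by (subst Pw) simp
      ultimately show "poly P b = 1" using PB' by auto
    qed (use fin ne finB' PA(1) PD nz AB' zA in \<open>auto simp: B'_def\<close>)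
    then show False using degP finB' False by (simp add: cB' cAB)
  next
    case zB': True
    obtain v where v: "w = [:- z, 1:] * v" using wz unfolding poly_eq_0_iff_dvd by (elim dvdE)
    show False
    proof (cases "z = 0")
      case True
      \<comment> \<open>Here \<open>P - 1\<close> has a double zero at 0, so 0 joins the prescribed
        zeros of the derivative.\<close>
      have "poly (pderiv P) 0 = 0"
        by (subst Pw) (simp add: v True pderiv_add pderiv_mult pderiv_pCons)
      then have "card A + card B' + card (A \<union> B') \<le> degree (pderiv P) + 2"
        by (intro two_level_roots(1)[of A P 0 B' 1])
          (use fin ne finB' PA(1) PB' AB' PD nz in \<open>auto simp: B'_def\<close>)
      moreover have "card (A \<union> B') = card A + card B'"
        using fin finB' AB' by (intro card_Un_disjoint) auto
      ultimately show False using degP by (simp add: cB')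
    next
      case False
      then have zB: "z \<in> B" using zB' by (auto simp: B'_def)
      have sB: "sq_prod B = [:- z, 1:] ^ 2 * sq_prod (B - {z})"
        unfolding sq_prod_def using fin zB by (simp add: prod.remove)
      have P3: "P = 1 + [:- z, 1:] ^ 3 * (sq_prod (B - {z}) * ([:0, 1:] * v))"
        by (subst Pw, subst v, subst sB) (simp only: power3_eq_cube power2_eq_square mult_ac)
      have "poly (pderiv (pderiv P)) z = 0"
        unfolding P3 pderiv_add pderiv_1 add_0 by (rule pderiv_root_factor(3)) simp
      then have "card A + card B' + card (A \<union> B) \<le> degree (pderiv P) + 1"
        using zB by (intro two_level_roots(2)[of A P 0 B' 1 _ z])
          (use fin ne finB' PA(1) PB' AB' PD nz in \<open>auto simp: B'_def\<close>)
      then show False using degP by (simp add: cB' cAB)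
    qed
  qed
  show "1 \<le> poly P y" if "0 \<le> y"
  proof (rule ccontr)
    assume "\<not> 1 \<le> poly P y"
    then have y: "poly P y < 1" by simp
    have yB: "y \<notin> B" using y PB(1) by force
    have y0: "0 < y" using y that P0 by (cases "y = 0") auto
    \<comment> \<open>The sign of \<open>w\<close> at 0 is not known, but at \<open>Max A\<close>
      the value \<open>P = 0\<close> forces \<open>w > 0\<close>. A sign change between there and
      \<open>y\<close> gives a zero to the right of all of \<open>A\<close>, as \<open>wroot\<close>
      demands.\<close>
    define m where "m = Max A"
    have m: "m \<in> A" "\<And>a. a \<in> A \<Longrightarrow> a \<le> m" using fin ne by (auto simp: m_def)
    have Py: "poly P x = 1 + poly (sq_prod B) x * (x * poly w x)" for x by (subst Pw) simp
    have "poly w y < 0"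
      using y y0 sq_prod_nonzero[OF fin(2) yB] unfolding Py[of y] by (auto simp: mult_less_0_iff)
    moreover have "m \<notin> B" "m < 0" using m(1) neg disj by auto
    then have "poly w m > 0"
    proof -
      have "poly (sq_prod B) m * (m * poly w m) < 0"
        using PA(1)[OF m(1)] unfolding Py[of m] by simp
      then have "m * poly w m < 0"
        using sq_prod_nonzero[OF fin(2) \<open>m \<notin> B\<close>] by (auto simp: mult_less_0_iff)
      then show ?thesis using \<open>m < 0\<close> by (auto simp: mult_less_0_iff)
    qed
    moreover have "m < y" using \<open>m < 0\<close> y0 by simp
    ultimately obtain z where z: "m < z" "z < y" "poly w z = 0"
      using poly_IVT_neg by blast
    have "a < z" if "a \<in> A" for a using m(2)[OF that] z(1) by simp
    then show False using wroot[OF z(3)] by blast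
  qed
qed

text \<open>At each zero \<open>d\<close> of \<open>t\<close> exactly one of \<open>d\<close> and
  \<open>- d\<close> is positive, so \<open>P(y) + P(-y) - 1\<close> and its derivative vanish on
  \<open>D\<close>, as do \<open>t^2\<close> and its derivative. The two polynomials also agree at
  0, and uniqueness in degree \<open>2 * card D\<close> makes them equal.\<close>

lemma even_poly_majorant:
  fixes t :: "real poly"
  assumes even: "\<And>x. poly t (- x) = poly t x" and t0: "poly t 0 = 1"
    and D: "finite D" "D \<noteq> {}" "degree t = card D" "\<And>d. d \<in> D \<Longrightarrow> poly t d = 0"
  shows "\<exists>P. degree P \<le> 2 * degree t \<and> (\<forall>y. 0 \<le> poly P y) \<and> (\<forall>y\<ge>0. 1 \<le> poly P y) \<and>
    (\<forall>y. poly P y + poly P (- y) = 1 + (poly t y)\<^sup>2)"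
proof -
  have tnz: "t \<noteq> 0" using t0 by auto
  have D_eq: "D = {x. poly t x = 0}"
    using D card_poly_roots_bound[OF tnz] poly_roots_finite[OF tnz]
    by (intro card_seteq) auto
  have sym: "- d \<in> D" if "d \<in> D" for d using that even by (auto simp: D_eq)
  have D0: "0 \<notin> D" using t0 by (auto simp: D_eq)
  define A where "A = {d\<in>D. d < 0}"
  define B where "B = {d\<in>D. d > 0}"
  have fin: "finite A" "finite B" using D(1) by (auto simp: A_def B_def)
  have DAB: "D = A \<union> B" using D0 by (auto simp: A_def B_def) (metis linorder_neqE)
  have cAB: "card D = card A + card B"
    unfolding DAB by (rule card_Un_disjoint[OF fin]) (auto simp: A_def B_def)
  have neA: "A \<noteq> {}"
  proof -
    obtain d where d: "d \<in> D" using D(2) by auto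
    then have "d \<noteq> 0" using D0 by auto
    then have "d \<in> A \<or> - d \<in> A" using d sym[OF d] by (auto simp: A_def)
    then show ?thesis by auto
  qed
  obtain P where P: "degree P \<le> 2 * card D" "poly P 0 = 1"
    "\<And>d. d \<in> D \<Longrightarrow> poly P d = of_bool (0 < d)" "\<And>d. d \<in> D \<Longrightarrow> poly (pderiv P) d = 0"
    using hermite_interpolation[OF D(1) D0, of 1 "\<lambda>d. of_bool (0 < d)"] by auto
  have step: "y \<le> 0 \<Longrightarrow> 0 \<le> poly P y" "0 \<le> y \<Longrightarrow> 1 \<le> poly P y" for y
    by (rule step_majorant[OF fin neA, where P=P and y=y];
        use P in \<open>auto simp: cAB A_def B_def\<close>)+
  define R where "R = P + pcompose P [:0, - 1:] - 1 - t ^ 2"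
  have poly_R: "poly R y = poly P y + poly P (- y) - 1 - (poly t y)\<^sup>2" for y
    by (simp add: R_def poly_pcompose)
  have dR: "poly (pderiv R) d = poly (pderiv P) d - poly (pderiv P) (- d) - 2 * poly t d * poly (pderiv t) d" for d
    by (simp add: R_def pderiv_add pderiv_diff pderiv_pcompose poly_pcompose pderiv_power pderiv_pCons)
  have "R = 0"
  proof (rule double_roots_imp_zero[OF D(1)])
    show "poly R 0 = 0" using P(2) t0 by (simp add: poly_R)
    have "degree (t ^ 2) \<le> 2 * card D" using D(3) tnz by (simp add: degree_power_eq)
    moreover have "degree (pcompose P [:0, - 1:]) \<le> 2 * card D"
      using P(1) by (simp add: degree_pcompose)
    ultimately show "degree R \<le> 2 * card D"
      unfolding R_def using P(1) by (intro degree_diff_le degree_add_le) auto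
    fix d assume d: "d \<in> D"
    have "d \<noteq> 0" using d D0 by auto
    then show "poly R d = 0"
      using P(3)[OF d] P(3)[OF sym[OF d]] D(4)[OF d] by (auto simp: poly_R)
    show "poly (pderiv R) d = 0"
      using P(4)[OF d] P(4)[OF sym[OF d]] D(4)[OF d] by (simp add: dR)
  qed (rule D0)
  then have "poly P y + poly P (- y) = 1 + (poly t y)\<^sup>2" for y
    using poly_R[of y] by simp
  moreover have "0 \<le> poly P y" for y using step[of y] by (cases "y \<le> 0") auto
  ultimately show ?thesis using P(1) step(2) D(3) by auto
qed

section \<open>From a majorant to a bound on the bias\<close>

lemma avg_ssum_uminus: "avg n (\<lambda>x. G (- ssum n x)) = avg n (\<lambda>x. G (ssum n x))"
proof -
  have "(\<Sum>j\<le>n. real (n choose j) * G (- (2 * real j - real n))) =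
        (\<Sum>j\<le>n. real (n choose j) * G (2 * real j - real n))"
    by (rule sum.reindex_bij_witness[where i="\<lambda>j. n - j" and j="\<lambda>j. n - j"])
       (auto simp: binomial_symmetric[symmetric] of_nat_diff intro!: arg_cong[where f=G])
  then show ?thesis
    using avg_ssum[of n "\<lambda>y. G (- y)"] avg_ssum[of n G] by simp
qed

text \<open>\<open>P(S)\<close> bounds the indicator of majority from above and
  \<open>1 - P(-S)\<close> from below. By the symmetry of \<open>S\<close> under the uniform
  distribution, \<open>P(S)\<close> and \<open>P(-S)\<close> have the same mean \<open>a\<close>,
  and the identity for \<open>P(y) + P(-y)\<close> evaluates it.\<close>

lemma kwise_maj_bias_le:
  fixes t :: "real poly"
  assumes Q: "Q \<in> kwise_dists n k (1 / 2)"
    and even: "\<And>x. poly t (- x) = poly t x" and t0: "poly t 0 = 1"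
    and D: "finite D" "D \<noteq> {}" "degree t = card D" "\<And>d. d \<in> D \<Longrightarrow> poly t d = 0"
    and k: "2 * degree t \<le> k"
  shows "maj_bias n Q \<le> avg n (\<lambda>x. (poly t (ssum n x))\<^sup>2) / 2"
proof -
  obtain P where P: "degree P \<le> 2 * degree t" "\<And>y. 0 \<le> poly P y" "\<And>y. 0 \<le> y \<Longrightarrow> 1 \<le> poly P y"
    "\<And>y. poly P y + poly P (- y) = 1 + (poly t y)\<^sup>2"
    using even_poly_majorant[OF even t0 D] by auto
  have supp: "set_pmf Q \<subseteq> bit_vectors n" using Q by (simp add: kwise_dists_def)
  define P' where "P' = pcompose P [:0, - 1:]"
  have P': "poly P' y = poly P (- y)" for y by (simp add: P'_def poly_pcompose)
  have degP': "degree P' \<le> k" using P(1) k by (simp add: P'_def degree_pcompose)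
  define a where "a = avg n (\<lambda>x. poly P (ssum n x))"
  have EP: "(\<Sum>x\<in>bit_vectors n. pmf Q x * poly P (ssum n x)) = a"
    unfolding a_def using P(1) k by (intro kwise_expectation_poly[OF Q]) simp
  have EP': "(\<Sum>x\<in>bit_vectors n. pmf Q x * poly P (- ssum n x)) = a"
    using kwise_expectation_poly[OF Q degP'] avg_ssum_uminus[of n "poly P"] by (simp add: P' a_def)
  have "a + a = avg n (\<lambda>x. poly P (ssum n x) + poly P (- ssum n x))"
    by (simp add: avg_add avg_ssum_uminus a_def)
  also have "\<dots> = 1 + avg n (\<lambda>x. (poly t (ssum n x))\<^sup>2)"
    by (simp add: P(4) avg_add)
  finally have a: "a = 1 / 2 + avg n (\<lambda>x. (poly t (ssum n x))\<^sup>2) / 2" by simp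
  have prob: "measure_pmf.prob Q {x. maj n x} = (\<Sum>x\<in>bit_vectors n. pmf Q x * of_bool (0 < ssum n x))"
    unfolding pmf_prob_bit_vectors[OF supp] maj_iff ..
  have "measure_pmf.prob Q {x. maj n x} \<le> a"
    unfolding prob EP[symmetric] using P(2,3) by (intro sum_mono mult_left_mono) auto
  moreover have "1 - a \<le> measure_pmf.prob Q {x. maj n x}"
  proof -
    have "1 - a = (\<Sum>x\<in>bit_vectors n. pmf Q x * (1 - poly P (- ssum n x)))"
      by (simp add: right_diff_distrib sum_subtractf EP' sum_pmf_bit_vectors[OF supp])
    also have "\<dots> \<le> measure_pmf.prob Q {x. maj n x}"
      unfolding prob using P(2,3) by (intro sum_mono mult_left_mono) (auto simp: not_less)
    finally show ?thesis .
  qed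
  ultimately show ?thesis unfolding maj_bias_def a by linarith
qed

section \<open>Sine polynomials\<close>

text \<open>Up to the sign \<open>(-1)^j\<close> this is the Chebyshev polynomial
  \<open>T_(2j+1)(x)\<close> divided by \<open>x\<close>. The recursion is that of
  \<open>sin((2j+1)t) / sin t\<close> in \<open>x = sin t\<close>, with
  \<open>2 cos 2t = 2 - 4x^2\<close>.\<close>

fun sine_poly :: "nat \<Rightarrow> real poly" where
  "sine_poly 0 = 1"
| "sine_poly (Suc 0) = [:3, 0, - 4:]"
| "sine_poly (Suc (Suc j)) = [:2, 0, - 4:] * sine_poly (Suc j) - sine_poly j"

lemma sine_poly_sin: "poly (sine_poly j) (sin t) * sin t = sin (real (2 * j + 1) * t)"
proof (induction j rule: sine_poly.induct)
  case 2
  have "sin (3 * t) = sin (2 * t + t)" by simp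
  also have "\<dots> = 2 * sin t * (cos t)\<^sup>2 + (1 - 2 * (sin t)\<^sup>2) * sin t"
    unfolding sin_add sin_double cos_double_sin by (simp add: power2_eq_square)
  also have "\<dots> = (3 - 4 * (sin t)\<^sup>2) * sin t"
    unfolding cos_squared_eq by (simp add: algebra_simps)
  finally show ?case by (simp add: power2_eq_square)
next
  case (3 j)
  have "poly (sine_poly (Suc (Suc j))) (sin t) * sin t =
      2 * (1 - 2 * (sin t)\<^sup>2) * (poly (sine_poly (Suc j)) (sin t) * sin t) - poly (sine_poly j) (sin t) * sin t"
    by (simp add: algebra_simps power2_eq_square)
  also have "\<dots> = 2 * cos (2 * t) * sin (real (2 * Suc j + 1) * t) - sin (real (2 * j + 1) * t)"
    unfolding 3 cos_double_sin[of t] ..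
  also have "2 * cos (2 * t) * sin (real (2 * Suc j + 1) * t) =
      sin (2 * t + real (2 * Suc j + 1) * t) - sin (2 * t - real (2 * Suc j + 1) * t)"
    unfolding mult.assoc[of 2] cos_times_sin by simp
  also have "2 * t + real (2 * Suc j + 1) * t = real (2 * Suc (Suc j) + 1) * t"
    by (simp add: algebra_simps)
  also have "2 * t - real (2 * Suc j + 1) * t = - (real (2 * j + 1) * t)"
    by (simp add: algebra_simps)
  finally show ?case by simp
qed auto

lemma sine_poly_0: "poly (sine_poly j) 0 = real (2 * j + 1)"
  by (induction j rule: sine_poly.induct) auto

lemma sine_poly_even: "poly (sine_poly j) (- x) = poly (sine_poly j) x"
  by (induction j rule: sine_poly.induct) auto

lemma degree_sine_poly_le: "degree (sine_poly j) \<le> 2 * j"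
proof (induction j rule: sine_poly.induct)
  case (3 j)
  have "degree ([:2, 0, - 4:] * sine_poly (Suc j)) \<le> 2 * Suc (Suc j)"
    by (rule order_trans[OF degree_mult_le]) (use 3(1) in simp)
  then show ?case using 3(2) unfolding sine_poly.simps by (intro degree_diff_le) auto
qed auto

lemma abs_sin_mult_le: "\<bar>sin (real m * t)\<bar> \<le> real m * \<bar>sin t\<bar>"
proof (induction m)
  case (Suc m)
  have "\<bar>sin (real (Suc m) * t)\<bar> = \<bar>sin (real m * t) * cos t + cos (real m * t) * sin t\<bar>"
    unfolding sin_add[symmetric] by (simp add: algebra_simps)
  also have "\<dots> \<le> \<bar>sin (real m * t)\<bar> * \<bar>cos t\<bar> + \<bar>cos (real m * t)\<bar> * \<bar>sin t\<bar>"
    by (rule order_trans[OF abs_triangle_ineq]) (simp add: abs_mult)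
  also have "\<dots> \<le> \<bar>sin (real m * t)\<bar> * 1 + 1 * \<bar>sin t\<bar>"
    by (intro add_mono mult_left_mono mult_right_mono) auto
  finally show ?case using Suc by (simp add: distrib_right)
qed auto

text \<open>With \<open>x = sin t\<close> and \<open>m = 2j+1\<close>, the first bound comes from
  \<open>|sin(mt)| \<le> m |sin t|\<close> and the second from \<open>|sin(mt)| \<le> 1\<close>.
  They give the flat top and the decay of the kernel.\<close>

lemma sine_poly_inside:
  assumes "\<bar>x\<bar> \<le> 1"
  shows "(poly (sine_poly j) x)\<^sup>2 \<le> (real (2 * j + 1))\<^sup>2" "x\<^sup>2 * (poly (sine_poly j) x)\<^sup>2 \<le> 1"
proof -
  define t where "t = arcsin x"
  have x: "x = sin t" using assms by (simp add: t_def sin_arcsin)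
  have eq: "poly (sine_poly j) x * x = sin (real (2 * j + 1) * t)"
    unfolding x by (rule sine_poly_sin)
  have "(poly (sine_poly j) x * x)\<^sup>2 \<le> 1" unfolding eq by (simp add: abs_square_le_1)
  then show "x\<^sup>2 * (poly (sine_poly j) x)\<^sup>2 \<le> 1" by (simp add: power_mult_distrib mult.commute)
  have "\<bar>poly (sine_poly j) x\<bar> \<le> real (2 * j + 1)"
  proof (cases "x = 0")
    case True
    then show ?thesis by (simp add: sine_poly_0)
  next
    case False
    have "\<bar>poly (sine_poly j) x\<bar> * \<bar>x\<bar> \<le> real (2 * j + 1) * \<bar>x\<bar>"
      using abs_sin_mult_le[of "2 * j + 1" t] unfolding eq[symmetric] abs_mult x[symmetric] .
    then show ?thesis using False by simp
  qed
  then show "(poly (sine_poly j) x)\<^sup>2 \<le> (real (2 * j + 1))\<^sup>2"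
    by (metis abs_ge_zero power2_abs power_mono)
qed

text \<open>After the alternating sign is removed, the values are nonnegative and nondecreasing in
  the index when \<open>x^2 \<ge> 1\<close>; the recursion then gains at most the factor
  \<open>4x^2\<close> per step.\<close>

lemma sine_poly_outside:
  assumes "1 \<le> \<bar>x\<bar>"
  shows "(poly (sine_poly j) x)\<^sup>2 \<le> (2 * x) ^ (4 * j)"
proof -
  define q where "q i = (- 1) ^ i * poly (sine_poly i) x" for i
  have x2: "1 \<le> x\<^sup>2" using assms abs_le_square_iff[of 1 x] by simp
  have rec: "q (Suc (Suc i)) = (4 * x\<^sup>2 - 2) * q (Suc i) - q i" for i
    by (simp add: q_def algebra_simps power2_eq_square)
  have mono: "0 \<le> q i \<and> q i \<le> q (Suc i)" for i
  proof (induction i)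
    case 0
    then show ?case using x2 by (simp add: q_def power2_eq_square)
  next
    case (Suc i)
    have "2 * q (Suc i) \<le> (4 * x\<^sup>2 - 2) * q (Suc i)"
      using x2 Suc by (intro mult_right_mono) auto
    then show ?case using Suc unfolding rec by linarith
  qed
  have "q i \<le> (4 * x\<^sup>2) ^ i" for i
  proof (induction i)
    case 0
    then show ?case by (simp add: q_def)
  next
    case (Suc i)
    have "q (Suc i) \<le> (4 * x\<^sup>2) * q i"
    proof (cases i)
      case 0
      then show ?thesis by (simp add: q_def power2_eq_square)
    next
      case (Suc l)
      then show ?thesis using mono[of l] mono[of "Suc l"] unfolding Suc rec by (simp add: left_diff_distrib)
    qed
    also have "\<dots> \<le> (4 * x\<^sup>2) * (4 * x\<^sup>2) ^ i" using Suc by (intro mult_left_mono) auto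
    finally show ?case by simp
  qed
  then have "(q j)\<^sup>2 \<le> ((4 * x\<^sup>2) ^ j)\<^sup>2" using mono[of j] by (intro power_mono) auto
  also have "4 * x\<^sup>2 = (2 * x)\<^sup>2" by (simp add: power2_eq_square)
  also have "(((2 * x)\<^sup>2) ^ j)\<^sup>2 = (2 * x) ^ (2 * j * 2)" by (simp only: power_mult)
  also have "2 * j * 2 = 4 * j" by simp
  also have "(q j)\<^sup>2 = (poly (sine_poly j) x)\<^sup>2" by (cases "even j") (simp_all add: q_def)
  finally show ?thesis .
qed

text \<open>The points \<open>sin(i pi / m)\<close> with \<open>0 < |i| \<le> j\<close> are
  distinct, since sine is injective between \<open>- pi/2\<close> and \<open>pi/2\<close>. They
  exhaust the degree bound, so all zeros are real and simple.\<close>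

lemma sine_poly_roots:
  assumes "1 \<le> j"
  shows "\<exists>D. finite D \<and> D \<noteq> {} \<and> degree (sine_poly j) = card D \<and> card D = 2 * j \<and> (\<forall>d\<in>D. poly (sine_poly j) d = 0)"
proof -
  define m where "m = real (2 * j + 1)"
  define I where "I = {- int j..int j} - {0}"
  define \<phi> where "\<phi> i = real_of_int i * (pi / m)" for i
  have bound: "- (pi / 2) < \<phi> i \<and> \<phi> i < pi / 2" if "i \<in> I" for i
  proof -
    have "\<bar>real_of_int i\<bar> \<le> real j" using that by (auto simp: I_def)
    then have "\<bar>real_of_int i\<bar> < m / 2" by (simp add: m_def)
    then have "\<bar>real_of_int i\<bar> * (pi / m) < (m / 2) * (pi / m)"
      by (intro mult_strict_right_mono) (auto simp: m_def)
    moreover have "m \<noteq> 0" by (simp add: m_def)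
    then have "(m / 2) * (pi / m) = pi / 2" by simp
    moreover have "\<bar>\<phi> i\<bar> = \<bar>real_of_int i\<bar> * (pi / m)"
      unfolding \<phi>_def abs_mult by (simp add: m_def)
    ultimately have "\<bar>\<phi> i\<bar> < pi / 2" by (simp only:)
    then show ?thesis by linarith
  qed
  have inj: "inj_on (\<lambda>i. sin (\<phi> i)) I"
  proof (rule inj_onI)
    fix a b assume ab: "a \<in> I" "b \<in> I" "sin (\<phi> a) = sin (\<phi> b)"
    have "\<phi> a = \<phi> b"
      using sin_monotone_2pi[of "\<phi> a" "\<phi> b"] sin_monotone_2pi[of "\<phi> b" "\<phi> a"] bound[OF ab(1)] bound[OF ab(2)] ab(3)
      by (cases "\<phi> a" "\<phi> b" rule: linorder_cases) auto
    then show "a = b" by (simp add: \<phi>_def m_def)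
  qed
  define D where "D = (\<lambda>i. sin (\<phi> i)) ` I"
  have "card I = 2 * j" by (simp add: I_def card_Diff_singleton_if)
  then have cD: "card D = 2 * j" unfolding D_def card_image[OF inj] .
  have root: "poly (sine_poly j) d = 0" if d: "d \<in> D" for d
  proof -
    obtain i where i: "i \<in> I" "d = sin (\<phi> i)" using d by (auto simp: D_def)
    have "\<phi> i \<noteq> 0" using i(1) by (auto simp: \<phi>_def m_def I_def)
    then have "sin (\<phi> i) \<noteq> 0" using bound[OF i(1)] sin_eq_0_pi[of "\<phi> i"] pi_gt_zero by fastforce
    moreover have "m * \<phi> i = real_of_int i * pi" by (simp add: \<phi>_def m_def)
    then have "poly (sine_poly j) (sin (\<phi> i)) * sin (\<phi> i) = 0"
      unfolding sine_poly_sin m_def[symmetric] by (simp add: sin_times_pi_eq_0)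
    ultimately show ?thesis using i(2) by simp
  qed
  have nz: "sine_poly j \<noteq> 0" using sine_poly_0[of j] by auto
  have "card D \<le> degree (sine_poly j)" by (rule card_roots_le_degree[OF nz root])
  then have "degree (sine_poly j) = card D" using degree_sine_poly_le[of j] cD by simp
  moreover have "finite D" by (simp add: D_def I_def)
  moreover have "D \<noteq> {}" using cD assms by auto
  ultimately show ?thesis using cD root by blast
qed

lemma kwise_maj_bias_le_sine_poly:
  assumes Q: "Q \<in> kwise_dists n k (1 / 2)" and j: "1 \<le> j" "4 * j \<le> k" and M: "0 < M"
  shows "maj_bias n Q \<le> avg n (\<lambda>x. (poly (sine_poly j) (ssum n x / M) / real (2 * j + 1))\<^sup>2) / 2"
proof -
  obtain D where D: "finite D" "D \<noteq> {}" "degree (sine_poly j) = card D" "card D = 2 * j"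
    "\<And>d. d \<in> D \<Longrightarrow> poly (sine_poly j) d = 0"
    using sine_poly_roots[OF j(1)] by blast
  \<comment> \<open>Scaling the argument puts the zeros at scale \<open>M\<close>, and dividing by
    the value \<open>2j+1\<close> at 0 gives \<open>t(0) = 1\<close>. The majorant has degree at
    most \<open>2 * degree t = 4j\<close>, whence \<open>4 * j \<le> k\<close>.\<close>
  define t where "t = smult (1 / real (2 * j + 1)) (pcompose (sine_poly j) [:0, 1 / M:])"
  have t: "poly t y = poly (sine_poly j) (y / M) / real (2 * j + 1)" for y
    by (simp add: t_def poly_pcompose)
  have deg: "degree t = 2 * j" using D(3,4) M by (simp add: t_def degree_pcompose)
  have "maj_bias n Q \<le> avg n (\<lambda>x. (poly t (ssum n x))\<^sup>2) / 2"
  proof (rule kwise_maj_bias_le[OF Q])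
    show "poly t (- x) = poly t x" for x using sine_poly_even[of j "x / M"] by (simp add: t)
    show "poly t 0 = 1" by (simp add: t sine_poly_0 del: of_nat_Suc)
    show "finite ((\<lambda>d. M * d) ` D)" "(\<lambda>d. M * d) ` D \<noteq> {}" using D by auto
    have "card ((\<lambda>d. M * d) ` D) = card D" using M by (intro card_image inj_onI) auto
    then show "degree t = card ((\<lambda>d. M * d) ` D)" using deg D(4) by simp
    show "poly t d = 0" if "d \<in> (\<lambda>d. M * d) ` D" for d using that D(5) M by (auto simp: t)
    show "2 * degree t \<le> k" using deg j(2) by simp
  qed
  then show ?thesis by (simp only: t)
qed

text \<open>The growth term is added everywhere instead of being confined to \<open>|y| > M\<close>:
  it is nonnegative, and the two summands can then be averaged separately.\<close>

lemma sine_poly_pointwise: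
  fixes y M :: real and T :: nat
  assumes M: "0 < M" and T: "1 \<le> T" and j: "m = real (2 * j + 1)"
  shows "(poly (sine_poly j) (y / M) / m)\<^sup>2 \<le>
    (if \<bar>y\<bar> < 2 * real T then 1 else (M / m)\<^sup>2 / y\<^sup>2) + (2 * y / M) ^ (4 * j) / m\<^sup>2"
proof -
  have m: "0 < m" by (simp add: j)
  have ev: "even (4 * j)" by simp
  have nn: "0 \<le> (2 * y / M) ^ (4 * j) / m\<^sup>2" using ev by (intro divide_nonneg_nonneg zero_le_even_power) auto
  have w0: "0 \<le> (if \<bar>y\<bar> < 2 * real T then 1 else (M / m)\<^sup>2 / y\<^sup>2)" by simp
  show ?thesis
  proof (cases "\<bar>y / M\<bar> \<le> 1")
    case True
    have 1: "(poly (sine_poly j) (y / M) / m)\<^sup>2 \<le> 1"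
      using sine_poly_inside(1)[OF True, of j] m by (simp add: j power_divide field_simps)
    have 2: "(poly (sine_poly j) (y / M) / m)\<^sup>2 \<le> (M / m)\<^sup>2 / y\<^sup>2" if "y \<noteq> 0"
      using sine_poly_inside(2)[OF True, of j] m M that by (simp add: power_divide field_simps)
    have "(poly (sine_poly j) (y / M) / m)\<^sup>2 \<le> (if \<bar>y\<bar> < 2 * real T then 1 else (M / m)\<^sup>2 / y\<^sup>2)"
      using 1 2 T by (cases "y = 0") auto
    then show ?thesis using nn by linarith
  next
    case False
    then have "(poly (sine_poly j) (y / M))\<^sup>2 \<le> (2 * (y / M)) ^ (4 * j)"
      by (intro sine_poly_outside) simp
    then have "(poly (sine_poly j) (y / M))\<^sup>2 / m\<^sup>2 \<le> (2 * y / M) ^ (4 * j) / m\<^sup>2"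
      by (intro divide_right_mono) auto
    then have "(poly (sine_poly j) (y / M) / m)\<^sup>2 \<le> (2 * y / M) ^ (4 * j) / m\<^sup>2"
      by (simp only: power_divide)
    then show ?thesis using w0 by linarith
  qed
qed

section \<open>The upper bound\<close>

lemma central_binomial_Suc_square:
  "(real (Suc h))\<^sup>2 * (real (2 * Suc h choose Suc h))\<^sup>2 = 4 * (real (2 * h + 1))\<^sup>2 * (real (2 * h choose h))\<^sup>2"
proof -
  have *: "real (Suc h) * real (2 * Suc h choose Suc h) = 2 * real (2 * h + 1) * real (2 * h choose h)"
  proof -
    have a: "Suc h * (Suc (Suc (2 * h)) choose Suc h) = Suc (Suc (2 * h)) * (Suc (2 * h) choose h)"
      by (rule Suc_times_binomial)
    have b: "Suc h * (Suc (2 * h) choose Suc h) = Suc (2 * h) * (2 * h choose h)"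
      by (rule Suc_times_binomial)
    have c: "Suc (2 * h) choose h = Suc (2 * h) choose Suc h"
      using binomial_symmetric[of h "Suc (2 * h)"] by simp
    have "Suc h * (Suc h * (2 * Suc h choose Suc h)) = Suc h * (2 * (2 * h + 1) * (2 * h choose h))"
      using a b c by (simp add: algebra_simps)
    then have "Suc h * (2 * Suc h choose Suc h) = 2 * (2 * h + 1) * (2 * h choose h)"
      by (subst (asm) mult_cancel1) simp
    then show ?thesis by (metis of_nat_mult of_nat_numeral)
  qed
  have "s\<^sup>2 * b\<^sup>2 = 4 * r\<^sup>2 * c\<^sup>2" if "s * b = 2 * r * c" for s b r c :: real
    using arg_cong[OF that, of "\<lambda>u. u\<^sup>2"] by (simp add: power_mult_distrib)
  then show ?thesis using * by blast
qed

text \<open>The shift by 1 gives equality at \<open>h = 0\<close> and lets the induction close: the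
  two sides of \<open>key\<close> differ by only \<open>4h\<close>.\<close>

lemma central_binomial_upper: "(real ((2 * h) choose h))\<^sup>2 * (3 * real h + 1) \<le> 16 ^ h"
proof (induction h)
  case (Suc h)
  have key: "4 * (real (2 * h + 1))\<^sup>2 * (3 * real (Suc h) + 1) \<le> 16 * (real (Suc h))\<^sup>2 * (3 * real h + 1)"
    by (simp add: power2_eq_square algebra_simps)
  have "(real (Suc h))\<^sup>2 * ((real (2 * Suc h choose Suc h))\<^sup>2 * (3 * real (Suc h) + 1))
      = (real (2 * h choose h))\<^sup>2 * (4 * (real (2 * h + 1))\<^sup>2 * (3 * real (Suc h) + 1))"
    using arg_cong[OF central_binomial_Suc_square, of "\<lambda>u. u * (3 * real (Suc h) + 1)"] by (simp only: mult_ac)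
  also have "\<dots> \<le> (real (2 * h choose h))\<^sup>2 * (16 * (real (Suc h))\<^sup>2 * (3 * real h + 1))"
    by (intro mult_left_mono key) simp
  also have "\<dots> = (real (Suc h))\<^sup>2 * (16 * ((real (2 * h choose h))\<^sup>2 * (3 * real h + 1)))"
    by (simp only: mult_ac)
  also have "\<dots> \<le> (real (Suc h))\<^sup>2 * (16 * 16 ^ h)"
    by (intro mult_left_mono Suc) auto
  finally show ?case by simp
qed simp

text \<open>The middle coefficient of an odd row is half the central one of the next row.\<close>

lemma middle_binomial_odd:
  assumes "n = 2 * h + 1"
  shows "(real (n choose h) / 2 ^ n)\<^sup>2 \<le> 2 / (3 * real n)"
proof -
  have s: "n choose Suc h = n choose h"
    using binomial_symmetric[of h n] assms by simp
  have "(2 * Suc h choose Suc h) = 2 * (n choose h)"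
    using s assms by simp
  then have c: "real (n choose h) / 2 ^ n = real (2 * Suc h choose Suc h) / 4 ^ Suc h"
    by (simp add: assms power_mult)
  have "(real (n choose h) / 2 ^ n)\<^sup>2 * (3 * real (Suc h) + 1) = (real (2 * Suc h choose Suc h))\<^sup>2 * (3 * real (Suc h) + 1) / 16 ^ Suc h"
  proof -
    have "((4::real) ^ Suc h)\<^sup>2 = (4\<^sup>2) ^ Suc h" by (simp only: power_mult[symmetric] mult.commute)
    then have "((4::real) ^ Suc h)\<^sup>2 = 16 ^ Suc h" by simp
    then show ?thesis unfolding c power_divide by (simp only: times_divide_eq_left)
  qed
  also have "\<dots> \<le> 1"
    using central_binomial_upper[of "Suc h"] by (simp add: divide_le_eq del: binomial_Suc_Suc)
  finally have "(real (n choose h) / 2 ^ n)\<^sup>2 \<le> 1 / (3 * real (Suc h) + 1)"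
    by (simp add: field_simps)
  also have "\<dots> \<le> 2 / (3 * real n)"
    by (simp add: assms field_simps)
  finally show ?thesis .
qed

text \<open>Termwise comparison with the telescoping \<open>1 / (4a(a+1))\<close>, as
  \<open>(2a+1)^2 \<ge> 4a(a+1)\<close>.\<close>

lemma sum_inverse_odd_squares:
  assumes "1 \<le> T"
  shows "(\<Sum>i<L. 1 / (2 * real (T + i) + 1)\<^sup>2) \<le> (1 / real T - 1 / real (T + L)) / 4"
proof (induction L)
  case (Suc L)
  define a where "a = real (T + L)"
  have a: "0 < a" using assms by (simp add: a_def)
  have "1 / (2 * a + 1)\<^sup>2 \<le> 1 / (4 * a * (a + 1))"
    using a by (intro divide_left_mono mult_pos_pos zero_less_power) (auto simp: power2_eq_square algebra_simps)
  also have "\<dots> = (1 / a - 1 / (a + 1)) / 4" using a by (simp add: field_simps)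
  finally have "1 / (2 * real (T + L) + 1)\<^sup>2 \<le> (1 / real (T + L) - 1 / real (T + Suc L)) / 4"
    by (simp add: a_def add_ac)
  then show ?case using Suc by simp
qed simp

text \<open>\<open>S\<close> takes only odd values, each with probability at most that of the
  central one. On either side at most \<open>T\<close> of them lie below \<open>2T\<close> in
  absolute value, and the remaining inverse squares sum to at most \<open>1/(4T)\<close>.\<close>

lemma avg_truncated_square:
  fixes a :: real
  assumes n: "n = 2 * h + 1" and T: "1 \<le> T"
  shows "avg n (\<lambda>x. if \<bar>ssum n x\<bar> < 2 * real T then 1 else a\<^sup>2 / (ssum n x)\<^sup>2) \<le>
    2 * (real (n choose h) / 2 ^ n) * (real T + a\<^sup>2 / (4 * real T))"
proof -
  define w where "w y = (if \<bar>y\<bar> < 2 * real T then 1 else a\<^sup>2 / y\<^sup>2)" for y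
  have w0: "0 \<le> w y" for y by (simp add: w_def)
  have wm: "w (- y) = w y" for y by (simp add: w_def)
  have split: "(\<Sum>i<T + L. f i) = (\<Sum>i<T. f i) + (\<Sum>i<L. f (T + i))" for f :: "nat \<Rightarrow> real" and L
    by (induction L) simp_all
  have half: "(\<Sum>i\<le>h. w (2 * real i + 1)) \<le> real T + a\<^sup>2 / (4 * real T)"
  proof -
    have "(\<Sum>i\<le>h. w (2 * real i + 1)) \<le> (\<Sum>i<T + Suc h. w (2 * real i + 1))"
      by (rule sum_mono2) (auto simp: w0)
    also have "\<dots> = (\<Sum>i<T. w (2 * real i + 1)) + (\<Sum>i<Suc h. w (2 * real (T + i) + 1))"
      by (rule split)
    also have "(\<Sum>i<T. w (2 * real i + 1)) = real T"
    proof -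
      have "w (2 * real i + 1) = 1" if "i < T" for i using that by (simp add: w_def)
      then show ?thesis by simp
    qed
    also have "(\<Sum>i<Suc h. w (2 * real (T + i) + 1)) = a\<^sup>2 * (\<Sum>i<Suc h. 1 / (2 * real (T + i) + 1)\<^sup>2)"
      unfolding sum_distrib_left by (intro sum.cong) (auto simp: w_def)
    also have "\<dots> \<le> a\<^sup>2 * ((1 / real T - 1 / real (T + Suc h)) / 4)"
      by (intro mult_left_mono sum_inverse_odd_squares[OF T]) auto
    also have "\<dots> \<le> a\<^sup>2 * (1 / real T / 4)"
      by (intro mult_left_mono divide_right_mono) auto
    finally show ?thesis by simp
  qed
  have "(\<Sum>j\<le>n. w (2 * real j - real n)) = (\<Sum>j\<le>h. w (2 * real j - real n)) + (\<Sum>j=Suc h..n. w (2 * real j - real n))"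
  proof -
    have "{..n} = {..h} \<union> {Suc h..n}" by (auto simp: n)
    then show ?thesis by (simp only:) (rule sum.union_disjoint; auto)
  qed
  also have "(\<Sum>j\<le>h. w (2 * real j - real n)) = (\<Sum>i\<le>h. w (2 * real i + 1))"
  proof (rule sum.reindex_bij_witness[where i="\<lambda>j. h - j" and j="\<lambda>j. h - j"])
    fix j assume "j \<in> {..h}"
    then have "2 * real (h - j) + 1 = - (2 * real j - real n)" by (simp add: n of_nat_diff)
    then show "w (2 * real (h - j) + 1) = w (2 * real j - real n)" by (simp only: wm)
  qed auto
  also have "(\<Sum>j=Suc h..n. w (2 * real j - real n)) = (\<Sum>i\<le>h. w (2 * real i + 1))"
    by (rule sum.reindex_bij_witness[where i="\<lambda>i. Suc h + i" and j="\<lambda>j. j - Suc h"])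
       (auto simp: n of_nat_diff intro!: arg_cong[where f=w])
  finally have whole: "(\<Sum>j\<le>n. w (2 * real j - real n)) \<le> 2 * (real T + a\<^sup>2 / (4 * real T))"
    using half by simp
  have "avg n (\<lambda>x. w (ssum n x)) = (\<Sum>j\<le>n. real (n choose j) * w (2 * real j - real n)) / 2 ^ n"
    by (rule avg_ssum)
  also have "\<dots> \<le> (\<Sum>j\<le>n. real (n choose h) * w (2 * real j - real n)) / 2 ^ n"
    using binomial_maximum[of n] by (intro divide_right_mono sum_mono mult_right_mono w0) (auto simp: n)
  also have "\<dots> = real (n choose h) / 2 ^ n * (\<Sum>j\<le>n. w (2 * real j - real n))"
    by (simp only: sum_distrib_left[symmetric] times_divide_eq_left)
  also have "\<dots> \<le> real (n choose h) / 2 ^ n * (2 * (real T + a\<^sup>2 / (4 * real T)))"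
    by (intro mult_left_mono whole) auto
  finally show ?thesis unfolding w_def by (simp only: mult_ac)
qed

section \<open>Exponential moments and high moments of the sum of signs\<close>

lemma cosh_le_exp_half_square: "cosh x \<le> exp (x\<^sup>2 / 2)" for x :: real
proof -
  \<comment> \<open>The derivative of \<open>ln (cosh y)\<close> is \<open>tanh y\<close>, so this
    bound integrates to the claim.\<close>
  have tanh_le: "tanh y \<le> y" if "0 \<le> y" for y :: real
  proof -
    have "(\<lambda>y. y - tanh y) 0 \<le> (\<lambda>y. y - tanh y) y"
    proof (rule DERIV_nonneg_imp_nondecreasing[OF that])
      fix z :: real
      have "((\<lambda>y. y - tanh y) has_real_derivative 1 - (1 - (tanh z)\<^sup>2) * 1) (at z)"
        by (intro DERIV_diff DERIV_ident has_field_derivative_tanh cosh_real_nonzero)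
      then have "((\<lambda>y. y - tanh y) has_real_derivative (tanh z)\<^sup>2) (at z)" by simp
      then show "\<exists>d. ((\<lambda>y. y - tanh y) has_real_derivative d) (at z) \<and> 0 \<le> d"
        using zero_le_power2 by blast
    qed
    then show ?thesis by simp
  qed
  have "ln (cosh y) \<le> y\<^sup>2 / 2" if "0 \<le> y" for y :: real
  proof -
    have "(\<lambda>y. y\<^sup>2 / 2 - ln (cosh y)) 0 \<le> (\<lambda>y. y\<^sup>2 / 2 - ln (cosh y)) y"
    proof (rule DERIV_nonneg_imp_nondecreasing[OF that])
      fix z :: real assume z: "0 \<le> z"
      have "((\<lambda>y. ln (cosh y)) has_real_derivative 1 / cosh z * (sinh z * 1)) (at z)"
        by (intro DERIV_ln_divide[THEN DERIV_chain2] has_field_derivative_cosh DERIV_ident cosh_real_pos)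
      moreover have "((\<lambda>y. y\<^sup>2 / 2) has_real_derivative z) (at z)"
        by (auto intro!: derivative_eq_intros)
      ultimately have "((\<lambda>y. y\<^sup>2 / 2 - ln (cosh y)) has_real_derivative z - tanh z) (at z)"
        unfolding tanh_def using DERIV_diff by fastforce
      then show "\<exists>d. ((\<lambda>y. y\<^sup>2 / 2 - ln (cosh y)) has_real_derivative d) (at z) \<and> 0 \<le> d"
        using tanh_le[OF z] by (intro exI[of _ "z - tanh z"]) simp
    qed
    then show ?thesis by simp
  qed
  from this[of "\<bar>x\<bar>"] have "ln (cosh x) \<le> x\<^sup>2 / 2" by (simp add: cosh_real_abs)
  then have "exp (ln (cosh x)) \<le> exp (x\<^sup>2 / 2)" by (simp only: exp_le_cancel_iff)
  then show ?thesis by simp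
qed

lemma avg_exp_abs_ssum:
  assumes "0 \<le> l"
  shows "avg n (\<lambda>x. exp (l * \<bar>ssum n x\<bar>)) \<le> 2 * exp (l\<^sup>2 * real n / 2)"
proof -
  have E: "avg n (\<lambda>x. exp (c * ssum n x)) \<le> exp (c\<^sup>2 * real n / 2)" for c
  proof -
    have "avg n (\<lambda>x. exp (c * ssum n x)) = avg n (\<lambda>x. \<Prod>i=1..n. exp (c * bsgn (x i)))"
      by (simp add: ssum_def sum_distrib_left exp_sum)
    also have "\<dots> = cosh c ^ n"
      using avg_prod[of n "\<lambda>_ b. exp (c * bsgn b)"] by (simp add: cosh_field_def add.commute)
    also have "\<dots> \<le> exp (c\<^sup>2 / 2) ^ n"
      by (intro power_mono cosh_le_exp_half_square) (simp add: cosh_real_nonneg)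
    also have "\<dots> = exp (c\<^sup>2 * real n / 2)"
      unfolding exp_of_nat_mult[symmetric] by (simp add: mult_ac)
    finally show ?thesis .
  qed
  have "avg n (\<lambda>x. exp (l * \<bar>ssum n x\<bar>)) \<le> avg n (\<lambda>x. exp (l * ssum n x) + exp (- l * ssum n x))"
    by (intro avg_mono) (auto simp: abs_if)
  then show ?thesis using E[of l] E[of "- l"] by (simp add: avg_add)
qed

text \<open>The power is bounded by an exponential through \<open>u \<le> exp (u - 1)\<close>,
  tangent at \<open>u = 1\<close>. The choice of \<open>l\<close> bounds the exponential moment by
  \<open>2 exp N\<close>, which cancels \<open>exp (-N)\<close>; what it takes is
  \<open>8Nn/M^2 \<le> 8/3 \<le> e\<close>, the source of the factor 3.\<close>

lemma avg_ssum_power_le: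
  assumes N: "1 \<le> N" and n: "1 \<le> n" and M: "0 < M" "3 * real N * real n \<le> M\<^sup>2"
  shows "avg n (\<lambda>x. (2 * ssum n x / M) ^ (2 * N)) \<le> 2"
proof -
  define l where "l = sqrt (2 * real N / real n)"
  have l: "0 < l" "l\<^sup>2 = 2 * real N / real n" using N n by (auto simp: l_def)
  have e: "8 / 3 \<le> exp (1::real)"
  proof -
    \<comment> \<open>\<open>41/32 = 1 + 1/4 + 1/32\<close> is the quadratic Taylor bound for
      \<open>exp (1/4)\<close>; its fourth power exceeds \<open>8/3\<close>.\<close>
    have "(41 / 32) ^ 4 \<le> exp (1 / 4 :: real) ^ 4"
      using exp_lower_Taylor_quadratic[of "1 / 4 :: real"] by (intro power_mono) (auto simp: power2_eq_square)
    also have "\<dots> = exp 1" by (simp add: exp_of_nat_mult[symmetric])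
    finally show ?thesis by (rule order_trans[rotated]) (simp add: power4_eq_xxxx)
  qed
  have pt: "(2 * y / M) ^ (2 * N) \<le> exp (- real N) * exp (l * \<bar>y\<bar>)" for y
  proof -
    define u where "u = l * \<bar>y\<bar> / (2 * real N)"
    have u0: "0 \<le> u" using l by (simp add: u_def)
    have "u \<le> exp (u - 1)" using exp_ge_add_one_self[of "u - 1"] by simp
    then have "u ^ (2 * N) \<le> exp (u - 1) ^ (2 * N)" by (intro power_mono u0)
    also have "\<dots> = exp (real (2 * N) * (u - 1))" by (simp only: exp_of_nat_mult)
    also have "real (2 * N) * (u - 1) = l * \<bar>y\<bar> - 2 * real N" using N by (simp add: u_def field_simps)
    finally have u: "u ^ (2 * N) \<le> exp (l * \<bar>y\<bar> - 2 * real N)" .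
    have "2 * \<bar>y\<bar> / M = 4 * real N / (l * M) * u" using l(1) N M(1) by (simp add: u_def)
    then have "(2 * y / M) ^ (2 * N) = (4 * real N / (l * M) * u) ^ (2 * N)"
      using M(1) by (metis abs_divide abs_mult abs_numeral abs_of_pos even_mult_iff even_numeral power_even_abs)
    also have "\<dots> = ((4 * real N / (l * M))\<^sup>2) ^ N * u ^ (2 * N)"
      by (simp only: power_mult_distrib power_mult)
    also have "(4 * real N / (l * M))\<^sup>2 \<le> exp 1"
    proof -
      have "(4 * real N / (l * M))\<^sup>2 = 8 * real N * real n / M\<^sup>2"
        using l N n M(1) by (simp add: power_divide power_mult_distrib l(2) power2_eq_square field_simps)
      also have "\<dots> \<le> 8 * real N * real n / (3 * real N * real n)"
        using M N n by (intro divide_left_mono) auto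
      also have "\<dots> = 8 / 3" using N n by simp
      finally show ?thesis using e by simp
    qed
    then have "((4 * real N / (l * M))\<^sup>2) ^ N * u ^ (2 * N) \<le> exp 1 ^ N * exp (l * \<bar>y\<bar> - 2 * real N)"
      by (intro mult_mono power_mono u) (auto simp: u0)
    also have "\<dots> = exp (- real N) * exp (l * \<bar>y\<bar>)"
    proof -
      have "exp 1 ^ N = exp (real N)" using exp_of_nat_mult[of N "1::real"] by simp
      then show ?thesis by (simp flip: exp_add)
    qed
    finally show ?thesis .
  qed
  have "avg n (\<lambda>x. (2 * ssum n x / M) ^ (2 * N)) \<le> avg n (\<lambda>x. exp (- real N) * exp (l * \<bar>ssum n x\<bar>))"
    by (intro avg_mono pt)
  also have "\<dots> = exp (- real N) * avg n (\<lambda>x. exp (l * \<bar>ssum n x\<bar>))" by (rule avg_cmult)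
  also have "\<dots> \<le> exp (- real N) * (2 * exp (l\<^sup>2 * real n / 2))"
    using l by (intro mult_left_mono avg_exp_abs_ssum) auto
  also have "l\<^sup>2 * real n / 2 = real N" using n by (simp add: l(2))
  also have "exp (- real N) * (2 * exp (real N)) = 2" by (simp add: exp_minus)
  finally show ?thesis .
qed

lemma maj_bias_le_half: "maj_bias n Q \<le> 1 / 2"
proof -
  have "measure_pmf.prob Q {x. maj n x} \<le> 1" "0 \<le> measure_pmf.prob Q {x. maj n x}" by auto
  then show ?thesis unfolding maj_bias_def by linarith
qed

text \<open>For \<open>k \<le> 32\<close> the right-hand side is at least 1/2. Otherwise the main
  term is \<open>c * a\<close>, at most \<open>sqrt (2/m)\<close> with \<open>m\<close> at least
  \<open>k/2\<close>. This is below the target \<open>2 / sqrt m\<close> by a factor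
  \<open>sqrt 2\<close>, which pays for the rounding of \<open>T\<close> and for the tail
  \<open>1/m^2\<close>.\<close>

lemma kwise_maj_bias_upper:
  assumes Q: "Q \<in> kwise_dists n k (1 / 2)" and n: "odd n" and k: "even k" "2 \<le> k" "k < n"
  shows "maj_bias n Q \<le> 2 * sqrt 2 / sqrt (real k)"
proof (cases "k \<le> 32")
  case True
  have "sqrt (real k) \<le> sqrt 32" using True by simp
  also have "sqrt 32 = 4 * sqrt (2::real)"
    using real_sqrt_mult[of 16 2] by simp
  finally have "1 / 2 \<le> 2 * sqrt 2 / sqrt (real k)"
    using k by (simp add: field_simps)
  then show ?thesis using maj_bias_le_half[of n Q] by linarith
next
  case False
  define j where "j = k div 4"
  define m where "m = real (2 * j + 1)"
  obtain h where h: "n = 2 * h + 1" using n by (auto elim: oddE)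
  have j: "8 \<le> j" "4 * j \<le> k" "k \<le> 4 * j + 2" using False k(1) by (auto simp: j_def)
  have m: "17 \<le> m" "real k \<le> 2 * m" "2 * m \<le> real n + 1" using j k by (auto simp: m_def)
  have n33: "33 \<le> n" using False k by simp
  define M where "M = sqrt (3 * real n * m)"
  have M: "0 < M" "M\<^sup>2 = 3 * real n * m" using n33 m by (auto simp: M_def)
  define a where "a = M / m"
  have a: "0 < a" "a\<^sup>2 = 3 * real n / m"
    using M m by (auto simp: a_def power_divide power2_eq_square)
  \<comment> \<open>\<open>T + a^2/(4T)\<close> is minimal, with value \<open>a\<close>, at
    \<open>T = a/2\<close>; the ceiling makes \<open>T\<close> an integer.\<close>
  define T where "T = nat \<lceil>a / 2\<rceil>"
  have T: "1 \<le> T" "a / 2 \<le> real T" "real T < a / 2 + 1"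
    using a(1) by (auto simp: T_def) linarith+
  define c where "c = real (n choose h) / 2 ^ n"
  have c: "0 \<le> c" "c\<^sup>2 \<le> 2 / (3 * real n)" using middle_binomial_odd[OF h] by (auto simp: c_def)
  have "avg n (\<lambda>x. (poly (sine_poly j) (ssum n x / M) / m)\<^sup>2) \<le>
      avg n (\<lambda>x. (if \<bar>ssum n x\<bar> < 2 * real T then 1 else a\<^sup>2 / (ssum n x)\<^sup>2) + (2 * ssum n x / M) ^ (4 * j) / m\<^sup>2)"
    unfolding a_def by (intro avg_mono sine_poly_pointwise M T m_def)
  also have "\<dots> = avg n (\<lambda>x. if \<bar>ssum n x\<bar> < 2 * real T then 1 else a\<^sup>2 / (ssum n x)\<^sup>2)
      + avg n (\<lambda>x. (2 * ssum n x / M) ^ (2 * (2 * j))) / m\<^sup>2"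
    using avg_cmult[of n "1 / m\<^sup>2" "\<lambda>x. (2 * ssum n x / M) ^ (4 * j)"] by (simp add: avg_add)
  also have "\<dots> \<le> 2 * c * (real T + a\<^sup>2 / (4 * real T)) + 2 / m\<^sup>2"
  proof (intro add_mono divide_right_mono)
    show "avg n (\<lambda>x. if \<bar>ssum n x\<bar> < 2 * real T then 1 else a\<^sup>2 / (ssum n x)\<^sup>2) \<le> 2 * c * (real T + a\<^sup>2 / (4 * real T))"
      unfolding c_def by (rule avg_truncated_square[OF h T(1)])
    show "avg n (\<lambda>x. (2 * ssum n x / M) ^ (2 * (2 * j))) \<le> 2"
      using j n33 M by (intro avg_ssum_power_le) (auto simp: m_def algebra_simps)
  qed simp
  finally have main: "maj_bias n Q \<le> c * (real T + a\<^sup>2 / (4 * real T)) + 1 / m\<^sup>2"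
    using kwise_maj_bias_le_sine_poly[OF Q _ j(2) M(1)] j(1) unfolding m_def by simp
  \<comment> \<open>The square is the cost of rounding. It contributes at most
    \<open>1/(a/2)\<close>, a share \<open>2/a^2\<close> of \<open>a\<close>, and this share is
    below 0.35 because \<open>2m \<le> n + 1\<close>.\<close>
  have "real T + a\<^sup>2 / (4 * real T) = a + (real T - a / 2)\<^sup>2 / real T"
    using T(1) by (simp add: field_simps power2_eq_square)
  also have "(real T - a / 2)\<^sup>2 / real T \<le> 1 / (a / 2)"
    using T a(1) by (intro frac_le) (auto simp: power_le_one)
  also have "1 / (a / 2) = a * (2 / a\<^sup>2)" using a(1) by (simp add: power2_eq_square)
  also have "2 / a\<^sup>2 = 2 * m / (3 * real n)" using a(2) by simp
  also have "\<dots> \<le> 35 / 100" using m n33 by (simp add: field_simps)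
  finally have Tb: "real T + a\<^sup>2 / (4 * real T) \<le> a * (135 / 100)" using a(1) by (simp add: mult_left_mono)
  have "(c * a)\<^sup>2 \<le> 2 / (3 * real n) * (3 * real n / m)"
    unfolding power_mult_distrib a(2)[symmetric] by (intro mult_right_mono c(2)) simp
  also have "\<dots> = 2 / m" using n33 by simp
  finally have "c * a \<le> sqrt (2 / m)" by (rule real_le_rsqrt)
  then have ca: "c * a \<le> sqrt 2 / sqrt m" by (simp add: real_sqrt_divide)
  have "c * (real T + a\<^sup>2 / (4 * real T)) \<le> (c * a) * (135 / 100)"
    using mult_left_mono[OF Tb c(1)] by simp
  also have "\<dots> \<le> sqrt 2 / sqrt m * (135 / 100)" using ca by (intro mult_right_mono) auto
  also have "\<dots> \<le> 191 / 100 / sqrt m"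
  proof -
    have "sqrt 2 \<le> (14147 / 10000 :: real)" by (rule real_le_lsqrt) (auto simp: power2_eq_square)
    then have "sqrt 2 * (135 / 100) \<le> (191 / 100 :: real)" by simp
    then have "sqrt 2 * (135 / 100) / sqrt m \<le> 191 / 100 / sqrt m" using m by (intro divide_right_mono) auto
    then show ?thesis by (simp only: times_divide_eq_left)
  qed
  finally have p: "c * (real T + a\<^sup>2 / (4 * real T)) \<le> 191 / 100 / sqrt m" .
  have "1 / m\<^sup>2 \<le> 9 / 100 / sqrt m"
  proof -
    have "sqrt m \<le> m" using m by (intro real_le_lsqrt) (auto simp: power2_eq_square)
    then have "sqrt m * 100 \<le> 9 * (m * m)" using m mult_mono[of 17 m m m] by linarith
    then show ?thesis using m by (simp add: field_simps power2_eq_square)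
  qed
  then have "maj_bias n Q \<le> 191 / 100 / sqrt m + 9 / 100 / sqrt m" using main p by linarith
  also have "\<dots> = 2 / sqrt m" by (simp add: add_divide_distrib[symmetric])
  also have "2 / sqrt m \<le> 2 * sqrt 2 / sqrt (real k)"
  proof -
    have "sqrt (real k) \<le> sqrt (2 * m)" using m by simp
    then have "sqrt (real k) \<le> sqrt 2 * sqrt m" by (simp add: real_sqrt_mult)
    then show ?thesis using m k by (simp add: field_simps)
  qed
  finally show ?thesis .
qed

section \<open>Existence of a maximizer\<close>

lemma kwise_arg_max_exists:
  assumes Q0: "Q0 \<in> kwise_dists n k (1 / 2)" and k: "1 \<le> k"
  shows "\<exists>Q. is_arg_max (maj_bias n) (\<lambda>Q. Q \<in> kwise_dists n k (1 / 2)) Q"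
proof -
  define V where "V = bit_vectors n"
  \<comment> \<open>Weights are functions on the whole type \<open>nat \<Rightarrow> bool\<close>;
    pinning the coordinates outside \<open>V\<close> to 0 makes the box a product of compact sets,
    compact by Tychonoff.\<close>
  define box :: "((nat \<Rightarrow> bool) \<Rightarrow> real) set" where "box = PiE UNIV (\<lambda>x. if x \<in> V then {0..1} else {0})"
  define TT where "TT = {T. T \<subseteq> {1..n} \<and> T \<noteq> {} \<and> card T \<le> k}"
  define K where "K = box \<inter> ({f. (\<Sum>x\<in>V. f x) = 1} \<inter> (\<Inter>T\<in>TT. {f. (\<Sum>x\<in>V. f x * chi T x) = 0}))"
  define g where "g f = \<bar>(\<Sum>x\<in>V. f x * of_bool (maj n x)) - 1 / 2\<bar>" for f :: "(nat \<Rightarrow> bool) \<Rightarrow> real"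
  have coord: "continuous_on S (\<lambda>f. f x)" for x :: "nat \<Rightarrow> bool" and S :: "((nat \<Rightarrow> bool) \<Rightarrow> real) set"
    by (rule continuous_on_subset[OF continuous_on_product_coordinates]) simp
  have "compactin (product_topology (\<lambda>_. euclidean) UNIV) box"
    unfolding box_def by (subst compactin_PiE) auto
  then have "compact box" by (simp add: euclidean_product_topology)
  moreover have "closed ({f. (\<Sum>x\<in>V. f x) = 1} \<inter> (\<Inter>T\<in>TT. {f. (\<Sum>x\<in>V. f x * chi T x) = 0}))"
    by (intro closed_Int closed_INT ballI closed_Collect_eq continuous_intros coord)
  ultimately have "compact K" unfolding K_def by (rule compact_Int_closed)
  have pmf_K: "pmf Q \<in> K \<and> maj_bias n Q = g (pmf Q)" if "Q \<in> kwise_dists n k (1 / 2)" for Q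
  proof -
    have supp: "set_pmf Q \<subseteq> V" using that by (simp add: kwise_dists_def V_def)
    then have "pmf Q x = 0" if "x \<notin> V" for x using that by (auto simp: set_pmf_iff)
    then have "pmf Q \<in> box" by (auto simp: box_def PiE_iff pmf_le_1)
    moreover have "sum (pmf Q) V = 1"
      using sum_pmf_bit_vectors[of Q n] supp by (simp only: V_def)
    moreover have "(\<Sum>x\<in>V. pmf Q x * chi T x) = 0" if "T \<in> TT" for T
      using \<open>Q \<in> _\<close> that unfolding kwise_dists_iff[OF k] TT_def V_def by blast
    moreover have "maj_bias n Q = g (pmf Q)"
      using pmf_prob_bit_vectors[of Q n "maj n"] supp by (simp only: V_def maj_bias_def g_def)
    ultimately show ?thesis by (simp add: K_def)
  qed
  have "continuous_on K g"
    unfolding g_def by (intro continuous_intros coord)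
  moreover have "K \<noteq> {}" using pmf_K[OF Q0] by auto
  ultimately obtain f where f: "f \<in> K" "\<And>f'. f' \<in> K \<Longrightarrow> g f' \<le> g f"
    using continuous_attains_sup[OF \<open>compact K\<close>] by blast
  define w where "w x = 2 ^ n * f x" for x
  have w0: "0 \<le> w x" if "x \<in> bit_vectors n" for x
  proof -
    have "f x \<in> (if x \<in> V then {0..1} else {0})" using f(1) by (simp add: K_def box_def PiE_iff)
    then show ?thesis using that by (simp add: w_def V_def)
  qed
  have w1: "avg n w = 1"
    using f(1) unfolding avg_def w_def sum_distrib_left[symmetric] by (simp add: K_def V_def)
  have avg_w: "avg n (\<lambda>x. w x * u x) = (\<Sum>x\<in>V. f x * u x)" for u
    unfolding avg_def w_def V_def mult.assoc sum_distrib_left[symmetric] by simp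
  have "density_pmf n w \<in> kwise_dists n k (1 / 2)"
    using f(1) by (intro density_pmf_kwise w0 w1 k) (auto simp: avg_w K_def TT_def)
  moreover have "maj_bias n (density_pmf n w) = g f"
    using maj_bias_density_pmf[of n w, OF w0 w1] by (simp only: avg_w g_def)
  ultimately show ?thesis
    using pmf_K f(2) by (intro exI[of _ "density_pmf n w"]) (auto simp: is_arg_max_def not_less)
qed

section \<open>The XOR distribution\<close>

lemma chi_full: "chi {1..n} x = (- 1) ^ (n - card {i\<in>{1..n}. x i})"
proof -
  have "chi {1..n} x = (\<Prod>i\<in>{1..n}. if x i then 1 else - 1)"
    unfolding chi_def by (intro prod.cong) (auto simp: bsgn_def)
  also have "\<dots> = (- 1) ^ card ({1..n} - {i\<in>{1..n}. x i})"
    by (subst prod.If_cases) (auto simp: Int_def set_diff_eq intro!: arg_cong[where f="\<lambda>A. (- 1) ^ card A"])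
  also have "card ({1..n} - {i\<in>{1..n}. x i}) = n - card {i\<in>{1..n}. x i}"
    by (subst card_Diff_subset) auto
  finally show ?thesis .
qed

lemma ssum_odd_nz:
  assumes "odd n" shows "ssum n x \<noteq> 0"
proof
  assume "ssum n x = 0"
  then have "real (2 * card {i\<in>{1..n}. x i}) = real n" by (simp add: ssum_conv_card)
  then have "2 * card {i\<in>{1..n}. x i} = n" by (simp only: of_nat_eq_iff)
  then show False using assms by (metis dvd_triv_left)
qed

lemma avg_maj:
  assumes "odd n" shows "avg n (\<lambda>x. of_bool (maj n x)) = 1 / 2"
proof -
  have "1 = avg n (\<lambda>x. of_bool (0 < ssum n x) + of_bool (0 < - ssum n x))"
    using ssum_odd_nz[OF assms] by (subst avg_cong[where G="\<lambda>_. 1"]) (auto simp: not_less_iff_gr_or_eq)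
  also have "\<dots> = 2 * avg n (\<lambda>x. of_bool (0 < ssum n x))"
    using avg_ssum_uminus[of n "\<lambda>y. of_bool (0 < y)"] by (simp add: avg_add)
  finally show ?thesis by (simp add: maj_iff)
qed

text \<open>Majority is a threshold in the number of ones, so the sum is an alternating partial row
  of binomials, and \<open>(\<Sum>i\<le>h. (-1)^i (n choose i)) = (-1)^h (n - 1 choose
  h)\<close>.\<close>

lemma avg_chi_maj:
  assumes n: "n = 2 * h + 1"
  shows "avg n (\<lambda>x. chi {1..n} x * of_bool (maj n x)) = (- 1) ^ h * real (2 * h choose h) / 2 ^ n"
proof -
  \<comment> \<open>The number of \<open>False\<close> bits is \<open>(n - S)/2\<close>, so the full
    character is a function of \<open>S\<close> alone and \<open>avg_ssum\<close> applies.\<close>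
  define G :: "real \<Rightarrow> real" where "G y = (- 1) ^ nat \<lfloor>(real n - y) / 2\<rfloor> * of_bool (0 < y)" for y
  have G: "G (2 * real j - real n) = (- 1) ^ (n - j) * of_bool (h < j)" if "j \<le> n" for j
  proof -
    have 1: "(real n - (2 * real j - real n)) / 2 = real (n - j)" using that by (simp add: of_nat_diff)
    have 2: "0 < 2 * real j - real n \<longleftrightarrow> h < j" by (auto simp: n)
    show ?thesis unfolding G_def 1 2 floor_of_nat nat_int ..
  qed
  have "chi {1..n} x * of_bool (maj n x) = G (ssum n x)" for x
  proof -
    have "card {i\<in>{1..n}. x i} \<le> card {1..n}" by (rule card_mono) auto
    then have c: "card {i\<in>{1..n}. x i} \<le> n" by simp
    show ?thesis
      unfolding chi_full maj_def ssum_conv_card G[OF c] using maj_iff[of n x] unfolding maj_def ssum_conv_card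
      by (auto simp: n)
  qed
  then have "avg n (\<lambda>x. chi {1..n} x * of_bool (maj n x)) = (\<Sum>j\<le>n. real (n choose j) * G (2 * real j - real n)) / 2 ^ n"
    by (simp only: avg_ssum)
  also have "(\<Sum>j\<le>n. real (n choose j) * G (2 * real j - real n)) = (\<Sum>j\<in>{h<..n}. real (n choose j) * (- 1) ^ (n - j))"
    by (rule sum.mono_neutral_cong_right) (auto simp: G)
  also have "\<dots> = (\<Sum>i\<le>h. real (n choose i) * (- 1) ^ i)"
    by (rule sum.reindex_bij_witness[where i="\<lambda>i. n - i" and j="\<lambda>j. n - j"])
       (auto simp: n binomial_symmetric[symmetric])
  also have "\<dots> = (- 1) ^ h * real (2 * h choose h)"
    using gbinomial_sum_lower_neg[of "real n" h] by (simp add: binomial_gbinomial n)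
  finally show ?thesis .
qed

lemma central_binomial_lower:
  assumes "1 \<le> h"
  shows "16 ^ h \<le> 4 * real h * (real ((2 * h) choose h))\<^sup>2"
  using assms
proof (induction h rule: nat_induct_at_least)
  case (Suc h)
  have h: "0 < real h" using Suc.hyps by simp
  have "real h * (real (Suc h) * 16 ^ Suc h) = 16 * (real h * real (Suc h)) * 16 ^ h" by simp
  also have "\<dots> \<le> 16 * (real h * real (Suc h)) * (4 * real h * (real (2 * h choose h))\<^sup>2)"
    by (intro mult_left_mono Suc.IH) simp
  also have "\<dots> = 16 * real h * (4 * (real h * real (Suc h))) * (real (2 * h choose h))\<^sup>2" by simp
  also have "\<dots> \<le> 16 * real h * (real (2 * h + 1))\<^sup>2 * (real (2 * h choose h))\<^sup>2"
    by (intro mult_right_mono mult_left_mono) (auto simp: power2_eq_square algebra_simps)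
  also have "\<dots> = real h * (4 * ((real (Suc h))\<^sup>2 * (real (2 * Suc h choose Suc h))\<^sup>2))"
    unfolding central_binomial_Suc_square by simp
  also have "\<dots> = real h * (real (Suc h) * (4 * real (Suc h) * (real (2 * Suc h choose Suc h))\<^sup>2))"
    by (simp only: power2_eq_square mult_ac)
  finally show ?case using h by (simp only: mult_le_cancel_left_pos of_nat_0_less_iff zero_less_Suc)
qed simp

text \<open>The parity constraint makes the number of ones even. As \<open>n\<close> is odd, an odd
  number of signs is then -1, so the support is where \<open>chi {1..n}\<close> is -1; uniformity
  there is the density \<open>1 - chi {1..n}\<close>.\<close>

lemma xor0_eq_density:
  assumes "odd n"
  shows "xor0 n = density_pmf n (\<lambda>x. 1 - chi {1..n} x)"
    and "x \<in> bit_vectors n \<Longrightarrow> 0 \<le> 1 - chi {1..n} x"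
    and "avg n (\<lambda>x. 1 - chi {1..n} x) = 1"
proof -
  show nonneg: "0 \<le> 1 - chi {1..n} x" for x
    using abs_chi[of "{1..n}" x] by linarith
  have "{1..n} \<noteq> {}" using assms by (auto elim: oddE)
  then show total: "avg n (\<lambda>x. 1 - chi {1..n} x) = 1"
    by (simp add: avg_diff avg_chi)
  define m where "m = n - 1"
  have n: "n = Suc m" using assms by (auto simp: m_def elim: oddE)
  have m: "even m" using assms n by simp
  define par where "par x = odd (\<Sum>i=1..m. of_bool (x i) :: nat)" for x :: "nat \<Rightarrow> bool"
  define ext where "ext x = x(n := par x)" for x
  have chi_m: "chi {1..m} x = (if par x then - 1 else 1)" for x
  proof -
    have "chi {1..m} x = (\<Prod>i=1..m. - ((- 1) ^ of_bool (x i)))"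
      unfolding chi_def by (intro prod.cong) auto
    also have "\<dots> = (- 1) ^ (\<Sum>i=1..m. of_bool (x i))"
      unfolding power_sum prod_uminus using m by simp
    finally show ?thesis by (simp add: par_def)
  qed
  have chi_n: "chi {1..n} x = - 1 \<longleftrightarrow> x n = par x" for x
  proof -
    have "{1..n} = insert n {1..m}" by (auto simp: n)
    then have "chi {1..n} x = bsgn (x n) * chi {1..m} x" by (simp add: chi_def n)
    then show ?thesis unfolding chi_m by (auto simp: bsgn_def)
  qed
  have par_upd: "par (x(n := b)) = par x" for x b
    unfolding par_def by (auto intro!: arg_cong[where f=odd] sum.cong simp: n)
  define V where "V = {y\<in>bit_vectors n. chi {1..n} y = - 1}"
  have img: "ext ` bit_vectors m = V"
  proof (intro set_eqI iffI)
    fix y assume "y \<in> ext ` bit_vectors m"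
    then show "y \<in> V" unfolding V_def mem_Collect_eq chi_n
      using par_upd by (auto simp: ext_def bit_vectors_alt n)
  next
    fix y assume "y \<in> V"
    then have y: "y \<in> bit_vectors n" "y n = par y" unfolding V_def mem_Collect_eq chi_n by blast+
    have "y(n := False) \<in> bit_vectors m"
      using y(1) unfolding bit_vectors_alt by (auto simp: n)
    moreover have "ext (y(n := False)) = y" by (simp add: ext_def par_upd flip: y(2))
    ultimately show "y \<in> ext ` bit_vectors m" by (metis imageI)
  qed
  have inj: "inj_on ext (bit_vectors m)"
  proof (rule inj_onI)
    fix x y assume xy: "x \<in> bit_vectors m" "y \<in> bit_vectors m" "ext x = ext y"
    show "x = y"
    proof
      fix i show "x i = y i"
        using fun_cong[OF xy(3), of i] bit_vectors_Suc_False[OF xy(1)] bit_vectors_Suc_False[OF xy(2)]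
        by (cases "i = n") (auto simp: ext_def n)
    qed
  qed
  have ne: "bit_vectors m \<noteq> {}" by (metis card.empty card_bit_vectors power_not_zero zero_neq_numeral)
  have "Pi_pmf {1..m} False (\<lambda>_. bernoulli_pmf (1 / 2)) = pmf_of_set (bit_vectors m)"
    unfolding bernoulli_pmf_half_conv_pmf_of_set bit_vectors_def by (subst Pi_pmf_of_set) auto
  then have "xor0 n = map_pmf ext (pmf_of_set (bit_vectors m))"
    by (simp add: xor0_def ext_def[abs_def] par_def m_def)
  also have "\<dots> = pmf_of_set V"
    unfolding img[symmetric] by (rule map_pmf_of_set_inj[OF inj ne]) simp
  finally have xor: "xor0 n = pmf_of_set V" .
  have V: "finite V" "V \<noteq> {}" "card V = 2 ^ m"
    using ne by (auto simp: card_image[OF inj] simp flip: img)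
  show "xor0 n = density_pmf n (\<lambda>x. 1 - chi {1..n} x)"
  proof (rule pmf_eqI)
    fix x
    have "chi {1..n} x = 1 \<or> chi {1..n} x = - 1" using abs_chi[of "{1..n}" x] by linarith
    then show "pmf (xor0 n) x = pmf (density_pmf n (\<lambda>x. 1 - chi {1..n} x)) x"
      using V(3) unfolding xor pmf_of_set[OF V(2,1)] pmf_density_pmf[OF nonneg total]
      by (auto simp: V_def n indicator_def)
  qed
qed

text \<open>The density differs from 1 by a single character, and that one has size
  \<open>n > k\<close>.\<close>

lemma xor0_kwise:
  assumes "odd n" "1 \<le> k" "k < n"
  shows "xor0 n \<in> kwise_dists n k (1 / 2)"
  unfolding xor0_eq_density(1)[OF assms(1)]
proof (rule density_pmf_kwise[OF xor0_eq_density(2,3)[OF assms(1)] assms(2)])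
  fix T :: "nat set" assume T: "T \<subseteq> {1..n}" "T \<noteq> {}" "card T \<le> k"
  have "T \<noteq> {1..n}" using T(3) assms(3) by auto
  then show "avg n (\<lambda>x. (1 - chi {1..n} x) * chi T x) = 0"
    using T avg_chi_mult[of "{1..n}" n T] by (simp add: left_diff_distrib avg_diff avg_chi)
qed auto

lemma maj_bias_xor0:
  assumes n: "n = 2 * h + 1"
  shows "maj_bias n (xor0 n) = real (2 * h choose h) / 2 ^ n"
proof -
  have odd: "odd n" using n by simp
  have "maj_bias n (xor0 n) = \<bar>avg n (\<lambda>x. (1 - chi {1..n} x) * of_bool (maj n x)) - 1 / 2\<bar>"
    unfolding xor0_eq_density(1)[OF odd] by (rule maj_bias_density_pmf[OF xor0_eq_density(2,3)[OF odd]])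
  also have "avg n (\<lambda>x. (1 - chi {1..n} x) * of_bool (maj n x)) = 1 / 2 - (- 1) ^ h * real (2 * h choose h) / 2 ^ n"
    unfolding left_diff_distrib avg_diff mult_1 avg_maj[OF odd] avg_chi_maj[OF n] ..
  finally show ?thesis by (simp add: abs_mult power_abs)
qed

lemma maj_bias_xor0_ge:
  assumes "odd n"
  shows "1 / (3 * sqrt (real n)) \<le> maj_bias n (xor0 n)"
proof -
  obtain h where n: "n = 2 * h + 1" using assms by (auto elim: oddE)
  define c where "c = real (2 * h choose h)"
  have "4 * 16 ^ h \<le> 9 * real n * c\<^sup>2"
  proof (cases "h = 0")
    case True
    then show ?thesis by (simp add: n c_def)
  next
    case False
    then have "16 ^ h \<le> 4 * real h * c\<^sup>2" unfolding c_def by (intro central_binomial_lower) simp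
    moreover have "2 * real h * c\<^sup>2 \<le> real n * c\<^sup>2" by (intro mult_right_mono) (auto simp: n)
    moreover have "0 \<le> real n * c\<^sup>2" by simp
    ultimately show ?thesis by linarith
  qed
  moreover have "(2 ^ n)\<^sup>2 = (4::real) * 16 ^ h"
  proof -
    have "((2::real) ^ n)\<^sup>2 = 2 ^ (2 + 4 * h)" unfolding power_mult[symmetric] n by (simp add: algebra_simps)
    then show ?thesis unfolding power_add power_mult by simp
  qed
  moreover have "(3 * sqrt (real n) * c)\<^sup>2 = 9 * real n * c\<^sup>2" by (simp add: power_mult_distrib)
  ultimately have "2 ^ n \<le> 3 * sqrt (real n) * c"
    by (intro power2_le_imp_le[of "2 ^ n"]) (auto simp: c_def)
  then show ?thesis
    unfolding maj_bias_xor0[OF n] c_def[symmetric] using n by (simp add: field_simps)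
qed

section \<open>Hypercontractivity and bounded corrections\<close>

definition low_sets :: "nat \<Rightarrow> nat \<Rightarrow> nat set set" where
  "low_sets n k = {T. T \<subseteq> {1..n} \<and> card T \<le> k}"

lemma finite_low_sets [simp]: "finite (low_sets n k)"
  by (rule finite_subset[of _ "Pow {1..n}"]) (auto simp: low_sets_def)

definition low_poly :: "nat \<Rightarrow> nat \<Rightarrow> (nat set \<Rightarrow> real) \<Rightarrow> (nat \<Rightarrow> bool) \<Rightarrow> real" where
  "low_poly n k a x = (\<Sum>T\<in>low_sets n k. a T * chi T x)"

lemma avg_low_poly_chi:
  assumes "T \<in> low_sets n k"
  shows "avg n (\<lambda>x. low_poly n k a x * chi T x) = a T"
proof -
  have "avg n (\<lambda>x. low_poly n k a x * chi T x) = avg n (\<lambda>x. \<Sum>U\<in>low_sets n k. a U * (chi U x * chi T x))"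
    by (simp only: low_poly_def sum_distrib_right mult.assoc)
  also have "\<dots> = (\<Sum>U\<in>low_sets n k. avg n (\<lambda>x. a U * (chi U x * chi T x)))" by (rule avg_sum)
  also have "\<dots> = (\<Sum>U\<in>low_sets n k. a U * avg n (\<lambda>x. chi U x * chi T x))"
    unfolding avg_cmult ..
  also have "\<dots> = (\<Sum>U\<in>low_sets n k. if U = T then a U else 0)"
    using assms by (intro sum.cong refl) (auto simp: low_sets_def avg_chi_mult)
  also have "\<dots> = a T" using assms by (simp add: sum.delta')
  finally show ?thesis .
qed

lemma avg_mult_low_poly:
  "avg n (\<lambda>x. F x * low_poly n k a x) = (\<Sum>T\<in>low_sets n k. a T * avg n (\<lambda>x. F x * chi T x))"
proof -
  have "avg n (\<lambda>x. F x * low_poly n k a x) = avg n (\<lambda>x. \<Sum>T\<in>low_sets n k. a T * (F x * chi T x))"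
    by (simp only: low_poly_def sum_distrib_left mult.left_commute)
  also have "\<dots> = (\<Sum>T\<in>low_sets n k. avg n (\<lambda>x. a T * (F x * chi T x)))" by (rule avg_sum)
  finally show ?thesis unfolding avg_cmult .
qed

lemma avg_low_poly_square: "avg n (\<lambda>x. (low_poly n k a x)\<^sup>2) = (\<Sum>T\<in>low_sets n k. (a T)\<^sup>2)"
  unfolding power2_eq_square avg_mult_low_poly by (intro sum.cong refl) (simp add: avg_low_poly_chi)

lemma bessel:
  "(\<Sum>T\<in>low_sets n k. (avg n (\<lambda>x. F x * chi T x))\<^sup>2) \<le> avg n (\<lambda>x. (F x)\<^sup>2)"
proof -
  define a where "a T = avg n (\<lambda>x. F x * chi T x)" for T
  have "0 \<le> avg n (\<lambda>x. (F x - low_poly n k a x)\<^sup>2)" by (intro avg_nonneg) simp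
  also have "\<dots> = avg n (\<lambda>x. ((F x)\<^sup>2 - 2 * (F x * low_poly n k a x)) + (low_poly n k a x)\<^sup>2)"
    by (intro avg_cong) (simp add: power2_eq_square algebra_simps)
  also have "\<dots> = avg n (\<lambda>x. (F x)\<^sup>2) - 2 * (\<Sum>T\<in>low_sets n k. a T * a T) + (\<Sum>T\<in>low_sets n k. (a T)\<^sup>2)"
    unfolding avg_add avg_diff avg_cmult avg_mult_low_poly avg_low_poly_square by (simp add: a_def)
  finally show ?thesis by (simp add: a_def power2_eq_square)
qed

lemma avg_cauchy_schwarz:
  "(avg n (\<lambda>x. F x * G x))\<^sup>2 \<le> avg n (\<lambda>x. (F x)\<^sup>2) * avg n (\<lambda>x. (G x)\<^sup>2)"
  using Cauchy_Schwarz_ineq_sum[of F G "bit_vectors n"]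
  by (simp add: avg_def power_divide power2_eq_square divide_right_mono)

lemma chi_upd_irrelevant: "i \<notin> T \<Longrightarrow> chi T (x(i := b)) = chi T x"
  unfolding chi_def by (intro prod.cong) auto

lemma low_sets_Suc_0: "low_sets (Suc n) 0 = low_sets n 0"
proof -
  have "low_sets m 0 = {{}}" for m
    using finite_subset[of _ "{1..m}"] by (auto simp: low_sets_def)
  then show ?thesis by simp
qed

lemma low_poly_Suc_0:
  assumes "x \<in> bit_vectors n"
  shows "low_poly (Suc n) 0 a x = low_poly n 0 a x"
    and "low_poly (Suc n) 0 a (x(Suc n := True)) = low_poly n 0 a x"
proof -
  show "low_poly (Suc n) 0 a x = low_poly n 0 a x"
    by (simp add: low_poly_def low_sets_Suc_0)
  have "chi T (x(Suc n := True)) = chi T x" if "T \<in> low_sets n 0" for T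
    using that by (intro chi_upd_irrelevant) (auto simp: low_sets_def)
  then show "low_poly (Suc n) 0 a (x(Suc n := True)) = low_poly n 0 a x"
    unfolding low_poly_def low_sets_Suc_0 by (intro sum.cong) auto
qed

text \<open>Splits off the last sign as preparation for the induction in \<open>bonami\<close>; the
  part multiplied by that sign has one degree less.\<close>

lemma low_poly_Suc_Suc:
  assumes "x \<in> bit_vectors n"
  shows "low_poly (Suc n) (Suc k) a x = low_poly n (Suc k) a x - low_poly n k (\<lambda>T. a (insert (Suc n) T)) x"
    and "low_poly (Suc n) (Suc k) a (x(Suc n := True)) = low_poly n (Suc k) a x + low_poly n k (\<lambda>T. a (insert (Suc n) T)) x"
proof -
  have fin: "finite T" and nin: "Suc n \<notin> T" if "T \<in> low_sets n l" for T l
    using that finite_subset[of T "{1..n}"] by (auto simp: low_sets_def)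
  have sets: "low_sets (Suc n) (Suc k) = low_sets n (Suc k) \<union> insert (Suc n) ` low_sets n k"
  proof (intro set_eqI iffI)
    fix T assume T: "T \<in> low_sets (Suc n) (Suc k)"
    then have finT: "finite T" using finite_subset[of T "{1..Suc n}"] by (auto simp: low_sets_def)
    show "T \<in> low_sets n (Suc k) \<union> insert (Suc n) ` low_sets n k"
    proof (cases "Suc n \<in> T")
      case True
      then have "T = insert (Suc n) (T - {Suc n})" by auto
      moreover have "T - {Suc n} \<in> low_sets n k"
        using T True finT by (auto simp: low_sets_def le_Suc_eq)
      ultimately show ?thesis by blast
    next
      case False
      then have "T \<in> low_sets n (Suc k)" using T by (auto simp: low_sets_def le_Suc_eq)
      then show ?thesis by blast
    qed
  next
    fix T assume "T \<in> low_sets n (Suc k) \<union> insert (Suc n) ` low_sets n k"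
    then show "T \<in> low_sets (Suc n) (Suc k)"
    proof
      assume "T \<in> insert (Suc n) ` low_sets n k"
      then obtain U where U: "U \<in> low_sets n k" "T = insert (Suc n) U" by blast
      have "card T \<le> Suc (card U)" unfolding U(2) by (rule card_insert_le_m1) auto
      then show ?thesis using U by (auto simp: low_sets_def)
    qed (auto simp: low_sets_def)
  qed
  have inj: "inj_on (insert (Suc n)) (low_sets n k)"
    by (rule inj_onI) (metis insert_ident nin)
  have disj: "low_sets n (Suc k) \<inter> insert (Suc n) ` low_sets n k = {}" using nin by blast
  have split: "low_poly (Suc n) (Suc k) a y = low_poly n (Suc k) a y + bsgn (y (Suc n)) * low_poly n k (\<lambda>T. a (insert (Suc n) T)) y" for y
  proof -
    have "low_poly (Suc n) (Suc k) a y = low_poly n (Suc k) a y + (\<Sum>T\<in>low_sets n k. a (insert (Suc n) T) * chi (insert (Suc n) T) y)"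
      unfolding low_poly_def sets by (subst sum.union_disjoint) (auto simp: disj sum.reindex[OF inj])
    also have "(\<Sum>T\<in>low_sets n k. a (insert (Suc n) T) * chi (insert (Suc n) T) y) =
        (\<Sum>T\<in>low_sets n k. bsgn (y (Suc n)) * (a (insert (Suc n) T) * chi T y))"
    proof (intro sum.cong refl)
      fix T assume T: "T \<in> low_sets n k"
      show "a (insert (Suc n) T) * chi (insert (Suc n) T) y = bsgn (y (Suc n)) * (a (insert (Suc n) T) * chi T y)"
        unfolding chi_def prod.insert[OF fin[OF T] nin[OF T]] by simp
    qed
    finally show ?thesis by (simp add: low_poly_def sum_distrib_left)
  qed
  have upd: "low_poly n l b (x(Suc n := True)) = low_poly n l b x" for l b
    unfolding low_poly_def by (intro sum.cong refl arg_cong2[where f="(*)"] chi_upd_irrelevant nin)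
  show "low_poly (Suc n) (Suc k) a x = low_poly n (Suc k) a x - low_poly n k (\<lambda>T. a (insert (Suc n) T)) x"
    unfolding split using bit_vectors_Suc_False[OF assms] by simp
  show "low_poly (Suc n) (Suc k) a (x(Suc n := True)) = low_poly n (Suc k) a x + low_poly n k (\<lambda>T. a (insert (Suc n) T)) x"
    unfolding split upd by simp
qed

text \<open>Induction on the number of bits. With \<open>A\<close> plus or minus \<open>B\<close>
  for the two values of the last bit, odd powers cancel. Cauchy-Schwarz bounds the mixed term with
  the constant \<open>sqrt (9^(l+1) * 9^l) = 3 * 9^l\<close>, and
  \<open>6 * 3 * 9^l = 2 * 9^(l+1)\<close> is exactly the mixed coefficient of
  \<open>9^k (\<alpha> + \<beta>)^2\<close>; this is what the base 9 is made for.\<close>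

lemma bonami:
  "avg n (\<lambda>x. (low_poly n k a x) ^ 4) \<le> 9 ^ k * (avg n (\<lambda>x. (low_poly n k a x)\<^sup>2))\<^sup>2"
proof (induction n arbitrary: k a)
  case 0
  have "avg 0 F = F (\<lambda>_. False)" for F by (simp add: avg_def bit_vectors_0)
  moreover have "1 * (low_poly 0 k a (\<lambda>_. False)) ^ 4 \<le> 9 ^ k * (low_poly 0 k a (\<lambda>_. False)) ^ 4"
    by (intro mult_right_mono) auto
  ultimately show ?case by (simp flip: power_mult)
next
  case (Suc n)
  show ?case
  proof (cases k)
    case 0
    have "avg (Suc n) (\<lambda>x. (low_poly (Suc n) 0 a x) ^ p) = avg n (\<lambda>x. (low_poly n 0 a x) ^ p)" for p
      unfolding avg_Suc by (intro avg_cong) (simp add: low_poly_Suc_0)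
    then show ?thesis using Suc.IH[of 0 a] 0 by simp
  next
    case k: (Suc l)
    define A where "A = low_poly n (Suc l) a"
    define B where "B = low_poly n l (\<lambda>T. a (insert (Suc n) T))"
    define \<alpha> where "\<alpha> = avg n (\<lambda>x. (A x)\<^sup>2)"
    define \<beta> where "\<beta> = avg n (\<lambda>x. (B x)\<^sup>2)"
    have nn: "0 \<le> \<alpha>" "0 \<le> \<beta>" unfolding \<alpha>_def \<beta>_def by (intro avg_nonneg; simp)+
    have sq: "avg (Suc n) (\<lambda>x. (low_poly (Suc n) k a x)\<^sup>2) = \<alpha> + \<beta>"
    proof -
      have "avg (Suc n) (\<lambda>x. (low_poly (Suc n) k a x)\<^sup>2) = avg n (\<lambda>x. (A x)\<^sup>2 + (B x)\<^sup>2)"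
        unfolding avg_Suc k
        by (intro avg_cong) (simp add: low_poly_Suc_Suc A_def B_def power2_eq_square algebra_simps)
      then show ?thesis by (simp add: avg_add \<alpha>_def \<beta>_def)
    qed
    have quart: "avg (Suc n) (\<lambda>x. (low_poly (Suc n) k a x) ^ 4) =
        avg n (\<lambda>x. (A x) ^ 4) + 6 * avg n (\<lambda>x. (A x)\<^sup>2 * (B x)\<^sup>2) + avg n (\<lambda>x. (B x) ^ 4)"
    proof -
      have id: "((u - v) ^ 4 + (u + v) ^ 4) / 2 = u ^ 4 + 6 * (u\<^sup>2 * v\<^sup>2) + v ^ 4" for u v :: real
        by (simp add: power4_eq_xxxx power2_eq_square algebra_simps)
      have "avg (Suc n) (\<lambda>x. (low_poly (Suc n) k a x) ^ 4) = avg n (\<lambda>x. (A x) ^ 4 + 6 * ((A x)\<^sup>2 * (B x)\<^sup>2) + (B x) ^ 4)"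
        unfolding avg_Suc k id[symmetric]
        by (intro avg_cong) (simp add: low_poly_Suc_Suc A_def B_def)
      then show ?thesis unfolding avg_add avg_cmult .
    qed
    have IA: "avg n (\<lambda>x. (A x) ^ 4) \<le> 9 ^ Suc l * \<alpha>\<^sup>2" unfolding A_def \<alpha>_def by (rule Suc.IH)
    have IB: "avg n (\<lambda>x. (B x) ^ 4) \<le> 9 ^ l * \<beta>\<^sup>2" unfolding B_def \<beta>_def by (rule Suc.IH)
    have cross: "avg n (\<lambda>x. (A x)\<^sup>2 * (B x)\<^sup>2) \<le> 3 * 9 ^ l * (\<alpha> * \<beta>)"
    proof (rule power2_le_imp_le)
      have "(avg n (\<lambda>x. (A x)\<^sup>2 * (B x)\<^sup>2))\<^sup>2 \<le> avg n (\<lambda>x. (A x) ^ 4) * avg n (\<lambda>x. (B x) ^ 4)"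
        using avg_cauchy_schwarz[of n "\<lambda>x. (A x)\<^sup>2" "\<lambda>x. (B x)\<^sup>2"] by (simp flip: power_mult)
      also have "\<dots> \<le> (9 ^ Suc l * \<alpha>\<^sup>2) * (9 ^ l * \<beta>\<^sup>2)"
        by (intro mult_mono IA IB avg_nonneg) auto
      also have "\<dots> = (3 * 9 ^ l * (\<alpha> * \<beta>))\<^sup>2"
        by (simp add: power_mult_distrib power2_eq_square mult_ac)
      finally show "(avg n (\<lambda>x. (A x)\<^sup>2 * (B x)\<^sup>2))\<^sup>2 \<le> (3 * 9 ^ l * (\<alpha> * \<beta>))\<^sup>2" .
      show "0 \<le> 3 * 9 ^ l * (\<alpha> * \<beta>)" using nn by simp
    qed
    have "9 ^ l * \<beta>\<^sup>2 \<le> 9 ^ Suc l * \<beta>\<^sup>2" by (intro mult_right_mono power_increasing) auto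
    then have "avg (Suc n) (\<lambda>x. (low_poly (Suc n) k a x) ^ 4) \<le>
        9 ^ Suc l * \<alpha>\<^sup>2 + 6 * (3 * 9 ^ l * (\<alpha> * \<beta>)) + 9 ^ Suc l * \<beta>\<^sup>2"
      unfolding quart using IA IB cross by linarith
    also have "\<dots> = 9 ^ k * (\<alpha> + \<beta>)\<^sup>2"
      by (simp add: k power2_eq_square algebra_simps)
    finally show ?thesis by (simp only: sq)
  qed
qed

section \<open>Bounded functions with prescribed low-degree coefficients\<close>

definition clip :: "real \<Rightarrow> real \<Rightarrow> real" where
  "clip c y = max (- c) (min c y)"

lemma abs_clip_le: "0 \<le> c \<Longrightarrow> \<bar>clip c y\<bar> \<le> c"
  by (auto simp: clip_def)

lemma clip_error:
  assumes "0 < c" shows "(y - clip c y)\<^sup>2 \<le> y ^ 4 / c\<^sup>2"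
proof (cases "\<bar>y\<bar> \<le> c")
  case True
  then have "y - clip c y = 0" by (auto simp: clip_def)
  then show ?thesis by simp
next
  case False
  then have "\<bar>y - clip c y\<bar> \<le> \<bar>y\<bar>" using assms by (auto simp: clip_def)
  then have "(y - clip c y)\<^sup>2 \<le> y\<^sup>2" by (simp add: abs_le_square_iff)
  also have "\<dots> \<le> y\<^sup>2 * (y\<^sup>2 / c\<^sup>2)"
  proof -
    have "c\<^sup>2 \<le> y\<^sup>2" using False assms abs_le_square_iff[of c y] by simp
    then have "y\<^sup>2 * 1 \<le> y\<^sup>2 * (y\<^sup>2 / c\<^sup>2)" using assms by (intro mult_left_mono) auto
    then show ?thesis by simp
  qed
  also have "\<dots> = y ^ 4 / c\<^sup>2" by (simp add: power2_eq_square power4_eq_xxxx)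
  finally show ?thesis .
qed

text \<open>Clipping the polynomial at level \<open>2 \<cdot> 3\<^sup>k\<close> times its norm leaves, by the fourth-moment bound, a remainder of
  at most half the norm; projecting the remainder to low degree and iterating gives \<open>g\<close> as a geometric series.\<close>

lemma bounded_with_low_coeffs:
  assumes \<delta>: "0 < \<delta>" and a: "(\<Sum>T\<in>low_sets n k. (a T)\<^sup>2) \<le> \<delta>\<^sup>2"
  shows "\<exists>g. (\<forall>x. \<bar>g x\<bar> \<le> 4 * 3 ^ k * \<delta>) \<and> (\<forall>T\<in>low_sets n k. avg n (\<lambda>x. g x * chi T x) = a T)"
proof -
  define c where "c i = 2 * 3 ^ k * (\<delta> / 2 ^ i)" for i :: nat
  have c: "0 < c i" for i using \<delta> by (simp add: c_def)
  \<comment> \<open>\<open>b (Suc i)\<close> collects the low coefficients of what clipping at level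
    \<open>c i\<close> cuts off. The clipped part then contributes \<open>b i - b (Suc i)\<close>,
    and these differences telescope to \<open>a\<close>.\<close>
  define step where "step i b T = avg n (\<lambda>x. (low_poly n k b x - clip (c i) (low_poly n k b x)) * chi T x)" for i b T
  define b where "b = rec_nat a step"
  have b0: "b 0 = a" and bS: "b (Suc i) = step i (b i)" for i by (simp_all add: b_def)
  have bnd: "(\<Sum>T\<in>low_sets n k. (b i T)\<^sup>2) \<le> (\<delta> / 2 ^ i)\<^sup>2" for i
  proof (induction i)
    case 0
    then show ?case using a by (simp add: b0)
  next
    case (Suc i)
    define h where "h = low_poly n k (b i)"
    have "(\<Sum>T\<in>low_sets n k. (b (Suc i) T)\<^sup>2) \<le> avg n (\<lambda>x. (h x - clip (c i) (h x))\<^sup>2)"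
      unfolding bS step_def h_def by (rule bessel)
    also have "\<dots> \<le> avg n (\<lambda>x. 1 / (c i)\<^sup>2 * h x ^ 4)"
      by (intro avg_mono) (use clip_error[OF c] in simp)
    also have "\<dots> = 1 / (c i)\<^sup>2 * avg n (\<lambda>x. h x ^ 4)" by (rule avg_cmult)
    also have "\<dots> \<le> 1 / (c i)\<^sup>2 * (9 ^ k * (avg n (\<lambda>x. (h x)\<^sup>2))\<^sup>2)"
      unfolding h_def by (intro mult_left_mono bonami) auto
    also have "\<dots> \<le> 1 / (c i)\<^sup>2 * (9 ^ k * ((\<delta> / 2 ^ i)\<^sup>2)\<^sup>2)"
      unfolding h_def avg_low_poly_square by (intro mult_left_mono power_mono Suc sum_nonneg) auto
    also have "\<dots> = (\<delta> / 2 ^ Suc i)\<^sup>2"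
    proof -
      have "((3::real) ^ k)\<^sup>2 = (3\<^sup>2) ^ k" by (simp only: power_mult[symmetric] mult.commute)
      then have "((3::real) ^ k)\<^sup>2 = 9 ^ k" by simp
      \<comment> \<open>With \<open>d\<close> the current norm bound, the squared remainder is at
        most \<open>9^k * d^4 / (4 * 9^k * d^2) = d^2/4\<close>: the factor 2 in \<open>c i\<close>
        is what halves the norm.\<close>
      then have c2: "(c i)\<^sup>2 = 4 * 9 ^ k * (\<delta> / 2 ^ i)\<^sup>2"
        unfolding c_def power_mult_distrib[of _ "\<delta> / 2 ^ i"] power_mult_distrib[of 2] by simp
      define d where "d = \<delta> / 2 ^ i"
      have d0: "d \<noteq> 0" using \<delta> by (simp add: d_def)
      have e: "\<delta> / 2 ^ Suc i = d / 2" by (simp add: d_def)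
      have aux: "1 / (4 * K * d\<^sup>2) * (K * (d\<^sup>2)\<^sup>2) = (d / 2)\<^sup>2" if "K \<noteq> 0" "d \<noteq> 0" for K d :: real
        using that by (simp add: power2_eq_square)
      show ?thesis unfolding c2 d_def[symmetric] e by (rule aux) (use d0 in auto)
    qed
    finally show ?case .
  qed
  define u where "u i x = clip (c i) (low_poly n k (b i) x)" for i x
  have u_le: "\<bar>u i x\<bar> \<le> c i" for i x unfolding u_def using c[of i] by (intro abs_clip_le) simp
  have c_sums: "c sums (4 * 3 ^ k * \<delta>)"
  proof -
    have "(\<lambda>i. (1 / 2) ^ i) sums (1 / (1 - 1 / 2 :: real))" by (rule geometric_sums) simp
    then have "(\<lambda>i. 2 * 3 ^ k * \<delta> * (1 / 2) ^ i) sums (2 * 3 ^ k * \<delta> * (1 / (1 - 1 / 2)))" by (rule sums_mult)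
    moreover have "c = (\<lambda>i. 2 * 3 ^ k * \<delta> * (1 / 2) ^ i)" by (rule ext) (simp add: c_def power_one_over)
    moreover have "2 * 3 ^ k * \<delta> * (1 / (1 - 1 / 2)) = 4 * 3 ^ k * \<delta>" by simp
    ultimately show ?thesis by (simp only:)
  qed
  have summable_abs: "summable (\<lambda>i. \<bar>u i x\<bar>)" for x
    by (rule summable_comparison_test'[OF sums_summable[OF c_sums], of 0]) (simp add: u_le)
  have summ: "summable (\<lambda>i. u i x)" for x by (rule summable_rabs_cancel[OF summable_abs])
  \<comment> \<open>Clipping makes \<open>g\<close> bounded but destroys low degree; only its low
    coefficients are prescribed.\<close>
  define g where "g x = (\<Sum>i. u i x)" for x
  have g_sums: "(\<lambda>i. u i x) sums g x" for x unfolding g_def by (rule summable_sums[OF summ])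
  have "\<bar>g x\<bar> \<le> 4 * 3 ^ k * \<delta>" for x
  proof -
    have "\<bar>g x\<bar> \<le> (\<Sum>i. \<bar>u i x\<bar>)" unfolding g_def by (rule summable_rabs[OF summable_abs])
    also have "\<dots> \<le> (\<Sum>i. c i)" by (rule suminf_le[OF u_le summable_abs sums_summable[OF c_sums]])
    finally show ?thesis using sums_unique[OF c_sums] by simp
  qed
  moreover have "avg n (\<lambda>x. g x * chi T x) = a T" if T: "T \<in> low_sets n k" for T
  proof -
    have lim: "(\<lambda>i. b i T) \<longlonglongrightarrow> 0"
    proof (rule tendsto_rabs_zero_cancel, rule real_tendsto_sandwich)
      show "\<forall>\<^sub>F i in sequentially. 0 \<le> \<bar>b i T\<bar>" by simp
      have "\<bar>b i T\<bar> \<le> \<delta> / 2 ^ i" for i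
      proof (rule power2_le_imp_le)
        have "(b i T)\<^sup>2 \<le> (\<Sum>T\<in>low_sets n k. (b i T)\<^sup>2)" by (rule member_le_sum[OF T]) auto
        then show "\<bar>b i T\<bar>\<^sup>2 \<le> (\<delta> / 2 ^ i)\<^sup>2" using bnd[of i] by simp
      qed (use \<delta> in simp)
      then show "\<forall>\<^sub>F i in sequentially. \<bar>b i T\<bar> \<le> \<delta> / 2 ^ i" by simp
      have "(\<lambda>i. \<delta> * (1 / 2) ^ i) \<longlonglongrightarrow> \<delta> * 0" by (intro tendsto_mult_left LIMSEQ_power_zero) simp
      then show "(\<lambda>i. \<delta> / 2 ^ i) \<longlonglongrightarrow> 0" by (simp add: power_one_over)
    qed simp
    have diff: "avg n (\<lambda>x. u i x * chi T x) = b i T - b (Suc i) T" for i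
      unfolding bS step_def left_diff_distrib avg_diff avg_low_poly_chi[OF T] u_def by simp
    have "(\<lambda>i. avg n (\<lambda>x. u i x * chi T x)) sums avg n (\<lambda>x. g x * chi T x)"
      unfolding avg_def by (intro sums_divide sums_sum sums_mult2 g_sums)
    moreover have "(\<lambda>i. avg n (\<lambda>x. u i x * chi T x)) sums (b 0 T - 0)"
      unfolding diff by (rule telescope_sums'[OF lim])
    ultimately have "avg n (\<lambda>x. g x * chi T x) = b 0 T - 0" by (rule sums_unique2)
    then show ?thesis by (simp add: b0)
  qed
  ultimately show ?thesis by blast
qed

text \<open>Unlike the sine, \<open>cis\<close> of a sum factors over the bits. A bit in
  \<open>T\<close> contributes \<open>cis t - cis (-t)\<close>, any other bit
  \<open>cis t + cis (-t)\<close>.\<close>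

lemma sum_cis_ssum_chi:
  assumes T: "T \<subseteq> {1..n}"
  shows "(\<Sum>x\<in>bit_vectors n. cis (t * ssum n x) * of_real (chi T x)) =
    2 ^ n * (\<i> * of_real (sin t)) ^ card T * of_real (cos t) ^ (n - card T)"
proof -
  define g where "g i b = cis (t * bsgn b) * of_real (if i \<in> T then bsgn b else 1)" for i b
  have cis_sum: "cis (\<Sum>i\<in>I. f i) = (\<Prod>i\<in>I. cis (f i))" for f :: "nat \<Rightarrow> real" and I
    by (induction I rule: infinite_finite_induct) (simp_all add: cis_mult[symmetric])
  have "(\<Sum>x\<in>bit_vectors n. cis (t * ssum n x) * of_real (chi T x)) = (\<Sum>x\<in>bit_vectors n. \<Prod>i=1..n. g i (x i))"
    unfolding chi_conv_prod[OF T] ssum_def sum_distrib_left cis_sum g_def by (simp add: prod.distrib)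
  also have "\<dots> = (\<Prod>i\<in>{1..n}. g i False + g i True)" by (rule sum_prod_bit_vectors)
  also have "\<dots> = (\<Prod>i\<in>{1..n}. 2 * (if i \<in> T then \<i> * of_real (sin t) else of_real (cos t)))"
    by (intro prod.cong refl) (auto simp: g_def complex_eq_iff)
  also have "\<dots> = 2 ^ n * (\<Prod>i\<in>{1..n}. if i \<in> T then \<i> * of_real (sin t) else of_real (cos t))"
    by (simp add: prod.distrib)
  also have "(\<Prod>i\<in>{1..n}. if i \<in> T then \<i> * of_real (sin t) else of_real (cos t)) =
      (\<i> * of_real (sin t)) ^ card ({1..n} \<inter> T) * of_real (cos t) ^ card ({1..n} - T)"
    by (subst prod.If_cases) (auto simp: Diff_eq)
  also have "{1..n} \<inter> T = T" using T by auto
  also have "card ({1..n} - T) = n - card T" using T finite_subset[OF T] by (subst card_Diff_subset) auto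
  finally show ?thesis by (simp add: mult.assoc)
qed

lemma avg_sin_ssum_chi:
  assumes T: "T \<subseteq> {1..n}"
  shows "\<bar>avg n (\<lambda>x. sin (t * ssum n x) * chi T x)\<bar> \<le> \<bar>sin t\<bar> ^ card T * \<bar>cos t\<bar> ^ (n - card T)"
proof -
  define z where "z = (\<Sum>x\<in>bit_vectors n. cis (t * ssum n x) * of_real (chi T x))"
  have "cmod z = 2 ^ n * (\<bar>sin t\<bar> ^ card T * \<bar>cos t\<bar> ^ (n - card T))"
    unfolding z_def sum_cis_ssum_chi[OF T] norm_mult norm_power by simp
  then have "\<bar>Im z\<bar> \<le> 2 ^ n * (\<bar>sin t\<bar> ^ card T * \<bar>cos t\<bar> ^ (n - card T))"
    using abs_Im_le_cmod[of z] by (simp only:)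
  moreover have "Im z = (\<Sum>x\<in>bit_vectors n. sin (t * ssum n x) * chi T x)" by (simp add: z_def)
  ultimately have "\<bar>\<Sum>x\<in>bit_vectors n. sin (t * ssum n x) * chi T x\<bar> / 2 ^ n \<le>
      2 ^ n * (\<bar>sin t\<bar> ^ card T * \<bar>cos t\<bar> ^ (n - card T)) / 2 ^ n"
    by (intro divide_right_mono) auto
  then show ?thesis by (simp add: avg_def)
qed

lemma avg_cos_ssum: "avg n (\<lambda>x. cos (t * ssum n x)) = cos t ^ n"
proof -
  have "(\<Sum>x\<in>bit_vectors n. cis (t * ssum n x)) = of_real (2 ^ n * cos t ^ n)"
    using sum_cis_ssum_chi[of "{}" n t] by simp
  then have "Re (\<Sum>x\<in>bit_vectors n. cis (t * ssum n x)) = 2 ^ n * cos t ^ n"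
    by (simp only: Re_complex_of_real)
  then show ?thesis by (simp add: avg_def)
qed

text \<open>With \<open>p = sin^2 t\<close> the squared coefficients are bounded by binomial
  weights, so the sum is a binomial lower tail. Inserting \<open>4^(k - card T) \<ge> 1\<close> is
  the exponential Markov step; over all subsets the weights then sum to
  \<open>4^k (1 - 3p/4)^n\<close>.\<close>

lemma sum_sq_sin_coeffs_le:
  "(\<Sum>T\<in>low_sets n k. (avg n (\<lambda>x. sin (t * ssum n x) * chi T x))\<^sup>2) \<le> 4 ^ k * exp (- (3 / 4) * (sin t)\<^sup>2 * real n)"
proof -
  define p where "p = (sin t)\<^sup>2"
  have p: "0 \<le> p" "p \<le> 1" by (auto simp: p_def abs_square_le_1)
  have q: "(cos t)\<^sup>2 = 1 - p" by (simp add: p_def cos_squared_eq)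
  have coef_le: "(avg n (\<lambda>x. sin (t * ssum n x) * chi T x))\<^sup>2 \<le> 4 ^ k * ((p / 4) ^ card T * (1 - p) ^ (n - card T))"
    if "T \<in> low_sets n k" for T
  proof -
    have T: "T \<subseteq> {1..n}" "card T \<le> k" using that by (auto simp: low_sets_def)
    have "(avg n (\<lambda>x. sin (t * ssum n x) * chi T x))\<^sup>2 \<le> (\<bar>sin t\<bar> ^ card T * \<bar>cos t\<bar> ^ (n - card T))\<^sup>2"
      using avg_sin_ssum_chi[OF T(1), of t] by (simp add: abs_le_square_iff[symmetric])
    also have "\<dots> = (\<bar>sin t\<bar>\<^sup>2) ^ card T * (\<bar>cos t\<bar>\<^sup>2) ^ (n - card T)"
      by (simp only: power_mult_distrib power_mult[symmetric] mult.commute)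
    also have "\<dots> = 4 ^ card T * ((p / 4) ^ card T * (1 - p) ^ (n - card T))"
      by (simp add: q p_def[symmetric] power_divide)
    also have "\<dots> \<le> 4 ^ k * ((p / 4) ^ card T * (1 - p) ^ (n - card T))"
      using p T(2) by (intro mult_right_mono power_increasing) auto
    finally show ?thesis .
  qed
  have "(\<Sum>T\<in>low_sets n k. (avg n (\<lambda>x. sin (t * ssum n x) * chi T x))\<^sup>2)
      \<le> (\<Sum>T\<in>low_sets n k. 4 ^ k * ((p / 4) ^ card T * (1 - p) ^ (n - card T)))"
    by (intro sum_mono coef_le)
  also have "\<dots> \<le> (\<Sum>T\<in>Pow {1..n}. 4 ^ k * ((p / 4) ^ card T * (1 - p) ^ (n - card T)))"
    using p by (intro sum_mono2) (auto simp: low_sets_def)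
  also have "\<dots> = 4 ^ k * (\<Sum>T\<in>Pow {1..n}. (\<Prod>i\<in>T. p / 4) * (\<Prod>i\<in>{1..n} - T. 1 - p))"
    unfolding sum_distrib_left
    by (intro sum.cong refl) (auto simp: card_Diff_subset finite_subset)
  also have "\<dots> = 4 ^ k * (p / 4 + (1 - p)) ^ n"
    by (subst prod_add[symmetric]) auto
  also have "\<dots> \<le> 4 ^ k * exp (- (3 / 4) * p) ^ n"
  proof (intro mult_left_mono power_mono)
    show "p / 4 + (1 - p) \<le> exp (- (3 / 4) * p)" using exp_ge_add_one_self[of "- (3 / 4) * p"] by simp
  qed (use p in auto)
  also have "exp (- (3 / 4) * p) ^ n = exp (- (3 / 4) * p * real n)"
    unfolding exp_of_nat_mult[symmetric] by (simp add: mult_ac)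
  finally show ?thesis by (simp add: p_def)
qed

section \<open>The lower bound\<close>

lemma sum_by_parts:
  fixes c v :: "nat \<Rightarrow> real"
  shows "(\<Sum>i<L. c i * (v (Suc i) - v i)) = (\<Sum>i<L. (c i - c (Suc i)) * v (Suc i)) + c L * v L - c 0 * v 0"
  by (induction L) (simp_all add: algebra_simps)

text \<open>Differences of the odd row become the even row weighted by the distance to the centre,
  which brings back a binomial average of \<open>1 - cos\<close>.\<close>

lemma binomial_diff:
  assumes N: "N = 2 * M" and M: "1 \<le> M"
  shows "real ((N - 1) choose (M + i)) - real ((N - 1) choose (M + Suc i)) =
    2 * real (Suc i) / real N * real (N choose (M + Suc i))"
proof -
  define n where "n = N - 1"
  have n: "N = Suc n" using N M by (simp add: n_def)
  have a: "Suc (M + i) * (N choose Suc (M + i)) = N * (n choose (M + i))"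
    using Suc_times_binomial[of "M + i" n] by (simp only: n)
  have b: "N choose Suc (M + i) = (n choose (M + i)) + (n choose Suc (M + i))" by (simp add: n)
  have "real N * (real (n choose (M + i)) - real (n choose Suc (M + i))) =
      2 * (real (Suc (M + i)) * real (N choose Suc (M + i))) - real N * real (N choose Suc (M + i))"
    using arg_cong[OF a, of real] arg_cong[OF b, of real] by (simp only: of_nat_mult of_nat_add) (simp add: algebra_simps)
  also have "\<dots> = 2 * real (Suc i) * real (N choose Suc (M + i))"
    by (simp add: N algebra_simps)
  finally have eq: "real N * (real (n choose (M + i)) - real (n choose Suc (M + i))) = 2 * real (Suc i) * real (N choose Suc (M + i))" .
  have aux: "d = u / m * b" if "m * d = u * b" "m \<noteq> 0" for d u m b :: real
    using that by (simp add: field_simps)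
  have "real N \<noteq> 0" using N M by simp
  from aux[OF eq this] show ?thesis by (simp add: n)
qed

text \<open>The sines change sign. Multiplication by \<open>2 sin t\<close> turns them into
  differences of \<open>1 - cos\<close>, and summation by parts moves the difference onto the
  decreasing binomial coefficients, so that all terms become nonnegative.\<close>

lemma sum_sin_half_binomial:
  assumes N: "N = 2 * M" and M: "1 \<le> M"
  shows "2 * sin t * (\<Sum>i<M. real ((N - 1) choose (M + i)) * sin (t * (2 * real i + 1))) =
    (\<Sum>i<M. 2 * real (Suc i) / real N * real (N choose (M + Suc i)) * (1 - cos (t * (2 * real (Suc i)))))"
proof -
  define v where "v i = 1 - cos (t * (2 * real i))" for i
  have v: "2 * sin t * sin (t * (2 * real i + 1)) = v (Suc i) - v i" for i
  proof -
    have "2 * sin t * sin (t * (2 * real i + 1)) = cos (t - t * (2 * real i + 1)) - cos (t + t * (2 * real i + 1))"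
      unfolding mult.assoc[of 2] sin_times_sin by simp
    also have "t - t * (2 * real i + 1) = - (t * (2 * real i))" by (simp add: algebra_simps)
    also have "t + t * (2 * real i + 1) = t * (2 * real (Suc i))" by (simp add: algebra_simps)
    finally show ?thesis by (simp add: v_def)
  qed
  have "2 * sin t * (\<Sum>i<M. real ((N - 1) choose (M + i)) * sin (t * (2 * real i + 1))) =
      (\<Sum>i<M. real ((N - 1) choose (M + i)) * (v (Suc i) - v i))"
    unfolding v[symmetric] sum_distrib_left by (intro sum.cong refl) (simp only: mult_ac)
  also have "\<dots> = (\<Sum>i<M. (real ((N - 1) choose (M + i)) - real ((N - 1) choose (M + Suc i))) * v (Suc i))"
  proof -
    have "(N - 1) choose (M + M) = 0" using N M by (intro binomial_eq_0) auto
    moreover have "v 0 = 0" by (simp add: v_def)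
    ultimately show ?thesis
      using sum_by_parts[of "\<lambda>i. real ((N - 1) choose (M + i))" v M] by simp
  qed
  finally show ?thesis unfolding binomial_diff[OF N M] v_def .
qed

lemma sum_upper_half:
  fixes g :: "real \<Rightarrow> real"
  assumes N: "N = 2 * M" and g: "\<And>y. g (- y) = g y" "g 0 = 0"
  shows "avg N (\<lambda>x. g (ssum N x)) = 2 * (\<Sum>i<M. real (N choose (M + Suc i)) * g (2 * real (Suc i))) / 2 ^ N"
proof -
  define f where "f j = real (N choose j) * g (2 * real j - real N)" for j
  have "{..N} = {..<M} \<union> ({M} \<union> {Suc M..N})" by (auto simp: N)
  then have "(\<Sum>j\<le>N. f j) = (\<Sum>j<M. f j) + (\<Sum>j\<in>{M} \<union> {Suc M..N}. f j)"
    by (simp only:) (rule sum.union_disjoint; auto)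
  also have "(\<Sum>j\<in>{M} \<union> {Suc M..N}. f j) = f M + (\<Sum>j=Suc M..N. f j)" by simp
  also have "f M = 0" by (simp add: f_def N g)
  also have "(\<Sum>j=Suc M..N. f j) = (\<Sum>i<M. real (N choose (M + Suc i)) * g (2 * real (Suc i)))"
    by (rule sum.reindex_bij_witness[where i="\<lambda>i. M + Suc i" and j="\<lambda>j. j - Suc M"])
       (auto simp: f_def N of_nat_diff intro!: arg_cong[where f=g])
  also have "(\<Sum>j<M. f j) = (\<Sum>i<M. real (N choose (M + Suc i)) * g (2 * real (Suc i)))"
  proof (rule sum.reindex_bij_witness[where i="\<lambda>i. M - Suc i" and j="\<lambda>j. M - Suc j"])
    fix j assume j: "j \<in> {..<M}"
    have 1: "M + Suc (M - Suc j) = N - j" using j by (auto simp: N)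
    have 2: "2 * real (Suc (M - Suc j)) = - (2 * real j - real N)" using j by (auto simp: N of_nat_diff)
    have 3: "N choose (N - j) = N choose j" using j by (intro binomial_symmetric[symmetric]) (auto simp: N)
    show "real (N choose (M + Suc (M - Suc j))) * g (2 * real (Suc (M - Suc j))) = f j"
      unfolding 1 2 3 g f_def ..
  qed auto
  finally show ?thesis unfolding avg_ssum f_def by simp
qed

text \<open>The weight \<open>Suc i\<close> is replaced by \<open>R\<close>, and the indices with
  \<open>Suc i < R\<close>, where this fails, are given up at a cost of at most
  \<open>2 * (N choose M)\<close> each. Without weights the full sum is, up to \<open>2^N\<close>,
  half the mean of \<open>1 - cos(tS)\<close>, which is explicit.\<close>

lemma sum_sin_half_binomial_lower:
  assumes N: "N = 2 * M" and R: "1 \<le> R"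
  shows "2 * real R / real N * (2 ^ N * (1 - cos t ^ N) / 2 - 2 * real (R - 1) * real (N choose M)) \<le>
    (\<Sum>i<M. 2 * real (Suc i) / real N * real (N choose (M + Suc i)) * (1 - cos (t * (2 * real (Suc i)))))"
proof -
  define v where "v i = real (N choose (M + Suc i)) * (1 - cos (t * (2 * real (Suc i))))" for i
  have v0: "0 \<le> v i" for i by (simp add: v_def)
  have vle: "v i \<le> 2 * real (N choose M)" for i
  proof -
    have "v i \<le> real (N choose M) * 2"
      unfolding v_def using binomial_maximum'[of M] cos_ge_minus_one[of "t * (2 * real (Suc i))"]
      by (intro mult_mono) (auto simp: N)
    then show ?thesis by simp
  qed
  have "2 ^ N * (1 - cos t ^ N) = 2 ^ N * avg N (\<lambda>x. 1 - cos (t * ssum N x))"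
    by (simp add: avg_diff avg_cos_ssum)
  also have "\<dots> = 2 * (\<Sum>i<M. v i)"
    unfolding v_def by (subst sum_upper_half[OF N]) auto
  finally have tot: "2 ^ N * (1 - cos t ^ N) / 2 = (\<Sum>i<M. v i)" by simp
  have "(\<Sum>i<M. if i < R - 1 then 2 * real (N choose M) else 0) \<le> (\<Sum>i<R - 1. 2 * real (N choose M))"
  proof -
    have "(\<Sum>i<M. if i < R - 1 then 2 * real (N choose M) else 0) = (\<Sum>i\<in>{..<M} \<inter> {..<R - 1}. 2 * real (N choose M))"
      by (subst sum.inter_restrict) auto
    also have "\<dots> \<le> (\<Sum>i<R - 1. 2 * real (N choose M))" by (rule sum_mono2) auto
    finally show ?thesis .
  qed
  then have low: "(\<Sum>i<M. if i < R - 1 then 2 * real (N choose M) else 0) \<le> 2 * real (R - 1) * real (N choose M)"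
    by (simp add: mult_ac)
  have "2 * real R / real N * (2 ^ N * (1 - cos t ^ N) / 2 - 2 * real (R - 1) * real (N choose M)) \<le>
      2 * real R / real N * (\<Sum>i<M. v i - (if i < R - 1 then 2 * real (N choose M) else 0))"
    using low unfolding tot sum_subtractf by (intro mult_left_mono) auto
  also have "\<dots> \<le> (\<Sum>i<M. 2 * real (Suc i) / real N * v i)"
    unfolding sum_distrib_left
  proof (intro sum_mono)
    fix i
    show "2 * real R / real N * (v i - (if i < R - 1 then 2 * real (N choose M) else 0)) \<le> 2 * real (Suc i) / real N * v i"
    proof (cases "i < R - 1")
      case True
      then have "2 * real R / real N * (v i - (if i < R - 1 then 2 * real (N choose M) else 0)) \<le> 0"
        using vle[of i] by (intro mult_nonneg_nonpos) auto
      also have "0 \<le> 2 * real (Suc i) / real N * v i" using v0[of i] by simp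
      finally show ?thesis .
    next
      case False
      have "2 * real R / real N * v i \<le> 2 * real (Suc i) / real N * v i"
        using False v0[of i] by (intro mult_right_mono divide_right_mono) auto
      then show ?thesis using False by simp
    qed
  qed
  finally show ?thesis by (simp only: v_def mult.assoc)
qed

lemma avg_sin_maj:
  assumes n: "n + 1 = 2 * M" and M: "1 \<le> M"
  shows "avg n (\<lambda>x. sin (t * ssum n x) * of_bool (maj n x)) =
    (\<Sum>i<M. real (n choose (M + i)) * sin (t * (2 * real i + 1))) / 2 ^ n"
proof -
  have "avg n (\<lambda>x. sin (t * ssum n x) * of_bool (maj n x)) =
      (\<Sum>j\<le>n. real (n choose j) * (sin (t * (2 * real j - real n)) * of_bool (0 < 2 * real j - real n))) / 2 ^ n"
    unfolding maj_iff by (rule avg_ssum)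
  also have "(\<Sum>j\<le>n. real (n choose j) * (sin (t * (2 * real j - real n)) * of_bool (0 < 2 * real j - real n))) =
      (\<Sum>j\<in>{M..n}. real (n choose j) * sin (t * (2 * real j - real n)))"
    using n by (intro sum.mono_neutral_cong_right) auto
  also have "\<dots> = (\<Sum>i<M. real (n choose (M + i)) * sin (t * (2 * real i + 1)))"
  proof (rule sum.reindex_bij_witness[where i="\<lambda>i. M + i" and j="\<lambda>j. j - M"])
    fix j assume "j \<in> {M..n}"
    then have j: "M + (j - M) = j" "2 * real (j - M) + 1 = 2 * real j - real n"
      using n by (auto simp: of_nat_diff)
    show "real (n choose (M + (j - M))) * sin (t * (2 * real (j - M) + 1)) = real (n choose j) * sin (t * (2 * real j - real n))"
      unfolding j ..
  qed (use n in auto)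
  finally show ?thesis .
qed

text \<open>\<open>R\<close> about \<open>sqrt N / 8\<close> trades its linear gain against the
  discarded central mass: with \<open>c sqrt N \<le> 0.82\<close> the loss is at most 0.205 out of
  nearly 1/2. Division by \<open>s sin t \<le> 6 sqrt k\<close> leaves \<open>0.07/6\<close>, more
  than \<open>1/100\<close>.\<close>

lemma avg_sin_maj_lower:
  assumes n: "odd n" and k: "2 \<le> k" "32 * k \<le> n" and t: "0 < sin t" "(sin t)\<^sup>2 = 32 * real k / real n"
  shows "1 / (100 * sqrt (real k)) \<le> avg n (\<lambda>x. sin (t * ssum n x) * of_bool (maj n x))"
proof -
  define M where "M = Suc n div 2"
  define N where "N = Suc n"
  have N: "N = 2 * M" "n + 1 = 2 * M" "N - 1 = n" using n by (auto simp: M_def N_def elim: oddE)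
  have n64: "64 \<le> n" using k by simp
  have M: "1 \<le> M" using N n64 by simp
  define B where "B = avg n (\<lambda>x. sin (t * ssum n x) * of_bool (maj n x))"
  define s where "s = sqrt (real N)"
  have s: "0 < s" "s * s = real N" using N M by (auto simp: s_def)
  define R where "R = nat \<lceil>s / 8\<rceil>"
  have R: "1 \<le> R" "s / 8 \<le> real R" "real (R - 1) \<le> s / 8"
    using s(1) by (auto simp: R_def of_nat_diff) linarith+
  define c where "c = real (N choose M) / 2 ^ N"
  have c: "0 \<le> c" "c * s \<le> 82 / 100"
  proof -
    show "0 \<le> c" by (simp add: c_def)
    have "((2::real) ^ N)\<^sup>2 = (2 ^ 4) ^ M" unfolding N power_mult[symmetric] by (simp add: mult.commute)
    then have p: "((2::real) ^ N)\<^sup>2 = 16 ^ M" by simp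
    have "(real (N choose M))\<^sup>2 * (3 / 2 * real N) \<le> (real (N choose M))\<^sup>2 * (3 * real M + 1)"
      by (intro mult_left_mono) (auto simp: N(1))
    also have "\<dots> \<le> 16 ^ M" using central_binomial_upper[of M] by (simp add: N(1))
    finally have "c\<^sup>2 * (3 / 2 * real N) \<le> 1"
      unfolding c_def power_divide p by (simp add: divide_le_eq)
    then have "(c * s)\<^sup>2 \<le> 2 / 3" by (simp add: power2_eq_square flip: s(2)) (simp add: algebra_simps)
    also have "\<dots> \<le> (82 / 100)\<^sup>2" by (simp add: power2_eq_square)
    finally show "c * s \<le> 82 / 100" by (rule power2_le_imp_le) simp
  qed
  have cosN: "cos t ^ N \<le> 1 / 100"
  proof -
    have "cos t ^ N = ((cos t)\<^sup>2) ^ M" by (simp add: N(1) power_mult)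
    also have "(cos t)\<^sup>2 = 1 - 32 * real k / real n" using t(2) by (simp add: cos_squared_eq)
    also have "(1 - 32 * real k / real n) ^ M \<le> exp (- (32 * real k / real n)) ^ M"
      using k n64 exp_ge_add_one_self[of "- (32 * real k / real n)"] by (intro power_mono) (auto simp: field_simps)
    also have "\<dots> = exp (- (32 * real k / real n) * real M)"
      unfolding exp_of_nat_mult[symmetric] by (simp add: mult_ac)
    also have "\<dots> \<le> exp (- 32)"
    proof -
      have "real n / 2 \<le> real M" using N by simp
      then have "32 * real k / real n * (real n / 2) \<le> 32 * real k / real n * real M"
        by (intro mult_left_mono) auto
      moreover have "32 * real k / real n * (real n / 2) = 16 * real k" using n64 by simp
      ultimately show ?thesis using k by simp
    qed
    also have "\<dots> \<le> 1 / 100"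
    proof -
      have "2 ^ 32 \<le> exp (1::real) ^ 32" using exp_ge_add_one_self[of "1::real"] by (intro power_mono) auto
      also have "\<dots> = exp 32" by (simp add: exp_of_nat_mult[symmetric])
      finally show ?thesis by (simp add: exp_minus field_simps)
    qed
    finally show ?thesis .
  qed
  have "2 * real (R - 1) * c \<le> 2 * (s / 8) * c" using R c by (intro mult_right_mono mult_left_mono) auto
  also have "\<dots> \<le> 205 / 1000" using c(2) by (simp add: mult_ac)
  finally have Rc: "2 * real (R - 1) * c \<le> 205 / 1000" .
  have gap: "28 / 100 \<le> (1 - cos t ^ N) / 2 - 2 * real (R - 1) * c"
  proof -
    have "28 / 100 \<le> (1 - y) / 2 - X" if "y \<le> 1 / 100" "X \<le> 205 / 1000" for X y :: real
    proof -
      have "(1 - y) / 2 = 1 / 2 - y / 2" by (simp add: diff_divide_distrib)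
      then show ?thesis using that by linarith
    qed
    from this[OF cosN Rc] show ?thesis .
  qed
  have "1 / 4 / s * (28 / 100) = 2 * (s / 8) / real N * (28 / 100)"
    using s by (simp add: field_simps flip: s(2))
  also have "\<dots> \<le> 2 * real R / real N * ((1 - cos t ^ N) / 2 - 2 * real (R - 1) * c)"
    using R(2) s(1) by (intro mult_mono divide_right_mono gap) auto
  also have "\<dots> = 2 * real R / real N * (2 ^ N * (1 - cos t ^ N) / 2 - 2 * real (R - 1) * real (N choose M)) / 2 ^ N"
    by (simp add: c_def field_simps)
  also have "\<dots> \<le> 2 * sin t * (\<Sum>i<M. real (n choose (M + i)) * sin (t * (2 * real i + 1))) / 2 ^ N"
    using sum_sin_half_binomial_lower[OF N(1) R(1), of t] sum_sin_half_binomial[OF N(1) M, of t] N(3)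
    by (intro divide_right_mono) auto
  also have "\<dots> = sin t * B" unfolding B_def avg_sin_maj[OF N(2) M] by (simp add: N_def)
  finally have main: "7 / 100 \<le> s * sin t * B" using s by (simp add: field_simps)
  have "(s * sin t)\<^sup>2 = s * s * (sin t)\<^sup>2" by (simp add: power2_eq_square)
  also have "\<dots> = real N * (32 * real k / real n)" unfolding s(2) t(2) ..
  also have "\<dots> = real N / real n * (32 * real k)" by simp
  also have "\<dots> \<le> 9 / 8 * (32 * real k)"
    using n64 by (intro mult_right_mono) (auto simp: N_def field_simps)
  also have "\<dots> = 36 * real k" by simp
  finally have "s * sin t \<le> sqrt (36 * real k)" by (rule real_le_rsqrt)
  also have "\<dots> = 6 * sqrt (real k)" by (simp add: real_sqrt_mult)
  finally have st: "s * sin t \<le> 6 * sqrt (real k)" .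
  have st0: "0 < s * sin t" using s t by simp
  have B0: "0 \<le> B" 
  proof (rule ccontr)
    assume "\<not> 0 \<le> B"
    then have "s * sin t * B \<le> 0" using st0 by (intro mult_nonneg_nonpos) auto
    then show False using main by simp
  qed
  have "7 / 100 \<le> 6 * sqrt (real k) * B" using mult_right_mono[OF st B0] main by simp
  then show ?thesis unfolding B_def[symmetric] using k B0 by (simp add: field_simps)
qed

text \<open>\<open>g\<close> has the low coefficients of the sine wave \<open>f\<close>, so the
  density \<open>1 + (f - g)/2\<close> is \<open>k\<close>-wise independent. The bound
  \<open>4 * (3/2048)^k\<close> on \<open>g\<close> is at most half the correlation
  \<open>1/(100 sqrt k)\<close> of \<open>f\<close> with majority, and
  \<open>(1/100 - 1/200)/2 = 1/400\<close>.\<close>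

lemma kwise_lower_large:
  assumes n: "odd n" and k: "2 \<le> k" "32 * k \<le> n"
  shows "\<exists>Q\<in>kwise_dists n k (1 / 2). 1 / (400 * sqrt (real k)) \<le> maj_bias n Q"
proof -
  have n0: "0 < n" using k by simp
  define t where "t = arcsin (sqrt (32 * real k / real n))"
  have p: "32 * real k / real n \<le> 1" using k n0 by simp
  have st: "sin t = sqrt (32 * real k / real n)"
    unfolding t_def using p by (intro sin_arcsin) (auto intro: order_trans[of _ 0])
  have t: "0 < sin t" "(sin t)\<^sup>2 = 32 * real k / real n" using k n0 by (auto simp: st)
  define f where "f x = sin (t * ssum n x)" for x
  \<comment> \<open>Chosen so that \<open>4^k * 2^(-24k) = \<delta>^2\<close>, with
    \<open>exp (-24k)\<close> relaxed to \<open>2^(-24k)\<close>.\<close>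
  define \<delta> :: real where "\<delta> = 1 / 2 ^ (11 * k)"
  have \<delta>: "0 < \<delta>" by (simp add: \<delta>_def)
  have "(\<Sum>T\<in>low_sets n k. (avg n (\<lambda>x. f x * chi T x))\<^sup>2) \<le> 4 ^ k * exp (- (24 * real k))"
    using sum_sq_sin_coeffs_le[of n t k] n0 unfolding t(2) f_def by simp
  also have "\<dots> \<le> 4 ^ k * (1 / 2 ^ (24 * k))"
  proof (intro mult_left_mono)
    have "2 ^ (24 * k) \<le> exp (1::real) ^ (24 * k)" using exp_ge_add_one_self[of "1::real"] by (intro power_mono) auto
    also have "\<dots> = exp (24 * real k)" by (simp add: exp_of_nat_mult[symmetric])
    finally show "exp (- (24 * real k)) \<le> 1 / 2 ^ (24 * k)" by (simp add: exp_minus field_simps)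
  qed simp
  also have "\<dots> = \<delta>\<^sup>2"
  proof -
    have "(4::real) ^ k = 2 ^ (2 * k)" by (simp add: power_mult)
    moreover have "(2::real) ^ (24 * k) = 2 ^ (2 * k) * 2 ^ (22 * k)" by (simp flip: power_add)
    moreover have "((2::real) ^ (11 * k))\<^sup>2 = 2 ^ (22 * k)" by (simp flip: power_mult)
    ultimately show ?thesis by (simp add: \<delta>_def power_divide)
  qed
  finally have "(\<Sum>T\<in>low_sets n k. (avg n (\<lambda>x. f x * chi T x))\<^sup>2) \<le> \<delta>\<^sup>2" .
  from bounded_with_low_coeffs[OF \<delta> this] obtain g where
    g: "\<And>x. \<bar>g x\<bar> \<le> 4 * 3 ^ k * \<delta>" and
    coef: "\<And>T. T \<in> low_sets n k \<Longrightarrow> avg n (\<lambda>x. g x * chi T x) = avg n (\<lambda>x. f x * chi T x)"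
    by blast
  have small: "800 * sqrt (real k) * (4 * 3 ^ k * \<delta>) \<le> 4"
  proof -
    have "sqrt (real k) \<le> real k" using k by (intro real_le_lsqrt) (auto simp: power2_eq_square)
    moreover have "800 * real k \<le> 512 ^ k"
      using k(1)
    proof (induction k rule: nat_induct_at_least)
      case (Suc k)
      have "800 * real (Suc k) \<le> 512 * (800 * real k)" using Suc.hyps by simp
      also have "\<dots> \<le> 512 * 512 ^ k" using Suc.IH by simp
      finally show ?case by simp
    qed simp
    ultimately have "800 * sqrt (real k) \<le> 512 ^ k" by linarith
    \<comment> \<open>\<open>2^11 = 4 * 512\<close>: the 4 absorbs the hypercontractive 3, and the
      512 absorbs \<open>800 sqrt k\<close>.\<close>
    moreover have "3 ^ k * \<delta> \<le> 1 / 512 ^ k"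
    proof -
      have "(3::real) ^ k \<le> 4 ^ k" by (intro power_mono) auto
      moreover have "(2::real) ^ (11 * k) = 512 ^ k * 4 ^ k"
        by (simp add: power_mult flip: power_mult_distrib)
      ultimately show ?thesis by (simp add: \<delta>_def field_simps)
    qed
    ultimately have "(800 * sqrt (real k)) * (3 ^ k * \<delta>) \<le> 512 ^ k * (1 / 512 ^ k)"
      using \<delta> by (intro mult_mono) auto
    also have "\<dots> = 1" by simp
    finally have "4 * ((800 * sqrt (real k)) * (3 ^ k * \<delta>)) \<le> 4 * 1" by (intro mult_left_mono) auto
    then have "4 * ((800 * sqrt (real k)) * (3 ^ k * \<delta>)) \<le> 4" by (simp only: mult_1_right)
    then show ?thesis by (simp only: mult_ac)
  qed
  define \<eta> where "\<eta> = 4 * 3 ^ k * \<delta>"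
  have \<eta>: "\<eta> \<le> 1 / (200 * sqrt (real k))" "\<eta> \<le> 1"
  proof -
    show *: "\<eta> \<le> 1 / (200 * sqrt (real k))" using small k by (simp add: \<eta>_def field_simps)
    have "1 \<le> sqrt (real k)" using k by simp
    then have "1 \<le> 200 * sqrt (real k)" by linarith
    then have "1 / (200 * sqrt (real k)) \<le> 1" using k by (subst divide_le_eq_1_pos) auto
    then show "\<eta> \<le> 1" using * by linarith
  qed
  \<comment> \<open>The factor 1/2 keeps \<open>w\<close> nonnegative, since \<open>f\<close> and
    \<open>g\<close> are both bounded by 1.\<close>
  define w where "w x = 1 + (f x - g x) / 2" for x
  have w0: "0 \<le> w x" for x
  proof -
    have "\<bar>f x\<bar> \<le> 1" by (simp add: f_def)
    then show ?thesis using g[of x] \<eta>(2) unfolding w_def \<eta>_def diff_divide_distrib by linarith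
  qed
  have orth: "avg n (\<lambda>x. (f x - g x) / 2 * chi T x) = 0" if "T \<in> low_sets n k" for T
  proof -
    have "avg n (\<lambda>x. (f x - g x) / 2 * chi T x) = avg n (\<lambda>x. 1 / 2 * (f x * chi T x - g x * chi T x))"
      by (intro avg_cong) (simp add: left_diff_distrib)
    then show ?thesis unfolding avg_cmult avg_diff using coef[OF that] by simp
  qed
  \<comment> \<open>The empty set is a low set, so \<open>g\<close> also matches the mean of
    \<open>f\<close> and the total mass stays 1.\<close>
  have "{} \<in> low_sets n k" by (simp add: low_sets_def)
  from orth[OF this] have w1: "avg n w = 1"
    unfolding w_def avg_add by simp
  have Q: "density_pmf n w \<in> kwise_dists n k (1 / 2)"
  proof (rule density_pmf_kwise)
    fix T :: "nat set" assume T: "T \<subseteq> {1..n}" "T \<noteq> {}" "card T \<le> k"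
    have "avg n (\<lambda>x. w x * chi T x) = avg n (\<lambda>x. chi T x + (f x - g x) / 2 * chi T x)"
      by (simp add: w_def distrib_right)
    also have "\<dots> = 0" using T orth[of T] avg_chi[OF T(1)] unfolding avg_add by (simp add: low_sets_def)
    finally show "avg n (\<lambda>x. w x * chi T x) = 0" .
  qed (use w0 w1 k in auto)
  have "maj_bias n (density_pmf n w) = \<bar>avg n (\<lambda>x. w x * of_bool (maj n x)) - 1 / 2\<bar>"
    by (rule maj_bias_density_pmf[OF w0 w1])
  also have "avg n (\<lambda>x. w x * of_bool (maj n x)) =
      avg n (\<lambda>x. of_bool (maj n x) + 1 / 2 * (f x * of_bool (maj n x) - g x * of_bool (maj n x)))"
    by (intro avg_cong) (simp only: w_def distrib_right left_diff_distrib mult_1_left times_divide_eq_left)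
  also have "\<dots> = 1 / 2 + (avg n (\<lambda>x. f x * of_bool (maj n x)) - avg n (\<lambda>x. g x * of_bool (maj n x))) / 2"
    unfolding avg_add avg_cmult avg_diff avg_maj[OF n] by simp
  finally have bias: "(avg n (\<lambda>x. f x * of_bool (maj n x)) - avg n (\<lambda>x. g x * of_bool (maj n x))) / 2 \<le> maj_bias n (density_pmf n w)"
    by simp
  have "avg n (\<lambda>x. g x * of_bool (maj n x)) \<le> avg n (\<lambda>x. \<eta>)"
  proof (rule avg_mono)
    fix x show "g x * of_bool (maj n x) \<le> \<eta>" using g[of x] \<delta> by (cases "maj n x") (auto simp: \<eta>_def)
  qed
  then have "avg n (\<lambda>x. g x * of_bool (maj n x)) \<le> 1 / (200 * sqrt (real k))" using \<eta>(1) by simp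
  moreover have "1 / (100 * sqrt (real k)) \<le> avg n (\<lambda>x. f x * of_bool (maj n x))"
    unfolding f_def by (rule avg_sin_maj_lower[OF n k t])
  moreover have "1 / (100 * sqrt (real k)) = 2 * (1 / (200 * sqrt (real k)))"
    "1 / (400 * sqrt (real k)) = 1 / (200 * sqrt (real k)) / 2" by simp_all
  ultimately have "1 / (400 * sqrt (real k)) \<le> maj_bias n (density_pmf n w)" using bias unfolding diff_divide_distrib by linarith
  then show ?thesis using Q by blast
qed

lemma kwise_lower:
  assumes n: "odd n" and k: "2 \<le> k" "k < n"
  shows "\<exists>Q\<in>kwise_dists n k (1 / 2). 1 / (400 * sqrt (real k)) \<le> maj_bias n Q"
proof (cases "32 * k \<le> n")
  case True
  then show ?thesis using kwise_lower_large[OF n k(1)] by blast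
next
  case False
  \<comment> \<open>36 is the next square above 32.\<close>
  have "sqrt (real n) \<le> sqrt (36 * real k)" using False by simp
  also have "\<dots> = 6 * sqrt (real k)" by (simp add: real_sqrt_mult)
  finally have "3 * sqrt (real n) \<le> 3 * (6 * sqrt (real k))" by simp
  also have "\<dots> \<le> 400 * sqrt (real k)" by simp
  finally have "3 * sqrt (real n) \<le> 400 * sqrt (real k)" .
  then have "1 / (400 * sqrt (real k)) \<le> 1 / (3 * sqrt (real n))" using k by (intro divide_left_mono) auto
  also have "\<dots> \<le> maj_bias n (xor0 n)" by (rule maj_bias_xor0_ge[OF n])
  finally show ?thesis using xor0_kwise[OF n _ k(2)] k(1) by auto
qed

theorem theorem10:
  "(\<exists>C::real. C > 0 \<and>
      (\<forall>n k::nat. odd n \<and> even k \<and> 2 \<le> k \<and> k < n \<longrightarrow>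
        (\<exists>Q. is_arg_max (maj_bias n) (\<lambda>Q. Q \<in> kwise_dists n k (1 / 2)) Q \<and>
             C / sqrt (real k * ln (real k)) \<le> maj_bias n Q \<and>
             maj_bias n Q \<le> 2 * sqrt 2 / sqrt (real k)))) \<and>
   (\<forall>n::nat. odd n \<longrightarrow>
      (1 < n \<longrightarrow> xor0 n \<in> kwise_dists n (n - 1) (1 / 2)) \<and>
      maj_bias n (xor0 n) \<ge> 1 / (3 * sqrt (real n)))"
proof (intro conjI allI impI)
  \<comment> \<open>The bound at hand is \<open>1/(400 sqrt k)\<close>; the factor
    \<open>sqrt (ln 2)\<close> makes up for \<open>ln k < 1\<close> at \<open>k = 2\<close>, since
    \<open>ln k \<ge> ln 2\<close> throughout.\<close>
  define C where "C = sqrt (ln 2) / 400"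
  have C: "0 < C" by (simp add: C_def)
  show "\<exists>C::real. C > 0 \<and>
      (\<forall>n k::nat. odd n \<and> even k \<and> 2 \<le> k \<and> k < n \<longrightarrow>
        (\<exists>Q. is_arg_max (maj_bias n) (\<lambda>Q. Q \<in> kwise_dists n k (1 / 2)) Q \<and>
             C / sqrt (real k * ln (real k)) \<le> maj_bias n Q \<and>
             maj_bias n Q \<le> 2 * sqrt 2 / sqrt (real k)))"
  proof (intro exI[of _ C] conjI allI impI C)
    fix n k :: nat assume "odd n \<and> even k \<and> 2 \<le> k \<and> k < n"
    then have n: "odd n" and k: "even k" "2 \<le> k" "k < n" by auto
    obtain Q0 where Q0: "Q0 \<in> kwise_dists n k (1 / 2)" "1 / (400 * sqrt (real k)) \<le> maj_bias n Q0"
      using kwise_lower[OF n k(2,3)] by blast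
    obtain Q where Q: "is_arg_max (maj_bias n) (\<lambda>Q. Q \<in> kwise_dists n k (1 / 2)) Q"
      using kwise_arg_max_exists[OF Q0(1)] k by auto
    have "C / sqrt (real k * ln (real k)) = sqrt (ln 2) / sqrt (ln (real k)) * (1 / (400 * sqrt (real k)))"
      by (simp add: C_def real_sqrt_mult)
    also have "\<dots> \<le> 1 * (1 / (400 * sqrt (real k)))"
      using k by (intro mult_right_mono) auto
    also have "\<dots> \<le> maj_bias n Q0" using Q0(2) by simp
    also have "\<dots> \<le> maj_bias n Q" using Q Q0(1) by (auto simp: is_arg_max_def not_less)
    finally have "C / sqrt (real k * ln (real k)) \<le> maj_bias n Q" .
    moreover have "maj_bias n Q \<le> 2 * sqrt 2 / sqrt (real k)"
      using Q by (intro kwise_maj_bias_upper[OF _ n k]) (simp add: is_arg_max_def)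
    ultimately show "\<exists>Q. is_arg_max (maj_bias n) (\<lambda>Q. Q \<in> kwise_dists n k (1 / 2)) Q \<and>
             C / sqrt (real k * ln (real k)) \<le> maj_bias n Q \<and>
             maj_bias n Q \<le> 2 * sqrt 2 / sqrt (real k)"
      using Q by blast
  qed
next
  fix n :: nat assume n: "odd n" "1 < n"
  then show "xor0 n \<in> kwise_dists n (n - 1) (1 / 2)" by (intro xor0_kwise) auto
next
  fix n :: nat assume "odd n"
  then show "1 / (3 * sqrt (real n)) \<le> maj_bias n (xor0 n)" by (rule maj_bias_xor0_ge)
qed

end
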